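(* Let $\theta>0$, let $E$ be a compact metric space, let $\pi$ be a probability measure on $E$, and let $Z\sim\mathrm{DP}(\theta,\pi)$. Let $k\ge1$ be an integer, let $\phi:E^k\to\mathbb{R}$ be continuous, and let $h(\mu)=\langle\phi,\mu^k\rangle$ for $\mu\in M_1(E)$. Then the solution $f_h$ (given in the context) of the Stein equation $$\mathcal{A}_2f_h(\mu)=h(\mu)-\mathbb{E}h(Z),\qquad \mu\in M_1(E),$$ is well defined and $$\sup_x\|\partial_xf_h\|_\infty\le\frac{2k}{\theta}\|\phi\|_\infty,$$ $$\sup_{x,y}\|\partial_{xy}f_h\|_\infty\le\frac{k(k-1)}{\theta+1}\|\phi\|_\infty,$$ $$\sup_{x,y,z}\|\partial_{xyz}f_h\|_\infty\le\frac{2k(k-1)(k-2)}{3(\theta+2)}\|\phi\|_\infty,$$ where the suprema are over $x,y,z\in E$.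
   Context: $M_1(E)$ is the space of Borel probability measures on $E$. $\mu^k$ is the $k$-fold product measure, $\langle\phi,\mu^k\rangle=\int_{E^k}\phi\,d\mu^k$, and $\mathrm{C}(E^j)$ is the space of continuous real functions on $E^j$ ($\mathrm{C}(E^0)=\mathbb{R}$). Dirichlet process: $\mathrm{DP}(\theta,\pi)$ is the law of the random probability measure $\sum_{i=1}^\infty P_i\delta_{\xi_i}$ on $E$, where $(P_1,P_2,\dots)$ has the one-parameter Poisson–Dirichlet distribution $\mathrm{PD}(\theta)$ and is independent of $\xi_1,\xi_2,\dots$, which are i.i.d. with distribution $\pi$. ($\mathrm{PD}(\theta)$ is, for instance, the law of the non-increasing rearrangement of $\big(V_i\prod_{j<i}(1-V_j)\big)_{i\ge1}$ with $V_1,V_2,\dots$ i.i.d. $\mathrm{Beta}(1,\theta)$.) Derivatives: for a function $F$ of finite measures on $E$ and $x\in E$, $$\partial_xF(\mu)=\lim_{\varepsilon\to0^+}\frac{F(\mu+\varepsilon\delta_x)-F(\mu)}{\varepsilon},$$ and $\partial_{xy}$, $\partial_{xyz}$ are the corresponding iterated derivatives. For such derivatives, $\|\cdot\|_\infty$ denotes the supremum over $\mu\in M_1(E)$; $\|\phi\|_\infty$ is the supremum over $E^k$. Generator: $\mathcal{A}_2$ is the generator of the Fleming–Viot process, whose unique stationary distribution is $\mathrm{DP}(\theta,\pi)$: $$\mathcal{A}_2f(\mu)=\frac{\theta}{2}\int_E\partial_xf(\mu)\,(\pi-\mu)(dx)+\frac12\int_{E^2}\big(\mu(dx)\delta_x(dy)-\mu(dx)\mu(dy)\big)\partial_{xy}f(\mu).$$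 $(Z_\mu(t))_{t\ge0}$ denotes the Fleming–Viot process with generator $\mathcal{A}_2$ and $Z_\mu(0)=\mu$. Dual process: $(Y_\phi(t))_{t\ge0}$ is the pure-jump Markov process on $\bigcup_{j\ge0}\mathrm{C}(E^j)$ with $Y_\phi(0)=\phi$ and the following transitions from a state $\psi\in\mathrm{C}(E^m)$. For each $1\le i<j\le m$, at rate $1$, it jumps to $\Phi^{(m)}_{ij}\psi\in \mathrm{C}(E^{m-1})$, where $\Phi^{(m)}_{ij}\psi(x_1,\dots,x_{m-1})=\psi(x_1,\dots,x_{j-1},x_i,x_j,\dots,x_{m-1})$. For each $1\le i\le m$, at rate $\theta/2$, it jumps to the function in $\mathrm{C}(E^{m-1})$ obtained by integrating the $i$-th coordinate of $\psi$ with respect to $\pi$. States in $\mathrm{C}(E^0)$ are absorbing. $M_k(t)$ denotes the number of transitions of $Y_\phi$ up to time $t$, so $Y_\phi(t)\in\mathrm{C}(E^{k-M_k(t)})$. Solution of the Stein equation: for $\mu\in M_1(E)$, $$f_h(\mu)=-\int_0^\infty\big[\mathbb{E}h(Z_\mu(t))-\mathbb{E}h(Z)\big]dt=-\int_0^\infty\mathbb{E}\Big[\big(\langle Y_\phi(t),\mu^{k-M_k(t)}\rangle-\mathbb{E}h(Z)\big)\mathbf{1}[M_k(t)<k]\Big]dt,$$ and $f_h$ is extended to all finite measures $\mu$ on $E$ by the last expression, which is how its derivatives $\partial_x f_h$, $\partial_{xy}f_h$, $\partial_{xyz}f_h$ are understood. *)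

theory Defs
  imports "HOL-Probability.Probability"
begin

text \<open>
  The compact metric space \<open>E\<close> is a type \<open>'a :: metric_space\<close> with \<open>compact UNIV\<close>.
  \<open>E\<^sup>m\<close> is \<open>{..<m} \<rightarrow>\<^sub>E UNIV\<close> with the product topology (coordinates are numbered from \<open>0\<close>), and
  \<open>M\<^sub>1(E)\<close> is \<open>space (prob_algebra borel)\<close>.
\<close>

section \<open>Functionals of measures\<close>

definition cont_fun :: "nat \<Rightarrow> ((nat \<Rightarrow> 'a::metric_space) \<Rightarrow> real) \<Rightarrow> bool" where
  "cont_fun m \<psi> \<longleftrightarrow>
     continuous_map (product_topology (\<lambda>_. euclidean) {..<m}) euclideanreal \<psi>"

definition pairing :: "nat \<Rightarrow> ((nat \<Rightarrow> 'a::metric_space) \<Rightarrow> real) \<Rightarrow> 'a measure \<Rightarrow> real" where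
  "pairing m \<psi> \<mu> = (\<integral>x. \<psi> x \<partial>(Pi\<^sub>M {..<m} (\<lambda>_. \<mu>)))"

definition fin_measures :: "'a::metric_space measure set" where
  "fin_measures = {\<mu>. finite_measure \<mu> \<and> sets \<mu> = sets borel}"

definition add_atom :: "'a::metric_space measure \<Rightarrow> real \<Rightarrow> 'a \<Rightarrow> 'a measure" where
  "add_atom \<mu> \<epsilon> x =
     measure_of UNIV (sets borel) (\<lambda>A. emeasure \<mu> A + ennreal \<epsilon> * indicator A x)"

lemma emeasure_add_atom:
  assumes "sets \<mu> = sets borel" "A \<in> sets borel"
  shows "emeasure (add_atom \<mu> \<epsilon> x) A = emeasure \<mu> A + ennreal \<epsilon> * indicator A x"
proof -
  let ?f = "\<lambda>A. emeasure \<mu> A + ennreal \<epsilon> * indicator A x"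
  have "countably_additive (sets borel) ?f"
  proof (rule countably_additiveI)
    fix B :: "nat \<Rightarrow> 'a set"
    assume B: "range B \<subseteq> sets borel" "disjoint_family B"
    have "(\<Sum>i. ?f (B i)) = (\<Sum>i. emeasure \<mu> (B i)) + (\<Sum>i. ennreal \<epsilon> * indicator (B i) x)"
      by (rule suminf_add[symmetric]) simp_all
    also have "\<dots> = ?f (\<Union>i. B i)"
      using B assms(1) suminf_indicator[OF B(2), of x]
      by (simp add: suminf_emeasure)
    finally show "(\<Sum>i. ?f (B i)) = ?f (\<Union>i. B i)" .
  qed
  moreover have "positive (sets borel) ?f"
    by (simp add: positive_def)
  moreover have "sigma_algebra UNIV (sets (borel :: 'a measure))"
    using sets.sigma_algebra_axioms[of "borel :: 'a measure"] by simp
  ultimately show ?thesis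
    unfolding add_atom_def using assms(2) by (intro emeasure_measure_of_sigma)
qed

definition mquot :: "('a::metric_space measure \<Rightarrow> real) \<Rightarrow> 'a \<Rightarrow> 'a measure \<Rightarrow> real \<Rightarrow> real" where
  "mquot F x \<mu> \<epsilon> = (F (add_atom \<mu> \<epsilon> x) - F \<mu>) / \<epsilon>"

definition mdifferentiable :: "('a::metric_space measure \<Rightarrow> real) \<Rightarrow> 'a \<Rightarrow> 'a measure \<Rightarrow> bool" where
  "mdifferentiable F x \<mu> \<longleftrightarrow> (\<exists>D. (mquot F x \<mu> \<longlongrightarrow> D) (at_right 0))"

definition mderiv :: "('a::metric_space measure \<Rightarrow> real) \<Rightarrow> 'a \<Rightarrow> 'a measure \<Rightarrow> real" where
  "mderiv F x \<mu> = Lim (at_right 0) (mquot F x \<mu>)"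

definition mderiv2 ::
  "('a::metric_space measure \<Rightarrow> real) \<Rightarrow> 'a \<Rightarrow> 'a \<Rightarrow> 'a measure \<Rightarrow> real" where
  "mderiv2 F x y = mderiv (mderiv F x) y"

definition mderiv3 ::
  "('a::metric_space measure \<Rightarrow> real) \<Rightarrow> 'a \<Rightarrow> 'a \<Rightarrow> 'a \<Rightarrow> 'a measure \<Rightarrow> real" where
  "mderiv3 F x y z = mderiv (mderiv2 F x y) z"

definition sup_norm :: "'b set \<Rightarrow> ('b \<Rightarrow> real) \<Rightarrow> ereal" where
  "sup_norm S F = (SUP s\<in>S. ereal \<bar>F s\<bar>)"

section \<open>The Dirichlet process\<close>

text \<open>The \<open>n\<close>-th entry (from \<open>0\<close>) of the non-increasing rearrangement of a non-negative null
  sequence; the lemma below relates it to literal rearrangement by a permutation.\<close>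
definition ranked :: "(nat \<Rightarrow> real) \<Rightarrow> nat \<Rightarrow> real" where
  "ranked p n = (SUP A\<in>{A. finite A \<and> card A = Suc n}. Min (p ` A))"

lemma ranked_eqI:
  assumes "bij \<sigma>" and q: "decseq (p \<circ> \<sigma>)"
  shows "ranked p = p \<circ> \<sigma>"
proof
  fix n
  have inj: "inj \<sigma>" and surj: "surj \<sigma>"
    using assms by (auto simp: bij_def)
  have "\<sigma> ` {..n} \<in> {A. finite A \<and> card A = Suc n}"
    using inj by (simp add: card_image inj_on_subset)
  moreover have "Min (p ` \<sigma> ` {..n}) = p (\<sigma> n)"
    using q by (intro Min_eqI) (auto simp: decseq_def)
  ultimately have 1: "p (\<sigma> n) \<in> (\<lambda>A. Min (p ` A)) ` {A. finite A \<and> card A = Suc n}"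
    by (intro image_eqI[of _ _ "\<sigma> ` {..n}"]) simp_all
  have 2: "Min (p ` A) \<le> p (\<sigma> n)" if A: "finite A" "card A = Suc n" for A
  proof -
    have "\<not> A \<subseteq> \<sigma> ` {..<n}"
    proof
      assume "A \<subseteq> \<sigma> ` {..<n}"
      then have "card A \<le> card (\<sigma> ` {..<n})" by (intro card_mono) auto
      also have "\<dots> \<le> n" using card_image_le[of "{..<n}" \<sigma>] by simp
      finally show False using A by simp
    qed
    then obtain a where a: "a \<in> A" "a \<notin> \<sigma> ` {..<n}" by blast
    obtain j where j: "a = \<sigma> j" using surj by (rule surjE)
    have "n \<le> j"
    proof (rule ccontr)
      assume "\<not> n \<le> j"
      then have "a \<in> \<sigma> ` {..<n}" using j by simp
      with a show False by simp
    qed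
    then have "p a \<le> p (\<sigma> n)" using q j by (auto simp: decseq_def)
    moreover have "Min (p ` A) \<le> p a" using A a by (intro Min_le) auto
    ultimately show ?thesis by simp
  qed
  show "ranked p n = (p \<circ> \<sigma>) n"
    unfolding ranked_def comp_apply
    by (rule cSup_eq_maximum[OF 1]) (elim imageE CollectE conjE, simp add: 2)
qed

definition beta_law :: "real \<Rightarrow> real \<Rightarrow> real measure" where
  "beta_law a b = density (restrict_space lborel {0<..<1})
     (\<lambda>x. ennreal (x powr (a - 1) * (1 - x) powr (b - 1) / Beta a b))"

definition stick_breaking :: "(nat \<Rightarrow> real) \<Rightarrow> nat \<Rightarrow> real" where
  "stick_breaking V i = V i * (\<Prod>j<i. 1 - V j)"

definition poisson_dirichlet :: "real \<Rightarrow> (nat \<Rightarrow> real) measure" where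
  "poisson_dirichlet \<theta> =
     distr (Pi\<^sub>M UNIV (\<lambda>_::nat. beta_law 1 \<theta>)) (Pi\<^sub>M UNIV (\<lambda>_::nat. borel))
       (\<lambda>V. ranked (stick_breaking V))"

text \<open>The measure \<open>\<Sum>\<^sub>i P\<^sub>i \<delta>\<^bsub>\<xi>\<^sub>i\<^esub>\<close>, as the image under \<open>\<xi>\<close> of the measure on \<open>\<nat>\<close> with weights
  \<open>P\<close>.\<close>
definition atomic_measure :: "(nat \<Rightarrow> real) \<Rightarrow> (nat \<Rightarrow> 'a::metric_space) \<Rightarrow> 'a measure" where
  "atomic_measure P \<xi> = distr (density (count_space UNIV) (\<lambda>i. ennreal (P i))) borel \<xi>"

text \<open>On the null event that the weights do not sum to \<open>1\<close> the atomic measure is replaced by a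
  point mass, so that the map takes values in \<open>M\<^sub>1(E)\<close> everywhere.\<close>
definition dirichlet_process ::
  "real \<Rightarrow> 'a::metric_space measure \<Rightarrow> 'a measure measure" where
  "dirichlet_process \<theta> \<pi> =
     distr (poisson_dirichlet \<theta> \<Otimes>\<^sub>M Pi\<^sub>M UNIV (\<lambda>_::nat. \<pi>)) (prob_algebra borel)
       (\<lambda>(P, \<xi>). if prob_space (atomic_measure P \<xi>) then atomic_measure P \<xi>
                 else return borel (\<xi> 0))"

section \<open>The Fleming--Viot generator and process\<close>

definition fv_gen ::
  "real \<Rightarrow> 'a::metric_space measure \<Rightarrow> ('a measure \<Rightarrow> real) \<Rightarrow> 'a measure \<Rightarrow> real" where
  "fv_gen \<theta> \<pi> F \<mu> =
     \<theta> / 2 * ((\<integral>x. mderiv F x \<mu> \<partial>\<pi>) - (\<integral>x. mderiv F x \<mu> \<partial>\<mu>))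
     + 1 / 2 * ((\<integral>x. (\<integral>y. mderiv2 F x y \<mu> \<partial>return borel x) \<partial>\<mu>)
                - (\<integral>(x, y). mderiv2 F x y \<mu> \<partial>(\<mu> \<Otimes>\<^sub>M \<mu>)))"

text \<open>All integrals in \<^term>\<open>fv_gen \<theta> \<pi> F \<mu>\<close> converge absolutely.\<close>
definition fv_gen_defined ::
  "'a::metric_space measure \<Rightarrow> ('a measure \<Rightarrow> real) \<Rightarrow> 'a measure \<Rightarrow> bool" where
  "fv_gen_defined \<pi> F \<mu> \<longleftrightarrow>
     integrable \<pi> (\<lambda>x. mderiv F x \<mu>) \<and>
     integrable \<mu> (\<lambda>x. mderiv F x \<mu>) \<and>
     (\<forall>x. integrable (return borel x) (\<lambda>y. mderiv2 F x y \<mu>)) \<and>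
     integrable \<mu> (\<lambda>x. \<integral>y. mderiv2 F x y \<mu> \<partial>return borel x) \<and>
     integrable (\<mu> \<Otimes>\<^sub>M \<mu>) (\<lambda>(x, y). mderiv2 F x y \<mu>)"

definition past ::
  "'w measure \<Rightarrow> (real \<Rightarrow> 'w \<Rightarrow> 'a::metric_space measure) \<Rightarrow> real \<Rightarrow> 'w measure" where
  "past N Z t = (SUP r\<in>{0..t}. vimage_algebra (space N) (Z r) (prob_algebra borel))"

definition fv_compensated :: "real \<Rightarrow> 'a::metric_space measure \<Rightarrow> ('a measure \<Rightarrow> real) \<Rightarrow>
    (real \<Rightarrow> 'w \<Rightarrow> 'a measure) \<Rightarrow> real \<Rightarrow> 'w \<Rightarrow> real" where
  "fv_compensated \<theta> \<pi> F Z t \<omega> =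
     F (Z t \<omega>) - (LBINT s:{0..t}. fv_gen \<theta> \<pi> F (Z s \<omega>))"

text \<open>The process generated by \<^const>\<open>fv_gen\<close> and started at \<open>\<mu>\<close>: the weakly continuous solution
  of the martingale problem for the generator on the domain of all functionals
  \<^term>\<open>pairing m \<psi>\<close> with \<open>\<psi> \<in> C(E\<^sup>m)\<close>.\<close>
definition fleming_viot_process :: "real \<Rightarrow> 'a::metric_space measure \<Rightarrow> 'a measure \<Rightarrow>
    'w measure \<Rightarrow> (real \<Rightarrow> 'w \<Rightarrow> 'a measure) \<Rightarrow> bool" where
  "fleming_viot_process \<theta> \<pi> \<mu> N Z \<longleftrightarrow>
     prob_space N \<and>
     (\<forall>t\<ge>0. Z t \<in> N \<rightarrow>\<^sub>M prob_algebra borel) \<and>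
     (AE \<omega> in N. Z 0 \<omega> = \<mu>) \<and>
     (\<forall>\<omega>\<in>space N. \<forall>g::'a \<Rightarrow> real. continuous_on UNIV g \<longrightarrow>
        continuous_on {0..} (\<lambda>t. \<integral>x. g x \<partial>Z t \<omega>)) \<and>
     (\<forall>m \<psi>. cont_fun m \<psi> \<longrightarrow>
        (\<forall>t\<ge>0. fv_compensated \<theta> \<pi> (pairing m \<psi>) Z t \<in> borel_measurable (past N Z t) \<and>
               integrable N (fv_compensated \<theta> \<pi> (pairing m \<psi>) Z t)) \<and>
        (\<forall>s t. 0 \<le> s \<longrightarrow> s \<le> t \<longrightarrow>
           (AE \<omega> in N. real_cond_exp N (past N Z s) (fv_compensated \<theta> \<pi> (pairing m \<psi>) Z t) \<omega>
              = fv_compensated \<theta> \<pi> (pairing m \<psi>) Z s \<omega>)))"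

section \<open>The dual process\<close>

text \<open>A state \<open>(m, \<psi>)\<close> stands for \<open>\<psi> \<in> C(E\<^sup>m)\<close>. The process is built from its jump chain and
  independent exponential holding times.\<close>

type_synonym 'a dual_state = "nat \<times> ((nat \<Rightarrow> 'a) \<Rightarrow> real)"

datatype dual_move = Coalesce nat nat | Integrate nat

text \<open>\<open>(x\<^sub>0, \<dots>, x\<^bsub>j-1\<^esub>, a, x\<^sub>j, \<dots>, x\<^bsub>m-2\<^esub>)\<close>\<close>
definition insert_coord :: "nat \<Rightarrow> nat \<Rightarrow> 'a \<Rightarrow> (nat \<Rightarrow> 'a) \<Rightarrow> nat \<Rightarrow> 'a" where
  "insert_coord m j a x =
     (\<lambda>l\<in>{..<m}. if l < j then x l else if l = j then a else x (l - 1))"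

fun apply_move :: "'a::metric_space measure \<Rightarrow> 'a dual_state \<Rightarrow> dual_move \<Rightarrow> 'a dual_state" where
  "apply_move \<pi> (m, \<psi>) (Coalesce i j) = (m - 1, \<lambda>x. \<psi> (insert_coord m j (x i) x))"
| "apply_move \<pi> (m, \<psi>) (Integrate i) = (m - 1, \<lambda>x. \<integral>a. \<psi> (insert_coord m i a x) \<partial>\<pi>)"

definition moves :: "nat \<Rightarrow> dual_move set" where
  "moves m = {Coalesce i j | i j. i < j \<and> j < m} \<union> {Integrate i | i. i < m}"

fun move_rate :: "real \<Rightarrow> dual_move \<Rightarrow> real" where
  "move_rate \<theta> (Coalesce i j) = 1"
| "move_rate \<theta> (Integrate i) = \<theta> / 2"

definition exit_rate :: "real \<Rightarrow> nat \<Rightarrow> real" where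
  "exit_rate \<theta> m = (\<Sum>v\<in>moves m. move_rate \<theta> v)"

definition move_pmf :: "real \<Rightarrow> nat \<Rightarrow> dual_move pmf" where
  "move_pmf \<theta> m =
     embed_pmf (\<lambda>v. if v \<in> moves m then move_rate \<theta> v / exit_rate \<theta> m else 0)"

lemma finite_moves: "finite (moves m)"
proof (rule finite_subset)
  show "moves m \<subseteq> (\<lambda>(i, j). Coalesce i j) ` ({..<m} \<times> {..<m}) \<union> Integrate ` {..<m}"
    by (auto simp: moves_def)
qed simp

lemma move_rate_pos: "0 < \<theta> \<Longrightarrow> 0 < move_rate \<theta> v"
  by (cases v) auto

lemma exit_rate_pos:
  assumes "0 < \<theta>" "1 \<le> m"
  shows "0 < exit_rate \<theta> m"
proof -
  have "Integrate 0 \<in> moves m"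
    using assms by (auto simp: moves_def)
  then show ?thesis
    unfolding exit_rate_def using assms finite_moves[of m] move_rate_pos
    by (intro sum_pos) auto
qed

lemma pmf_move_pmf:
  assumes "0 < \<theta>" "1 \<le> m"
  shows "pmf (move_pmf \<theta> m) v = (if v \<in> moves m then move_rate \<theta> v / exit_rate \<theta> m else 0)"
proof -
  let ?f = "\<lambda>v. if v \<in> moves m then move_rate \<theta> v / exit_rate \<theta> m else 0"
  have nonneg: "0 \<le> ?f v" for v
    using exit_rate_pos[OF assms] move_rate_pos[OF assms(1), of v] by simp
  have "(\<integral>\<^sup>+v. ennreal (?f v) \<partial>count_space UNIV) = (\<Sum>v\<in>moves m. ennreal (?f v))"
    by (rule nn_integral_count_space'[OF finite_moves]) auto
  also have "\<dots> = ennreal (\<Sum>v\<in>moves m. ?f v)"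
    using nonneg by (intro sum_ennreal)
  also have "(\<Sum>v\<in>moves m. ?f v) = (\<Sum>v\<in>moves m. move_rate \<theta> v) / exit_rate \<theta> m"
    unfolding sum_divide_distrib by (rule sum.cong) simp_all
  also have "\<dots> = 1"
    using exit_rate_pos[OF assms] by (simp add: exit_rate_def)
  finally show ?thesis
    unfolding move_pmf_def by (intro pmf_embed_pmf nonneg) simp
qed

text \<open>The first \<open>n + 1\<close> states of the jump chain started at \<open>s\<close>.\<close>
primrec dual_chain ::
  "real \<Rightarrow> 'a::metric_space measure \<Rightarrow> nat \<Rightarrow> 'a dual_state \<Rightarrow> 'a dual_state list pmf" where
  "dual_chain \<theta> \<pi> 0 s = return_pmf [s]"
| "dual_chain \<theta> \<pi> (Suc n) s =
     bind_pmf (map_pmf (apply_move \<pi> s) (move_pmf \<theta> (fst s)))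
       (\<lambda>s'. map_pmf ((#) s) (dual_chain \<theta> \<pi> n s'))"

text \<open>The chain from \<open>\<phi> \<in> C(E\<^sup>k)\<close> is absorbed in \<open>C(E\<^sup>0)\<close> after exactly \<open>k\<close> jumps. The second
  component consists of i.i.d. standard exponential variables.\<close>
definition dual_space :: "real \<Rightarrow> 'a::metric_space measure \<Rightarrow> nat \<Rightarrow>
    ((nat \<Rightarrow> 'a) \<Rightarrow> real) \<Rightarrow> ('a dual_state list \<times> (nat \<Rightarrow> real)) measure" where
  "dual_space \<theta> \<pi> k \<phi> =
     measure_pmf (dual_chain \<theta> \<pi> k (k, \<phi>))
     \<Otimes>\<^sub>M Pi\<^sub>M UNIV (\<lambda>_::nat. density lborel (\<lambda>x. ennreal (exponential_density 1 x)))"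

text \<open>The time of the jump leaving the \<open>n\<close>-th state: the holding time in the \<open>i\<close>-th state is a
  standard exponential divided by the exit rate of that state.\<close>
definition jump_time ::
  "real \<Rightarrow> nat \<Rightarrow> 'a dual_state list \<times> (nat \<Rightarrow> real) \<Rightarrow> real" where
  "jump_time \<theta> n \<omega> = (\<Sum>i\<le>n. snd \<omega> i / exit_rate \<theta> (fst (fst \<omega> ! i)))"

definition dual_jumps ::
  "real \<Rightarrow> nat \<Rightarrow> real \<Rightarrow> 'a dual_state list \<times> (nat \<Rightarrow> real) \<Rightarrow> nat" where
  "dual_jumps \<theta> k t \<omega> = card {n. n < k \<and> jump_time \<theta> n \<omega> \<le> t}"

definition dual_process ::
  "real \<Rightarrow> nat \<Rightarrow> real \<Rightarrow> 'a dual_state list \<times> (nat \<Rightarrow> real) \<Rightarrow> 'a dual_state" where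
  "dual_process \<theta> k t \<omega> = fst \<omega> ! dual_jumps \<theta> k t \<omega>"

section \<open>The solution of the Stein equation\<close>

text \<open>In the following, \<open>c\<close> plays the role of \<open>E h(Z)\<close>.\<close>

definition stein_integrand :: "real \<Rightarrow> nat \<Rightarrow> real \<Rightarrow> 'a::metric_space measure \<Rightarrow> real \<Rightarrow>
    'a dual_state list \<times> (nat \<Rightarrow> real) \<Rightarrow> real" where
  "stein_integrand \<theta> k c \<mu> t \<omega> =
     (pairing (fst (dual_process \<theta> k t \<omega>)) (snd (dual_process \<theta> k t \<omega>)) \<mu> - c)
     * (if dual_jumps \<theta> k t \<omega> < k then 1 else 0)"

definition stein_solution :: "real \<Rightarrow> 'a::metric_space measure \<Rightarrow> nat \<Rightarrow>
    ((nat \<Rightarrow> 'a) \<Rightarrow> real) \<Rightarrow> real \<Rightarrow> 'a measure \<Rightarrow> real" where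
  "stein_solution \<theta> \<pi> k \<phi> c \<mu> =
     - (LBINT t:{0..}. \<integral>\<omega>. stein_integrand \<theta> k c \<mu> t \<omega> \<partial>dual_space \<theta> \<pi> k \<phi>)"

end

theory Submission imports Defs begin

text \<open>
  Write \<open>\<lambda>\<^sub>m = m (m - 1 + \<theta>) / 2\<close> for the exit rate of the dual process from \<open>C(E\<^sup>m)\<close>. Every jump lowers
  the dimension by exactly one, so the \<open>n\<close>-th state lies in \<open>C(E\<^bsup>k-n\<^esup>)\<close>, and its holding time is an
  exponential variable of rate \<open>\<lambda>\<^bsub>k-n\<^esub>\<close> that is independent of the jump chain. Hence the time integral in
  the definition of \<open>f\<^sub>h\<close> only sees the mean \<open>\<phi>\<^sub>n\<close> of the \<open>n\<close>-th state (\<open>mean_state\<close>) and the mean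
  holding time, and for every finite measure \<open>\<mu>\<close>
  \<open>f\<^sub>h(\<mu>) = - \<Sum>\<^bsub>n<k\<^esub> (\<langle>\<phi>\<^sub>n, \<mu>\<^bsup>k-n\<^esup>\<rangle> - c) / \<lambda>\<^bsub>k-n\<^esub>\<close> with \<open>c = E h(Z)\<close>,
  a polynomial functional (\<open>stein_solution_polynomial\<close>). Everything else is a computation with such
  functionals.

  \<^item> Bounds. Differentiating \<open>\<mu> \<mapsto> \<langle>\<psi>, \<mu>\<^sup>m\<rangle>\<close> in the direction of \<open>\<delta>\<^sub>x\<close> inserts \<open>x\<close> into each of the \<open>m\<close>
    coordinates in turn (\<open>mquot_pairing\<close>), which costs a factor \<open>m\<close>, then \<open>m - 1\<close>, then \<open>m - 2\<close>. Since
    \<open>\<phi>\<^sub>n\<close> is obtained from \<open>\<phi>\<close> by averaging, its norm is at most that of \<open>\<phi>\<close>. What remains are the sums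
    of \<open>m / \<lambda>\<^sub>m\<close>, \<open>m (m - 1) / \<lambda>\<^sub>m\<close> and \<open>m (m - 1) (m - 2) / \<lambda>\<^sub>m\<close> over \<open>m \<le> k\<close>
    (\<open>sum_falling_factorial_exit_rate\<close>).

  \<^item> Stein equation. The generator maps \<open>\<langle>\<psi>, \<mu>\<^sup>m\<rangle>\<close> to \<open>\<lambda>\<^sub>m (\<langle>\<psi>', \<mu>\<^bsup>m-1\<^esup>\<rangle> - \<langle>\<psi>, \<mu>\<^sup>m\<rangle>)\<close>, where \<open>\<psi>'\<close> is
    the mean of the next dual state (\<open>fv_gen_polynomial\<close>). Applied to \<open>f\<^sub>h\<close>, the rates cancel and the sum
    telescopes to \<open>h(\<mu>) - \<phi>\<^sub>k\<close>, with \<open>\<phi>\<^sub>k\<close> a constant.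

  \<^item> The constant \<open>\<phi>\<^sub>k\<close> is \<open>E h(Z)\<close> (\<open>dirichlet_mean\<close>), because \<open>E \<langle>\<psi>', Z\<^bsup>m-1\<^esup>\<rangle> = E \<langle>\<psi>, Z\<^sup>m\<rangle>\<close>
    (\<open>dirichlet_step\<close>). By uniform approximation it is enough to prove this for products of functions of
    one variable. Stick breaking makes \<open>Z\<close> equal in law to \<open>V \<delta>\<^sub>\<xi> + (1 - V) Z\<close>, with \<open>V\<close>, \<open>\<xi>\<close> and \<open>Z\<close> on the
    right-hand side independent; expanding products gives a fixed point equation for the moments \<open>E \<Prod>\<^sub>i \<langle>g\<^sub>i, Z\<rangle>\<close> (\<open>stick_moment_fixed_point\<close>), from which the
    recursion follows by induction on the number of factors (\<open>moment_recursion\<close>). Ranking the weights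
    does not change these moments, since the atoms are exchangeable (\<open>ranked_moment\<close>).

  \<^item> Fleming--Viot representation. Along a Fleming--Viot process the moment \<open>u(t) = E \<langle>\<psi>, Z\<^sub>t\<^sup>m\<rangle>\<close> solves
    \<open>u' = \<lambda>\<^sub>m (v - u)\<close>, where \<open>v\<close> is the moment belonging to \<open>\<psi>'\<close>. By induction on \<open>m\<close> all moments
    approach their limit exponentially fast, and integrating the equation over \<open>[0, \<infinity>)\<close> shows that the
    time integral is the same sum as above (\<open>fv_occupation\<close>).
\<close>

section \<open>Bounded measurable functions of several coordinates\<close>

text \<open>The bound \<open>C\<close> is part of the predicate because one and the same bound, the norm of the initial function,
  is carried through all transitions of the dual process.\<close>
definition bdd_meas :: "nat \<Rightarrow> real \<Rightarrow> ((nat \<Rightarrow> 'a::metric_space) \<Rightarrow> real) \<Rightarrow> bool" where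
  "bdd_meas m C \<psi> \<longleftrightarrow> \<psi> \<in> borel_measurable (Pi\<^sub>M {..<m} (\<lambda>_. borel)) \<and>
     (\<forall>x\<in>{..<m} \<rightarrow>\<^sub>E UNIV. \<bar>\<psi> x\<bar> \<le> C)"

lemma bdd_meas_measurable: "bdd_meas m C \<psi> \<Longrightarrow> \<psi> \<in> borel_measurable (Pi\<^sub>M {..<m} (\<lambda>_. borel))"
  by (simp add: bdd_meas_def)

lemma bdd_meas_le: "bdd_meas m C \<psi> \<Longrightarrow> x \<in> {..<m} \<rightarrow>\<^sub>E UNIV \<Longrightarrow> \<bar>\<psi> x\<bar> \<le> C"
  by (simp add: bdd_meas_def)

lemma bdd_meas_nonneg: "bdd_meas m C \<psi> \<Longrightarrow> 0 \<le> C"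
  using bdd_meas_le[of m C \<psi> "\<lambda>l\<in>{..<m}. undefined"] by force

lemma insert_coord_PiE: "insert_coord m i a x \<in> {..<m} \<rightarrow>\<^sub>E UNIV"
  by (auto simp: insert_coord_def)

lemma bdd_meas_abs_insert: "bdd_meas m C \<psi> \<Longrightarrow> \<bar>\<psi> (insert_coord m i a x)\<bar> \<le> C"
  by (rule bdd_meas_le[OF _ insert_coord_PiE])

lemma measurable_insert_coord:
  assumes "i < m" "f \<in> borel_measurable M" "g \<in> measurable M (Pi\<^sub>M {..<m-1} (\<lambda>_. borel))"
  shows "(\<lambda>p. insert_coord m i (f p) (g p)) \<in> measurable M (Pi\<^sub>M {..<m} (\<lambda>_. borel))"
  unfolding insert_coord_def
proof (rule measurable_restrict)
  fix l assume l: "l \<in> {..<m}"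
  have g: "(\<lambda>p. g p n) \<in> borel_measurable M" if "n < m - 1" for n
    using measurable_compose[OF assms(3) measurable_component_singleton[of n]] that by simp
  consider "l < i" | "l = i" | "i < l" by linarith
  then show "(\<lambda>x. if l < i then g x l else if l = i then f x else g x (l - 1)) \<in> borel_measurable M"
    using l assms(1,2) g[of l] g[of "l-1"] by cases auto
qed

lemma measurable_bdd_meas_insert:
  assumes "bdd_meas m C \<psi>" "i < m" "f \<in> borel_measurable M" "g \<in> measurable M (Pi\<^sub>M {..<m-1} (\<lambda>_. borel))"
  shows "(\<lambda>p. \<psi> (insert_coord m i (f p) (g p))) \<in> borel_measurable M"
  using measurable_compose[OF measurable_insert_coord[OF assms(2-4)] bdd_meas_measurable[OF assms(1)]] .

lemma bdd_meas_insert: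
  assumes "bdd_meas m C \<psi>" "i < m"
  shows "bdd_meas (m - 1) C (\<lambda>y. \<psi> (insert_coord m i a y))"
  unfolding bdd_meas_def
  by (intro conjI ballI measurable_bdd_meas_insert[OF assms] bdd_meas_abs_insert[OF assms(1)]) simp_all

lemma bdd_meas_cmult: "bdd_meas m C \<psi> \<Longrightarrow> bdd_meas m (\<bar>c\<bar> * C) (\<lambda>x. c * \<psi> x)"
  by (auto simp: bdd_meas_def abs_mult intro!: mult_left_mono)

lemma bdd_meas_sum:
  "finite I \<Longrightarrow> (\<And>v. v \<in> I \<Longrightarrow> bdd_meas m (C v) (\<psi> v)) \<Longrightarrow> bdd_meas m (\<Sum>v\<in>I. C v) (\<lambda>x. \<Sum>v\<in>I. \<psi> v x)"
  unfolding bdd_meas_def by (intro conjI borel_measurable_sum ballI order_trans[OF sum_abs] sum_mono) simp_all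

section \<open>Integration against product measures\<close>

lemma fin_measuresD:
  assumes "\<mu> \<in> fin_measures"
  shows "finite_measure \<mu>" "sets \<mu> = sets borel" "space \<mu> = UNIV"
  using assms sets_eq_imp_space_eq[of \<mu> borel] by (auto simp: fin_measures_def)

lemma M1_fin: "\<mu> \<in> space (prob_algebra borel) \<Longrightarrow> \<mu> \<in> fin_measures"
  by (auto simp: fin_measures_def space_prob_algebra prob_space_def)

lemma sets_PiM_fin:
  "\<mu> \<in> fin_measures \<Longrightarrow> sets (Pi\<^sub>M I (\<lambda>_. \<mu>)) = sets (Pi\<^sub>M I (\<lambda>_. borel))"
  by (intro sets_PiM_cong) (auto simp: fin_measures_def)

lemma product_sigma_finite_fin_measures: "\<mu> \<in> fin_measures \<Longrightarrow> product_sigma_finite (\<lambda>_::nat. \<mu>)"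
  by (simp add: product_sigma_finite_def fin_measuresD finite_measure.axioms)

lemma emeasure_PiM_UNIV:
  assumes "\<mu> \<in> fin_measures"
  shows "emeasure (Pi\<^sub>M {..<m::nat} (\<lambda>_. \<mu>)) (space (Pi\<^sub>M {..<m} (\<lambda>_. \<mu>))) = ennreal (measure \<mu> UNIV ^ m)"
proof -
  interpret product_sigma_finite "\<lambda>_::nat. \<mu>" using assms by (rule product_sigma_finite_fin_measures)
  interpret finite_measure \<mu> using assms by (rule fin_measuresD)
  have "emeasure (Pi\<^sub>M {..<m} (\<lambda>_. \<mu>)) (Pi\<^sub>E {..<m} (\<lambda>_. space \<mu>)) = (\<Prod>i<m. emeasure \<mu> (space \<mu>))"
    by (intro emeasure_PiM) auto
  then show ?thesis
    using fin_measuresD(3)[OF assms] by (simp add: space_PiM emeasure_eq_measure ennreal_power)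
qed

lemma finite_measure_PiM:
  assumes "\<mu> \<in> fin_measures" shows "finite_measure (Pi\<^sub>M {..<m::nat} (\<lambda>_. \<mu>))"
  using emeasure_PiM_UNIV[OF assms, of m] by (intro finite_measureI) simp

lemma measure_PiM_UNIV:
  assumes "\<mu> \<in> fin_measures"
  shows "measure (Pi\<^sub>M {..<m::nat} (\<lambda>_. \<mu>)) (space (Pi\<^sub>M {..<m} (\<lambda>_. \<mu>))) = measure \<mu> UNIV ^ m"
  using emeasure_PiM_UNIV[OF assms, of m] by (simp add: measure_def)

lemma space_PiM_fin: "\<mu> \<in> fin_measures \<Longrightarrow> space (Pi\<^sub>M I (\<lambda>_. \<mu>)) = I \<rightarrow>\<^sub>E UNIV"
  by (simp add: space_PiM fin_measuresD)

lemma bdd_meas_integrable: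
  assumes "\<mu> \<in> fin_measures" "bdd_meas m C \<psi>"
  shows "integrable (Pi\<^sub>M {..<m} (\<lambda>_. \<mu>)) \<psi>"
proof -
  interpret finite_measure "Pi\<^sub>M {..<m} (\<lambda>_. \<mu>)" using assms by (intro finite_measure_PiM)
  show ?thesis
    using assms bdd_meas_measurable[OF assms(2)] bdd_meas_le[OF assms(2)]
    by (intro integrable_const_bound[of _ C] AE_I2)
       (auto simp: space_PiM_fin measurable_cong_sets[OF sets_PiM_fin refl])
qed

lemma bounded_integral_le:
  fixes f :: "'b \<Rightarrow> real"
  assumes "finite_measure M" "\<And>x. x \<in> space M \<Longrightarrow> \<bar>f x\<bar> \<le> C"
  shows "\<bar>\<integral>x. f x \<partial>M\<bar> \<le> C * measure M (space M)"
proof (cases "integrable M f")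
  case True
  interpret finite_measure M by fact
  have "\<bar>\<integral>x. f x \<partial>M\<bar> \<le> (\<integral>x. \<bar>f x\<bar> \<partial>M)" by (rule integral_abs_bound)
  also have "\<dots> \<le> (\<integral>x. C \<partial>M)"
    using True assms(2) by (intro integral_mono) auto
  finally show ?thesis by (simp add: mult.commute)
next
  case False
  then have "(\<integral>x. f x \<partial>M) = 0" by (rule not_integrable_integral_eq)
  moreover have "0 \<le> C * measure M (space M)"
  proof (cases "space M = {}")
    case False
    then obtain x where "x \<in> space M" by auto
    then have "0 \<le> C" using assms(2)[of x] by linarith
    then show ?thesis by simp
  qed simp
  ultimately show ?thesis by simp
qed

lemma pairing_bound:
  assumes "\<mu> \<in> fin_measures" "\<And>x. x \<in> {..<m} \<rightarrow>\<^sub>E UNIV \<Longrightarrow> \<bar>\<psi> x\<bar> \<le> C"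
  shows "\<bar>pairing m \<psi> \<mu>\<bar> \<le> C * measure \<mu> UNIV ^ m"
  using bounded_integral_le[OF finite_measure_PiM[OF assms(1)], of m \<psi> C] assms(2)
  unfolding pairing_def measure_PiM_UNIV[OF assms(1)] by (simp add: space_PiM_fin[OF assms(1)])

lemma pairing_0: "pairing 0 \<psi> \<mu> = \<psi> (\<lambda>_. undefined)"
proof -
  have "lebesgue_integral (count_space {\<lambda>_::nat. undefined}) \<psi> = \<psi> (\<lambda>_. undefined)"
    by (subst lebesgue_integral_count_space_finite) auto
  then show ?thesis by (simp add: pairing_def PiM_empty)
qed

lemma pairing_sum:
  assumes "\<mu> \<in> fin_measures" "\<And>v. v \<in> I \<Longrightarrow> bdd_meas m (C v) (\<psi> v)"
  shows "pairing m (\<lambda>x. \<Sum>v\<in>I. c v * \<psi> v x) \<mu> = (\<Sum>v\<in>I. c v * pairing m (\<psi> v) \<mu>)"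
  unfolding pairing_def using bdd_meas_integrable[OF assms(1) assms(2)]
  by (subst Bochner_Integration.integral_sum) auto

lemma pairing_diff:
  assumes "\<mu> \<in> fin_measures" "bdd_meas m C \<psi>" "bdd_meas m C' \<psi>'"
  shows "pairing m (\<lambda>x. \<psi> x - \<psi>' x) \<mu> = pairing m \<psi> \<mu> - pairing m \<psi>' \<mu>"
  unfolding pairing_def using bdd_meas_integrable[OF assms(1)] assms(2,3)
  by (subst Bochner_Integration.integral_diff) auto

text \<open>A product of copies of the same measure does not depend on the order of its factors; both sides agree
  on boxes.\<close>
lemma distr_insert_coord:
  assumes \<mu>: "\<mu> \<in> fin_measures" and i: "i < m"
  shows "distr (\<mu> \<Otimes>\<^sub>M Pi\<^sub>M {..<m-1} (\<lambda>_. \<mu>)) (Pi\<^sub>M {..<m} (\<lambda>_. \<mu>)) (\<lambda>(a, y). insert_coord m i a y)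
     = Pi\<^sub>M {..<m} (\<lambda>_. \<mu>)"
proof -
  interpret product_sigma_finite "\<lambda>_::nat. \<mu>" using \<mu> by (rule product_sigma_finite_fin_measures)
  interpret finite_measure \<mu> using \<mu> by (rule fin_measuresD)
  let ?P = "Pi\<^sub>M {..<m-1} (\<lambda>_. \<mu>)"
  interpret P: finite_measure ?P using \<mu> by (rule finite_measure_PiM)
  have meas: "(\<lambda>(a, y). insert_coord m i a y) \<in> measurable (\<mu> \<Otimes>\<^sub>M ?P) (Pi\<^sub>M {..<m} (\<lambda>_. \<mu>))"
  proof -
    have "(\<lambda>p. insert_coord m i (fst p) (snd p)) \<in> measurable (\<mu> \<Otimes>\<^sub>M ?P) (Pi\<^sub>M {..<m} (\<lambda>_. borel))"
      by (rule measurable_insert_coord[OF i])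
         (auto simp: measurable_cong_sets[OF refl fin_measuresD(2)[OF \<mu>, symmetric]]
            measurable_cong_sets[OF refl sets_PiM_fin[OF \<mu>, symmetric]])
    then show ?thesis
      by (simp add: case_prod_beta' measurable_cong_sets[OF refl sets_PiM_fin[OF \<mu>]])
  qed
  show ?thesis
  proof (rule PiM_eqI)
    fix A assume A: "\<And>l. l \<in> {..<m} \<Longrightarrow> A l \<in> sets \<mu>"
    \<comment> \<open>the increasing enumeration of the coordinates other than \<open>i\<close>\<close>
    define h where "h = (\<lambda>l. if l < i then l else Suc l)"
    have bij: "bij_betw h {..<m-1} ({..<m} - {i})"
      unfolding h_def using i
      by (intro bij_betwI[of _ _ _ "\<lambda>l. if l < i then l else l - 1"]) (auto split: if_splits)
    have hl: "h l < m" if "l < m - 1" for l using that unfolding h_def by auto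
    have vim: "(\<lambda>(a, y). insert_coord m i a y) -` (Pi\<^sub>E {..<m} A) \<inter> space (\<mu> \<Otimes>\<^sub>M ?P)
       = A i \<times> Pi\<^sub>E {..<m-1} (\<lambda>l. A (h l))" (is "?L = ?R")
    proof (rule set_eqI)
      fix p :: "'a \<times> (nat \<Rightarrow> 'a)"
      obtain a y where p: "p = (a, y)" by (cases p)
      have "p \<in> ?L \<longleftrightarrow> (\<forall>l<m. insert_coord m i a y l \<in> A l) \<and> y \<in> {..<m-1} \<rightarrow>\<^sub>E UNIV"
        using insert_coord_PiE[of m i a y]
        by (auto simp: p space_pair_measure fin_measuresD(3)[OF \<mu>] space_PiM PiE_iff)
      also have "(\<forall>l<m. insert_coord m i a y l \<in> A l) \<longleftrightarrow> a \<in> A i \<and> (\<forall>l<m-1. y l \<in> A (h l))"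
      proof
        assume L: "\<forall>l<m. insert_coord m i a y l \<in> A l"
        have "y l \<in> A (h l)" if "l < m - 1" for l
          using L[rule_format, OF hl[OF that]] hl[OF that] i that
          by (auto simp: insert_coord_def h_def split: if_splits)
        then show "a \<in> A i \<and> (\<forall>l<m-1. y l \<in> A (h l))"
          using L[rule_format, OF i] i by (simp add: insert_coord_def)
      next
        assume R: "a \<in> A i \<and> (\<forall>l<m-1. y l \<in> A (h l))"
        show "\<forall>l<m. insert_coord m i a y l \<in> A l"
        proof (intro allI impI)
          fix l assume l: "l < m"
          consider "l < i" | "l = i" | "i < l" by linarith
          then show "insert_coord m i a y l \<in> A l"
          proof cases
            case 1
            then show ?thesis using R[THEN conjunct2, rule_format, of l] i l by (simp add: insert_coord_def h_def)
          next
            case 2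
            then show ?thesis using R l by (simp add: insert_coord_def)
          next
            case 3
            then have "l - 1 < m - 1" "h (l - 1) = l" using l by (auto simp: h_def)
            then show ?thesis using R[THEN conjunct2, rule_format, of "l-1"] 3 l
              by (simp add: insert_coord_def)
          qed
        qed
      qed
      finally show "p \<in> ?L \<longleftrightarrow> p \<in> ?R" by (auto simp: p PiE_iff)
    qed
    have "emeasure (distr (\<mu> \<Otimes>\<^sub>M ?P) (Pi\<^sub>M {..<m} (\<lambda>_. \<mu>)) (\<lambda>(a, y). insert_coord m i a y)) (Pi\<^sub>E {..<m} A)
       = emeasure (\<mu> \<Otimes>\<^sub>M ?P) (A i \<times> Pi\<^sub>E {..<m-1} (\<lambda>l. A (h l)))"
      unfolding vim[symmetric] using A by (intro emeasure_distr[OF meas] sets_PiM_I_finite) auto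
    also have "\<dots> = emeasure \<mu> (A i) * (\<Prod>l<m-1. emeasure \<mu> (A (h l)))"
    proof -
      have "emeasure ?P (Pi\<^sub>E {..<m-1} (\<lambda>l. A (h l))) = (\<Prod>l<m-1. emeasure \<mu> (A (h l)))"
        using A hl by (intro emeasure_PiM) auto
      moreover have "Pi\<^sub>E {..<m-1} (\<lambda>l. A (h l)) \<in> sets ?P"
        using A hl by (intro sets_PiM_I_finite) auto
      ultimately show ?thesis
        using A i by (subst P.emeasure_pair_measure_Times) auto
    qed
    also have "(\<Prod>l<m-1. emeasure \<mu> (A (h l))) = (\<Prod>l\<in>{..<m} - {i}. emeasure \<mu> (A l))"
      by (rule prod.reindex_bij_betw[OF bij])
    also have "emeasure \<mu> (A i) * \<dots> = (\<Prod>l<m. emeasure \<mu> (A l))"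
      using i by (subst (2) prod.remove[of _ i]) auto
    finally show "emeasure (distr (\<mu> \<Otimes>\<^sub>M ?P) (Pi\<^sub>M {..<m} (\<lambda>_. \<mu>)) (\<lambda>(a, y). insert_coord m i a y)) (Pi\<^sub>E {..<m} A)
      = (\<Prod>l<m. emeasure \<mu> (A l))" .
  qed simp_all
qed

lemma measurable_pairing_param:
  assumes \<mu>: "\<mu> \<in> fin_measures"
    and "(\<lambda>(p, y). \<Psi> p y) \<in> borel_measurable (M \<Otimes>\<^sub>M Pi\<^sub>M {..<m} (\<lambda>_. borel))"
  shows "(\<lambda>p. pairing m (\<Psi> p) \<mu>) \<in> borel_measurable M"
proof -
  interpret finite_measure "Pi\<^sub>M {..<m} (\<lambda>_. \<mu>)" using \<mu> by (rule finite_measure_PiM)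
  have "sets (M \<Otimes>\<^sub>M Pi\<^sub>M {..<m} (\<lambda>_. \<mu>)) = sets (M \<Otimes>\<^sub>M Pi\<^sub>M {..<m} (\<lambda>_. borel))"
    by (intro sets_pair_measure_cong refl sets_PiM_fin[OF \<mu>])
  then have "(\<lambda>(p, y). \<Psi> p y) \<in> borel_measurable (M \<Otimes>\<^sub>M Pi\<^sub>M {..<m} (\<lambda>_. \<mu>))"
    using assms(2) by (subst measurable_cong_sets[OF _ refl])
  then show ?thesis
    unfolding pairing_def by (rule borel_measurable_lebesgue_integral)
qed

lemma pairing_integral_swap:
  assumes \<mu>: "\<mu> \<in> fin_measures" and \<nu>: "finite_measure \<nu>"
    and meas: "(\<lambda>(p, y). \<Psi> p y) \<in> borel_measurable (\<nu> \<Otimes>\<^sub>M Pi\<^sub>M {..<m} (\<lambda>_. borel))"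
    and bd: "\<And>p y. p \<in> space \<nu> \<Longrightarrow> y \<in> {..<m} \<rightarrow>\<^sub>E UNIV \<Longrightarrow> \<bar>\<Psi> p y\<bar> \<le> C"
  shows "(\<integral>p. pairing m (\<Psi> p) \<mu> \<partial>\<nu>) = pairing m (\<lambda>y. \<integral>p. \<Psi> p y \<partial>\<nu>) \<mu>"
    "integrable \<nu> (\<lambda>p. pairing m (\<Psi> p) \<mu>)"
    "(\<integral>z. (case z of (p, y) \<Rightarrow> \<Psi> p y) \<partial>(\<nu> \<Otimes>\<^sub>M Pi\<^sub>M {..<m} (\<lambda>_. \<mu>))) = (\<integral>p. pairing m (\<Psi> p) \<mu> \<partial>\<nu>)"
proof -
  interpret P: finite_measure "Pi\<^sub>M {..<m} (\<lambda>_. \<mu>)" using \<mu> by (rule finite_measure_PiM)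
  interpret N: finite_measure \<nu> by fact
  interpret pair_sigma_finite \<nu> "Pi\<^sub>M {..<m} (\<lambda>_. \<mu>)" by unfold_locales
  interpret PP: finite_measure "\<nu> \<Otimes>\<^sub>M Pi\<^sub>M {..<m} (\<lambda>_. \<mu>)"
    by (rule finite_measure_pair_measure[OF finite_measure_PiM[OF \<mu>] \<nu>])
  have "sets (\<nu> \<Otimes>\<^sub>M Pi\<^sub>M {..<m} (\<lambda>_. \<mu>)) = sets (\<nu> \<Otimes>\<^sub>M Pi\<^sub>M {..<m} (\<lambda>_. borel))"
    by (intro sets_pair_measure_cong refl sets_PiM_fin[OF \<mu>])
  then have m': "(\<lambda>(p, y). \<Psi> p y) \<in> borel_measurable (\<nu> \<Otimes>\<^sub>M Pi\<^sub>M {..<m} (\<lambda>_. \<mu>))"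
    using meas by (subst measurable_cong_sets[OF _ refl])
  have int: "integrable (\<nu> \<Otimes>\<^sub>M Pi\<^sub>M {..<m} (\<lambda>_. \<mu>)) (\<lambda>(p, y). \<Psi> p y)"
    using bd m' by (intro PP.integrable_const_bound[of _ C] AE_I2)
      (auto simp: space_pair_measure space_PiM_fin[OF \<mu>])
  show "(\<integral>p. pairing m (\<Psi> p) \<mu> \<partial>\<nu>) = pairing m (\<lambda>y. \<integral>p. \<Psi> p y \<partial>\<nu>) \<mu>"
    unfolding pairing_def using Fubini_integral[OF int] by simp
  show "integrable \<nu> (\<lambda>p. pairing m (\<Psi> p) \<mu>)"
    unfolding pairing_def using integrable_fst[OF int] by simp
  show "(\<integral>z. (case z of (p, y) \<Rightarrow> \<Psi> p y) \<partial>(\<nu> \<Otimes>\<^sub>M Pi\<^sub>M {..<m} (\<lambda>_. \<mu>))) = (\<integral>p. pairing m (\<Psi> p) \<mu> \<partial>\<nu>)"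
    unfolding pairing_def using integral_fst[OF int] by simp
qed

lemma measurable_bdd_meas_insert_pair:
  assumes "bdd_meas m C \<psi>" "i < m" "sets \<nu> = sets borel"
  shows "(\<lambda>(a, y). \<psi> (insert_coord m i a y)) \<in> borel_measurable (\<nu> \<Otimes>\<^sub>M Pi\<^sub>M {..<m-1} (\<lambda>_. borel))"
  unfolding case_prod_beta'
  by (rule measurable_bdd_meas_insert[OF assms(1,2)]) (auto simp: measurable_cong_sets[OF refl assms(3)[symmetric]])

text \<open>Integrating out one coordinate at a time reduces statements about \<open>\<mu>\<^sup>m\<close> to integrals over \<open>\<mu>\<close>.\<close>
lemma pairing_insert:
  assumes \<mu>: "\<mu> \<in> fin_measures" and \<psi>: "bdd_meas m C \<psi>" and i: "i < m"
  shows "pairing m \<psi> \<mu> = (\<integral>a. pairing (m - 1) (\<lambda>y. \<psi> (insert_coord m i a y)) \<mu> \<partial>\<mu>)"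
proof -
  let ?P = "Pi\<^sub>M {..<m-1} (\<lambda>_. \<mu>)"
  have meas: "(\<lambda>(a, y). insert_coord m i a y) \<in> measurable (\<mu> \<Otimes>\<^sub>M ?P) (Pi\<^sub>M {..<m} (\<lambda>_. \<mu>))"
  proof -
    have "(\<lambda>p. insert_coord m i (fst p) (snd p)) \<in> measurable (\<mu> \<Otimes>\<^sub>M ?P) (Pi\<^sub>M {..<m} (\<lambda>_. borel))"
      by (rule measurable_insert_coord[OF i])
         (auto simp: measurable_cong_sets[OF refl fin_measuresD(2)[OF \<mu>, symmetric]]
            measurable_cong_sets[OF refl sets_PiM_fin[OF \<mu>, symmetric]])
    then show ?thesis
      by (simp add: case_prod_beta' measurable_cong_sets[OF refl sets_PiM_fin[OF \<mu>]])
  qed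
  have "pairing m \<psi> \<mu> = (\<integral>x. \<psi> x \<partial>distr (\<mu> \<Otimes>\<^sub>M ?P) (Pi\<^sub>M {..<m} (\<lambda>_. \<mu>)) (\<lambda>(a, y). insert_coord m i a y))"
    unfolding pairing_def distr_insert_coord[OF \<mu> i] ..
  also have "\<dots> = (\<integral>z. (case z of (a, y) \<Rightarrow> \<psi> (insert_coord m i a y)) \<partial>(\<mu> \<Otimes>\<^sub>M ?P))"
    using bdd_meas_measurable[OF \<psi>]
    by (subst integral_distr[OF meas])
       (auto simp: case_prod_beta' measurable_cong_sets[OF sets_PiM_fin[OF \<mu>] refl])
  also have "\<dots> = (\<integral>a. pairing (m - 1) (\<lambda>y. \<psi> (insert_coord m i a y)) \<mu> \<partial>\<mu>)"
    by (rule pairing_integral_swap(3)[OF \<mu> fin_measuresD(1)[OF \<mu>] measurable_bdd_meas_insert_pair[OF \<psi> i fin_measuresD(2)[OF \<mu>]]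
          bdd_meas_abs_insert[OF \<psi>]])
  finally show ?thesis .
qed

section \<open>Perturbing a measure by an atom\<close>

lemma space_add_atom: "space (add_atom \<mu> \<epsilon> x) = UNIV"
  by (simp add: add_atom_def space_measure_of_conv)

lemma sets_add_atom: "sets (add_atom \<mu> \<epsilon> (x::'a::metric_space)) = sets borel"
proof -
  have "sigma_sets UNIV (sets (borel::'a measure)) = sets borel"
    using sets.sigma_sets_eq[of "borel :: 'a measure"] by simp
  then show ?thesis by (simp add: add_atom_def)
qed

lemma add_atom_fin:
  assumes "\<mu> \<in> fin_measures"
  shows "add_atom \<mu> \<epsilon> x \<in> fin_measures"
proof -
  interpret finite_measure \<mu> using assms by (rule fin_measuresD)
  have "finite_measure (add_atom \<mu> \<epsilon> x)"
    using fin_measuresD[OF assms]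
    by (intro finite_measureI) (simp add: space_add_atom emeasure_add_atom emeasure_eq_measure ennreal_mult_eq_top_iff)
  then show ?thesis by (simp add: fin_measures_def sets_add_atom)
qed

lemma nn_integral_add_atom:
  assumes \<mu>: "\<mu> \<in> fin_measures" and f: "f \<in> borel_measurable borel"
  shows "(\<integral>\<^sup>+a. f a \<partial>add_atom \<mu> \<epsilon> x) = (\<integral>\<^sup>+a. f a \<partial>\<mu>) + ennreal \<epsilon> * f x"
  using f
proof (induction rule: borel_measurable_induct)
  case (cong f g)
  then show ?case by (metis ext space_borel UNIV_I)
next
  case (set A)
  then show ?case using fin_measuresD[OF \<mu>] by (simp add: sets_add_atom emeasure_add_atom)
next
  case (mult u c)
  then have "u \<in> borel_measurable \<mu>" "u \<in> borel_measurable (add_atom \<mu> \<epsilon> x)"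
    by (simp_all add: measurable_cong_sets[OF fin_measuresD(2)[OF \<mu>] refl] measurable_cong_sets[OF sets_add_atom refl])
  then show ?case using mult by (simp add: nn_integral_cmult algebra_simps distrib_left)
next
  case (add u v)
  then have "u \<in> borel_measurable \<mu>" "u \<in> borel_measurable (add_atom \<mu> \<epsilon> x)"
    "v \<in> borel_measurable \<mu>" "v \<in> borel_measurable (add_atom \<mu> \<epsilon> x)"
    by (simp_all add: measurable_cong_sets[OF fin_measuresD(2)[OF \<mu>] refl] measurable_cong_sets[OF sets_add_atom refl])
  then show ?case using add by (simp add: nn_integral_add algebra_simps distrib_left)
next
  case (seq U)
  then have m: "\<And>i. U i \<in> borel_measurable \<mu>" "\<And>i. U i \<in> borel_measurable (add_atom \<mu> \<epsilon> x)"
    by (simp_all add: measurable_cong_sets[OF fin_measuresD(2)[OF \<mu>] refl] measurable_cong_sets[OF sets_add_atom refl])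
  have "(\<integral>\<^sup>+a. (SUP i. U i) a \<partial>add_atom \<mu> \<epsilon> x) = (SUP i. \<integral>\<^sup>+a. U i a \<partial>add_atom \<mu> \<epsilon> x)"
    unfolding SUP_apply by (intro nn_integral_monotone_convergence_SUP seq m)
  also have "\<dots> = (SUP i. (\<integral>\<^sup>+a. U i a \<partial>\<mu>) + ennreal \<epsilon> * U i x)"
    using seq by simp
  also have "\<dots> = (SUP i. \<integral>\<^sup>+a. U i a \<partial>\<mu>) + (SUP i. ennreal \<epsilon> * U i x)"
    using seq(3) by (intro ennreal_SUP_add)
      (auto simp: incseq_def le_fun_def intro!: nn_integral_mono mult_left_mono)
  also have "(SUP i. \<integral>\<^sup>+a. U i a \<partial>\<mu>) = (\<integral>\<^sup>+a. (SUP i. U i) a \<partial>\<mu>)"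
    unfolding SUP_apply by (intro nn_integral_monotone_convergence_SUP[symmetric] seq m)
  also have "(SUP i. ennreal \<epsilon> * U i x) = ennreal \<epsilon> * (SUP i. U i) x"
    unfolding SUP_apply by (rule SUP_mult_left_ennreal[symmetric])
  finally show ?case .
qed

lemma integrable_bounded:
  assumes "finite_measure \<nu>" "sets \<nu> = sets borel" "f \<in> borel_measurable borel" "\<And>a. \<bar>f a\<bar> \<le> C"
  shows "integrable \<nu> (f :: 'a::metric_space \<Rightarrow> real)"
  using assms by (intro finite_measure.integrable_const_bound[of _ _ C] AE_I2)
    (simp_all add: measurable_cong_sets[OF assms(2) refl])

lemma integral_add_atom:
  assumes \<mu>: "\<mu> \<in> fin_measures" and f: "f \<in> borel_measurable borel" "\<And>a. \<bar>f a\<bar> \<le> C" and "0 \<le> \<epsilon>"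
  shows "(\<integral>a. f a \<partial>add_atom \<mu> \<epsilon> x) = (\<integral>a. f a \<partial>\<mu>) + \<epsilon> * f x"
proof -
  note \<nu> = add_atom_fin[OF \<mu>, of \<epsilon> x]
  have i: "integrable \<mu> f" "integrable (add_atom \<mu> \<epsilon> x) f"
    using integrable_bounded[OF fin_measuresD(1,2) f] \<mu> \<nu> by blast+
  have fin: "(\<integral>\<^sup>+a. ennreal (g a) \<partial>\<mu>) < \<infinity>" if "\<And>a. g a \<le> C" for g
  proof -
    interpret finite_measure \<mu> using \<mu> by (rule fin_measuresD)
    have "(\<integral>\<^sup>+a. ennreal (g a) \<partial>\<mu>) \<le> (\<integral>\<^sup>+a. ennreal C \<partial>\<mu>)"
      using that by (intro nn_integral_mono ennreal_leI)
    also have "\<dots> < \<infinity>" by (simp add: emeasure_eq_measure ennreal_mult_eq_top_iff less_top[symmetric])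
    finally show ?thesis .
  qed
  have f': "f a \<le> C" "- f a \<le> C" for a using f(2)[of a] by linarith+
  have "enn2real (\<integral>\<^sup>+a. ennreal (g a) \<partial>add_atom \<mu> \<epsilon> x) =
      enn2real (\<integral>\<^sup>+a. ennreal (g a) \<partial>\<mu>) + \<epsilon> * max 0 (g x)"
    if "g \<in> borel_measurable borel" "\<And>a. g a \<le> C" for g
    using that(1) fin[OF that(2)] \<open>0 \<le> \<epsilon>\<close>
    by (subst nn_integral_add_atom[OF \<mu>])
       (auto simp: enn2real_plus ennreal_mult_less_top enn2real_mult max_def ennreal_neg)
  from this[of f] this[of "\<lambda>a. - f a"] show ?thesis
    using i f f' by (simp add: real_lebesgue_integral_def max_def algebra_simps)
qed

section \<open>Derivatives of pairings\<close>

lemma insert_coord_commute: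
  assumes "i \<le> j" "j < m - 1"
  shows "insert_coord m i x (insert_coord (m - 1) j y z)
    = insert_coord m (Suc j) y (insert_coord (m - 1) i x z)"
proof
  fix l
  show "insert_coord m i x (insert_coord (m - 1) j y z) l
    = insert_coord m (Suc j) y (insert_coord (m - 1) i x z) l"
  proof (cases "l < m")
    case True
    consider "l < i" | "l = i" | "i < l" "l < Suc j" | "l = Suc j" | "Suc j < l" by linarith
    then show ?thesis using True assms by cases (cases l; auto simp: insert_coord_def)+
  qed (simp add: insert_coord_def)
qed

lemma integrable_pairing_insert:
  assumes "\<mu> \<in> fin_measures" "finite_measure \<nu>" "sets \<nu> = sets borel" "bdd_meas m C \<psi>" "i < m"
  shows "integrable \<nu> (\<lambda>a. pairing (m - 1) (\<lambda>y. \<psi> (insert_coord m i a y)) \<mu>)"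
  by (rule pairing_integral_swap(2)[OF assms(1,2) measurable_bdd_meas_insert_pair[OF assms(4,5,3)]
     bdd_meas_abs_insert[OF assms(4)]])

lemma measurable_pairing_insert:
  assumes "\<mu> \<in> fin_measures" "bdd_meas m C \<psi>" "i < m"
  shows "(\<lambda>a. pairing (m - 1) (\<lambda>y. \<psi> (insert_coord m i a y)) \<mu>) \<in> borel_measurable borel"
  by (rule measurable_pairing_param[OF assms(1) measurable_bdd_meas_insert_pair[OF assms(2,3) refl]])

text \<open>The product rule: each of the \<open>m\<close> factors of \<open>\<mu>\<^sup>m\<close> is replaced in turn by \<open>\<delta>\<^sub>x\<close>.\<close>
definition pair_deriv :: "nat \<Rightarrow> ((nat \<Rightarrow> 'a::metric_space) \<Rightarrow> real) \<Rightarrow> 'a \<Rightarrow> 'a measure \<Rightarrow> real" where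
  "pair_deriv m \<psi> x \<mu> = (\<Sum>i<m. pairing (m - 1) (\<lambda>y. \<psi> (insert_coord m i x y)) \<mu>)"

text \<open>Either the last coordinate is the one that is replaced by \<open>x\<close>, or it is integrated and the replacement
  takes place among the first \<open>m\<close>.\<close>
lemma pair_deriv_Suc:
  assumes \<mu>: "\<mu> \<in> fin_measures" and \<psi>: "bdd_meas (Suc m) C \<psi>"
  shows "pair_deriv (Suc m) \<psi> x \<mu> = pairing m (\<lambda>y. \<psi> (insert_coord (Suc m) m x y)) \<mu>
      + (\<integral>a. pair_deriv m (\<lambda>y. \<psi> (insert_coord (Suc m) m a y)) x \<mu> \<partial>\<mu>)"
    "integrable \<mu> (\<lambda>a. pair_deriv m (\<lambda>y. \<psi> (insert_coord (Suc m) m a y)) x \<mu>)"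
proof -
  define G where "G i a = pairing (m - 1) (\<lambda>y. \<psi> (insert_coord (Suc m) m a (insert_coord m i x y))) \<mu>" for i a
  have G: "G i a = pairing (m - 1) (\<lambda>y. \<psi> (insert_coord (Suc m) i x (insert_coord m (m - 1) a y))) \<mu>"
    if "i < m" for i a
  proof -
    have "i \<le> m - 1" "m - 1 < Suc m - 1" using that by auto
    with insert_coord_commute[of i "m - 1" "Suc m" x a] that show ?thesis by (simp add: G_def)
  qed
  have "bdd_meas m C (\<lambda>y. \<psi> (insert_coord (Suc m) i x y))" if "i < m" for i
    using bdd_meas_insert[OF \<psi>, of i x] that by simp
  note * = integrable_pairing_insert[OF \<mu> fin_measuresD(1,2)[OF \<mu>] this, of _ "m - 1"]
    pairing_insert[OF \<mu> this, of _ "m - 1"]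
  have int: "integrable \<mu> (G i)" if "i < m" for i
    using *(1)[OF that] that unfolding G[OF that] by simp
  show "integrable \<mu> (\<lambda>a. pair_deriv m (\<lambda>y. \<psi> (insert_coord (Suc m) m a y)) x \<mu>)"
    unfolding pair_deriv_def G_def[symmetric] using int by auto
  have "(\<integral>a. pair_deriv m (\<lambda>y. \<psi> (insert_coord (Suc m) m a y)) x \<mu> \<partial>\<mu>) = (\<Sum>i<m. \<integral>a. G i a \<partial>\<mu>)"
    unfolding pair_deriv_def G_def[symmetric] using int by (subst Bochner_Integration.integral_sum) auto
  also have "\<dots> = (\<Sum>i<m. pairing m (\<lambda>y. \<psi> (insert_coord (Suc m) i x y)) \<mu>)"
    using *(2) by (intro sum.cong refl) (simp add: G)
  finally show "pair_deriv (Suc m) \<psi> x \<mu> = pairing m (\<lambda>y. \<psi> (insert_coord (Suc m) m x y)) \<mu>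
      + (\<integral>a. pair_deriv m (\<lambda>y. \<psi> (insert_coord (Suc m) m a y)) x \<mu> \<partial>\<mu>)"
    by (simp add: pair_deriv_def)
qed

lemma pair_deriv_bound:
  assumes "\<mu> \<in> fin_measures" "bdd_meas m C \<psi>"
  shows "\<bar>pair_deriv m \<psi> x \<mu>\<bar> \<le> real m * (C * measure \<mu> UNIV ^ (m - 1))"
proof -
  have "\<bar>pair_deriv m \<psi> x \<mu>\<bar> \<le> (\<Sum>i<m. \<bar>pairing (m - 1) (\<lambda>y. \<psi> (insert_coord m i x y)) \<mu>\<bar>)"
    unfolding pair_deriv_def by (rule sum_abs)
  also have "\<dots> \<le> (\<Sum>i<m. C * measure \<mu> UNIV ^ (m - 1))"
    by (intro sum_mono pairing_bound assms bdd_meas_abs_insert[OF assms(2)])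
  finally show ?thesis by simp
qed

text \<open>By induction on \<open>m\<close>, integrating out the last coordinate. The constant is uniform in \<open>\<psi>\<close> because the
  induction step needs the estimate for all sections of \<open>\<psi>\<close> at once.\<close>
lemma pairing_Taylor:
  assumes \<mu>: "\<mu> \<in> fin_measures"
  shows "\<exists>K\<ge>0. \<forall>\<psi> C \<epsilon>. bdd_meas m C \<psi> \<longrightarrow> 0 \<le> \<epsilon> \<longrightarrow> \<epsilon> \<le> 1 \<longrightarrow>
    \<bar>pairing m \<psi> (add_atom \<mu> \<epsilon> x) - pairing m \<psi> \<mu> - \<epsilon> * pair_deriv m \<psi> x \<mu>\<bar> \<le> K * C * \<epsilon>\<^sup>2"
proof (induction m)
  case 0
  show ?case by (intro exI[of _ 0]) (simp add: pairing_0 pair_deriv_def)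
next
  case (Suc m)
  then obtain K where K: "0 \<le> K"
    "\<And>\<psi> C \<epsilon>. bdd_meas m C \<psi> \<Longrightarrow> 0 \<le> \<epsilon> \<Longrightarrow> \<epsilon> \<le> 1 \<Longrightarrow>
    \<bar>pairing m \<psi> (add_atom \<mu> \<epsilon> x) - pairing m \<psi> \<mu> - \<epsilon> * pair_deriv m \<psi> x \<mu>\<bar> \<le> K * C * \<epsilon>\<^sup>2"
    by blast
  let ?M = "measure \<mu> UNIV"
  define L where "L = K * ?M + (K + real m * ?M ^ (m - 1))"
  show ?case
  proof (intro exI[of _ L] conjI allI impI)
    show "0 \<le> L" using K(1) by (simp add: L_def)
    fix \<psi> :: "(nat \<Rightarrow> 'a) \<Rightarrow> real" and C \<epsilon> :: real
    assume \<psi>: "bdd_meas (Suc m) C \<psi>" and \<epsilon>: "0 \<le> \<epsilon>" "\<epsilon> \<le> 1"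
    let ?\<nu> = "add_atom \<mu> \<epsilon> x" and ?\<psi> = "\<lambda>a y. \<psi> (insert_coord (Suc m) m a y)"
    note \<nu> = add_atom_fin[OF \<mu>, of \<epsilon> x]
    have C: "0 \<le> C" using \<psi> by (rule bdd_meas_nonneg)
    have \<psi>a: "bdd_meas m C (?\<psi> a)" for a using bdd_meas_insert[OF \<psi>, of m a] by simp
    define R where "R a = pairing m (?\<psi> a) ?\<nu> - pairing m (?\<psi> a) \<mu> - \<epsilon> * pair_deriv m (?\<psi> a) x \<mu>" for a
    have R: "\<bar>R a\<bar> \<le> K * C * \<epsilon>\<^sup>2" for a unfolding R_def by (rule K(2)[OF \<psi>a \<epsilon>])
    have int: "integrable \<mu> (\<lambda>a. pairing m (?\<psi> a) ?\<nu>)" "integrable \<mu> (\<lambda>a. pairing m (?\<psi> a) \<mu>)"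
      using integrable_pairing_insert[OF \<nu> fin_measuresD(1,2)[OF \<mu>] \<psi>, of m]
        integrable_pairing_insert[OF \<mu> fin_measuresD(1,2)[OF \<mu>] \<psi>, of m] by simp_all
    have "pairing (Suc m) \<psi> ?\<nu> = (\<integral>a. pairing m (?\<psi> a) ?\<nu> \<partial>?\<nu>)"
      using pairing_insert[OF \<nu> \<psi>, of m] by simp
    also have "\<dots> = (\<integral>a. pairing m (?\<psi> a) ?\<nu> \<partial>\<mu>) + \<epsilon> * pairing m (?\<psi> x) ?\<nu>"
      using measurable_pairing_insert[OF \<nu> \<psi>, of m] \<epsilon>
      by (intro integral_add_atom[OF \<mu> _ pairing_bound[OF \<nu> bdd_meas_le[OF \<psi>a]]]) auto
    finally have 1: "pairing (Suc m) \<psi> ?\<nu> = (\<integral>a. pairing m (?\<psi> a) ?\<nu> \<partial>\<mu>) + \<epsilon> * pairing m (?\<psi> x) ?\<nu>" .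
    have 2: "pairing (Suc m) \<psi> \<mu> = (\<integral>a. pairing m (?\<psi> a) \<mu> \<partial>\<mu>)"
      using pairing_insert[OF \<mu> \<psi>, of m] by simp
    note 3 = pair_deriv_Suc[OF \<mu> \<psi>, of x]
    have IR: "(\<integral>a. R a \<partial>\<mu>) = (\<integral>a. pairing m (?\<psi> a) ?\<nu> \<partial>\<mu>) - (\<integral>a. pairing m (?\<psi> a) \<mu> \<partial>\<mu>)
        - \<epsilon> * (\<integral>a. pair_deriv m (?\<psi> a) x \<mu> \<partial>\<mu>)"
      unfolding R_def using int 3(2) by simp
    have "pairing (Suc m) \<psi> ?\<nu> - pairing (Suc m) \<psi> \<mu> - \<epsilon> * pair_deriv (Suc m) \<psi> x \<mu>
       = (\<integral>a. R a \<partial>\<mu>) + \<epsilon> * (R x + \<epsilon> * pair_deriv m (?\<psi> x) x \<mu>)"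
      unfolding 1 2 3(1) IR by (simp add: R_def algebra_simps)
    also have "\<bar>\<dots>\<bar> \<le> \<bar>\<integral>a. R a \<partial>\<mu>\<bar> + \<epsilon> * (\<bar>R x\<bar> + \<epsilon> * \<bar>pair_deriv m (?\<psi> x) x \<mu>\<bar>)"
      using \<epsilon> by (intro order_trans[OF abs_triangle_ineq] add_left_mono)
         (simp add: abs_mult mult_left_mono order_trans[OF abs_triangle_ineq])
    also have "\<dots> \<le> K * C * \<epsilon>\<^sup>2 * ?M + \<epsilon> * (K * C * \<epsilon> + \<epsilon> * (real m * (C * ?M ^ (m - 1))))"
    proof (intro add_mono mult_left_mono)
      show "\<bar>\<integral>a. R a \<partial>\<mu>\<bar> \<le> K * C * \<epsilon>\<^sup>2 * ?M"
        using bounded_integral_le[OF fin_measuresD(1)[OF \<mu>] R] by (simp add: fin_measuresD[OF \<mu>])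
      have "K * C * \<epsilon>\<^sup>2 \<le> K * C * \<epsilon>"
        using \<epsilon> K C by (intro mult_left_mono) (auto simp: power2_eq_square mult_left_le)
      then show "\<bar>R x\<bar> \<le> K * C * \<epsilon>" using R[of x] by linarith
    qed (use \<epsilon> pair_deriv_bound[OF \<mu> \<psi>a] in auto)
    also have "\<dots> = L * C * \<epsilon>\<^sup>2" by (simp add: L_def algebra_simps power2_eq_square)
    finally show "\<bar>pairing (Suc m) \<psi> ?\<nu> - pairing (Suc m) \<psi> \<mu> - \<epsilon> * pair_deriv (Suc m) \<psi> x \<mu>\<bar> \<le> L * C * \<epsilon>\<^sup>2" .
  qed
qed

lemma mquot_pairing:
  assumes \<mu>: "\<mu> \<in> fin_measures" and \<psi>: "bdd_meas m C \<psi>"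
  shows "(mquot (pairing m \<psi>) x \<mu> \<longlongrightarrow> pair_deriv m \<psi> x \<mu>) (at_right 0)"
proof -
  obtain K where K: "0 \<le> K"
    "\<And>\<epsilon>. 0 \<le> \<epsilon> \<Longrightarrow> \<epsilon> \<le> 1 \<Longrightarrow>
    \<bar>pairing m \<psi> (add_atom \<mu> \<epsilon> x) - pairing m \<psi> \<mu> - \<epsilon> * pair_deriv m \<psi> x \<mu>\<bar> \<le> K * C * \<epsilon>\<^sup>2"
    using pairing_Taylor[OF \<mu>, of m x] \<psi> by blast
  have "((\<lambda>\<epsilon>. mquot (pairing m \<psi>) x \<mu> \<epsilon> - pair_deriv m \<psi> x \<mu>) \<longlongrightarrow> 0) (at_right 0)"
  proof (rule Lim_null_comparison)
    show "((\<lambda>\<epsilon>. K * C * \<epsilon>) \<longlongrightarrow> 0) (at_right (0::real))"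
      by (auto intro!: tendsto_eq_intros)
    have "eventually (\<lambda>\<epsilon>::real. 0 < \<epsilon> \<and> \<epsilon> < 1) (at_right 0)"
      by (auto simp: eventually_at_right_field intro!: exI[of _ 1])
    then show "\<forall>\<^sub>F \<epsilon> in at_right 0. norm (mquot (pairing m \<psi>) x \<mu> \<epsilon> - pair_deriv m \<psi> x \<mu>) \<le> K * C * \<epsilon>"
    proof eventually_elim
      case (elim \<epsilon>)
      have "mquot (pairing m \<psi>) x \<mu> \<epsilon> - pair_deriv m \<psi> x \<mu> =
        (pairing m \<psi> (add_atom \<mu> \<epsilon> x) - pairing m \<psi> \<mu> - \<epsilon> * pair_deriv m \<psi> x \<mu>) / \<epsilon>"
        using elim by (simp add: mquot_def field_simps)
      also have "norm \<dots> = \<bar>pairing m \<psi> (add_atom \<mu> \<epsilon> x) - pairing m \<psi> \<mu> - \<epsilon> * pair_deriv m \<psi> x \<mu>\<bar> / \<epsilon>"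
        unfolding real_norm_def abs_divide using elim by (simp only: abs_of_pos)
      also have "\<dots> \<le> K * C * \<epsilon>\<^sup>2 / \<epsilon>"
        using K(2)[of \<epsilon>] elim by (intro divide_right_mono) simp_all
      also have "\<dots> = K * C * \<epsilon>" using elim by (simp add: power2_eq_square)
      finally show ?case .
    qed
  qed
  then show ?thesis by (simp add: LIM_zero_iff)
qed

text \<open>The representation of \<open>F\<close> is required on all finite measures because difference quotients leave the
  probability measures. The derivative is again represented in this form, with the pairs \<open>(j, i)\<close> as
  indices, so that the lemma can be iterated.\<close>
lemma mderiv_polynomial:
  assumes J: "finite J" and \<psi>: "\<And>j. j \<in> J \<Longrightarrow> bdd_meas (d j) (C j) (\<psi> j)"
    and F: "\<And>\<mu>. \<mu> \<in> fin_measures \<Longrightarrow> F \<mu> = c0 + (\<Sum>j\<in>J. c j * pairing (d j) (\<psi> j) \<mu>)"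
    and \<mu>: "\<mu> \<in> fin_measures"
  shows "mdifferentiable F x \<mu>" (is ?A)
    "mderiv F x \<mu> = (\<Sum>p\<in>Sigma J (\<lambda>j. {..<d j}). c (fst p) *
      pairing (d (fst p) - 1) (\<lambda>y. \<psi> (fst p) (insert_coord (d (fst p)) (snd p) x y)) \<mu>)" (is ?B)
proof -
  have "mquot F x \<mu> = (\<lambda>\<epsilon>. \<Sum>j\<in>J. c j * mquot (pairing (d j) (\<psi> j)) x \<mu> \<epsilon>)"
    unfolding mquot_def F[OF \<mu>] F[OF add_atom_fin[OF \<mu>]]
    by (simp add: sum_subtractf[symmetric] sum_divide_distrib right_diff_distrib[symmetric])
  then have "(mquot F x \<mu> \<longlongrightarrow> (\<Sum>j\<in>J. c j * pair_deriv (d j) (\<psi> j) x \<mu>)) (at_right 0)"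
    using mquot_pairing[OF \<mu> \<psi>] by (auto intro!: tendsto_intros)
  note * = this tendsto_Lim[OF _ this]
  show ?A using * unfolding mdifferentiable_def by blast
  have "mderiv F x \<mu> = (\<Sum>j\<in>J. c j * pair_deriv (d j) (\<psi> j) x \<mu>)"
    unfolding mderiv_def using *(2) by simp
  also have "\<dots> = (\<Sum>j\<in>J. \<Sum>i<d j. c j * pairing (d j - 1) (\<lambda>y. \<psi> j (insert_coord (d j) i x y)) \<mu>)"
    by (simp add: pair_deriv_def sum_distrib_left)
  also have "\<dots> = (\<Sum>p\<in>Sigma J (\<lambda>j. {..<d j}). c (fst p) *
      pairing (d (fst p) - 1) (\<lambda>y. \<psi> (fst p) (insert_coord (d (fst p)) (snd p) x y)) \<mu>)"
    using J by (subst sum.Sigma) (auto simp: case_prod_beta')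
  finally show ?B .
qed

section \<open>Continuous functions on a compact power\<close>

text \<open>On a compact \<open>E\<close> this is continuity on \<open>E\<^sup>m\<close>, in a form that visibly survives the moves of the dual
  process, in particular the integration of a coordinate.\<close>
definition ucont :: "nat \<Rightarrow> ((nat \<Rightarrow> 'a::metric_space) \<Rightarrow> real) \<Rightarrow> bool" where
  "ucont m \<psi> \<longleftrightarrow> (\<forall>e>0. \<exists>\<delta>>0. \<forall>x\<in>{..<m} \<rightarrow>\<^sub>E UNIV. \<forall>y\<in>{..<m} \<rightarrow>\<^sub>E UNIV.
     (\<forall>i<m. dist (x i) (y i) < \<delta>) \<longrightarrow> \<bar>\<psi> x - \<psi> y\<bar> < e)"

text \<open>Every point has a box such that the oscillation from it is less than \<open>e / 2\<close> on the box of twice the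
  radius; finitely many of the smaller boxes cover \<open>E\<^sup>m\<close>, and their least radius serves as \<open>\<delta>\<close>.\<close>
lemma cont_fun_ucont:
  assumes E: "compact (UNIV :: 'a::metric_space set)" and \<psi>: "cont_fun m (\<psi> :: (nat \<Rightarrow> 'a) \<Rightarrow> real)"
  shows "ucont m \<psi>" "\<exists>C. \<forall>x\<in>{..<m} \<rightarrow>\<^sub>E UNIV. \<bar>\<psi> x\<bar> \<le> C"
proof -
  let ?X = "product_topology (\<lambda>_. euclidean :: 'a topology) {..<m}"
  let ?S = "{..<m} \<rightarrow>\<^sub>E (UNIV :: 'a set)"
  have top: "topspace ?X = ?S" by simp
  have cpt: "compactin ?X ?S"
    using E compact_space_product_topology[of "\<lambda>_. euclidean :: 'a topology" "{..<m}"]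
    by (simp add: compact_space_def)
  have cont: "continuous_map ?X euclideanreal \<psi>" using \<psi> by (simp add: cont_fun_def)
  have "compact (\<psi> ` ?S)" using image_compactin[OF cpt cont] by simp
  from compact_imp_bounded[OF this] show "\<exists>C. \<forall>x\<in>?S. \<bar>\<psi> x\<bar> \<le> C"
    by (auto simp: bounded_iff)
  show "ucont m \<psi>"
    unfolding ucont_def
  proof (intro allI impI)
    fix e :: real assume "0 < e"
    have "\<exists>r>0. \<forall>y\<in>?S. (\<forall>i<m. dist (x i) (y i) < 2 * r) \<longrightarrow> \<bar>\<psi> x - \<psi> y\<bar> < e / 2" if x: "x \<in> ?S" for x
    proof -
      let ?U = "{y \<in> topspace ?X. \<psi> y \<in> ball (\<psi> x) (e / 2)}"
      have o: "openin ?X ?U" by (rule openin_continuous_map_preimage[OF cont]) simp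
      have xU: "x \<in> ?U" using x \<open>0 < e\<close> by simp
      from product_topology_open_contains_basis[OF o xU]
      obtain U where U: "x \<in> Pi\<^sub>E {..<m} U" "\<forall>i. openin euclidean (U i)" "Pi\<^sub>E {..<m} U \<subseteq> ?U"
        by (elim exE conjE)
      have "\<forall>i\<in>{..<m}. \<exists>r>0. ball (x i) r \<subseteq> U i"
        using U(1,2) by (metis PiE_mem open_contains_ball open_openin)
      then obtain r where r: "\<And>i. i < m \<Longrightarrow> 0 < r i \<and> ball (x i) (r i) \<subseteq> U i"
        by (metis lessThan_iff)
      define R where "R = Min (insert 1 (r ` {..<m})) / 2"
      have "0 < R" using r by (auto simp: R_def)
      moreover have "\<bar>\<psi> x - \<psi> y\<bar> < e / 2" if y: "y \<in> ?S" "\<forall>i<m. dist (x i) (y i) < 2 * R" for y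
      proof -
        have "y i \<in> U i" if i: "i < m" for i
        proof -
          have "2 * R \<le> r i" unfolding R_def using i by simp
          then have "y i \<in> ball (x i) (r i)" using y(2) i by force
          then show ?thesis using r[OF i] by auto
        qed
        then have "y \<in> Pi\<^sub>E {..<m} U" using y(1) by (auto simp: PiE_iff)
        with U(3) have "y \<in> ?U" by (rule subsetD)
        then show ?thesis by (simp add: dist_real_def)
      qed
      ultimately show ?thesis by blast
    qed
    then obtain r where r: "\<And>x. x \<in> ?S \<Longrightarrow> 0 < r x"
      "\<And>x y. x \<in> ?S \<Longrightarrow> y \<in> ?S \<Longrightarrow> (\<forall>i<m. dist (x i) (y i) < 2 * r x) \<Longrightarrow> \<bar>\<psi> x - \<psi> y\<bar> < e / 2"
      by metis
    define B where "B x = Pi\<^sub>E {..<m} (\<lambda>i. ball (x i) (r x))" for x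
    have "\<forall>U\<in>B ` ?S. openin ?X U" by (auto simp: B_def openin_PiE)
    moreover have "?S \<subseteq> \<Union>(B ` ?S)"
    proof
      fix x assume x: "x \<in> ?S"
      then have "x \<in> B x" using r(1)[OF x] by (auto simp: B_def PiE_iff)
      then show "x \<in> \<Union>(B ` ?S)" using x by blast
    qed
    ultimately obtain \<F> where \<F>: "finite \<F>" "\<F> \<subseteq> B ` ?S" "?S \<subseteq> \<Union>\<F>"
      using cpt[unfolded compactin_def, THEN conjunct2, rule_format, of "B ` ?S"] by blast
    then obtain K where K: "finite K" "K \<subseteq> ?S" "\<F> = B ` K" by (meson finite_subset_image)
    define \<delta> where "\<delta> = Min (insert 1 (r ` K))"
    have \<delta>: "0 < \<delta>" using K r(1) by (auto simp: \<delta>_def)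
    moreover have "\<bar>\<psi> x - \<psi> y\<bar> < e" if xy: "x \<in> ?S" "y \<in> ?S" "\<forall>i<m. dist (x i) (y i) < \<delta>" for x y
    proof -
      obtain k where k: "k \<in> K" "x \<in> B k" using \<F>(3) K(3) xy(1) by auto
      have "\<delta> \<le> r k" unfolding \<delta>_def using k K(1) by simp
      have kS: "k \<in> ?S" using k K by auto
      have 1: "dist (k i) (x i) < r k" if "i < m" for i using k(2) that by (auto simp: B_def PiE_iff)
      have 2: "dist (k i) (y i) < 2 * r k" if "i < m" for i
        using 1[OF that] xy(3) that \<open>\<delta> \<le> r k\<close> dist_triangle[of "k i" "y i" "x i"] by fastforce
      have "dist (k i) (x i) < 2 * r k" if "i < m" for i using 1[OF that] r(1)[OF kS] by linarith
      have "\<bar>\<psi> k - \<psi> x\<bar> < e / 2" using r(2)[OF kS xy(1)] \<open>\<And>i. i < m \<Longrightarrow> dist (k i) (x i) < 2 * r k\<close> by auto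
      moreover have "\<bar>\<psi> k - \<psi> y\<bar> < e / 2" using r(2)[OF kS xy(2)] 2 by auto
      ultimately show ?thesis by linarith
    qed
    ultimately show "\<exists>\<delta>>0. \<forall>x\<in>?S. \<forall>y\<in>?S. (\<forall>i<m. dist (x i) (y i) < \<delta>) \<longrightarrow> \<bar>\<psi> x - \<psi> y\<bar> < e"
      by blast
  qed
qed

lemma ucont_cont_fun:
  assumes "ucont m (\<psi> :: (nat \<Rightarrow> 'a::metric_space) \<Rightarrow> real)"
  shows "cont_fun m \<psi>"
  unfolding cont_fun_def continuous_map_def
proof (intro conjI allI impI)
  let ?X = "product_topology (\<lambda>_. euclidean :: 'a topology) {..<m}"
  let ?S = "{..<m} \<rightarrow>\<^sub>E (UNIV :: 'a set)"
  show "\<psi> \<in> topspace ?X \<rightarrow> topspace euclideanreal" by simp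
  fix U :: "real set" assume "openin euclideanreal U"
  then have U: "open U" by simp
  show "openin ?X {x \<in> topspace ?X. \<psi> x \<in> U}"
    unfolding openin_product_topology_alt
  proof (intro ballI)
    fix x assume "x \<in> {x \<in> topspace ?X. \<psi> x \<in> U}"
    then have x: "x \<in> ?S" "\<psi> x \<in> U" by auto
    obtain e where e: "0 < e" "ball (\<psi> x) e \<subseteq> U" using U x(2) by (meson open_contains_ball)
    obtain \<delta> where \<delta>: "0 < \<delta>" "\<And>y. y \<in> ?S \<Longrightarrow> (\<forall>i<m. dist (x i) (y i) < \<delta>) \<Longrightarrow> \<bar>\<psi> x - \<psi> y\<bar> < e"
      using assms e(1) x(1) unfolding ucont_def by meson
    show "\<exists>V. finite {i \<in> {..<m}. V i \<noteq> topspace (euclidean::'a topology)} \<and>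
        (\<forall>i\<in>{..<m}. openin euclidean (V i)) \<and> x \<in> Pi\<^sub>E {..<m} V \<and> Pi\<^sub>E {..<m} V \<subseteq> {x \<in> topspace ?X. \<psi> x \<in> U}"
    proof (intro exI[of _ "\<lambda>i. ball (x i) \<delta>"] conjI subsetI)
      fix y assume y: "y \<in> (\<Pi>\<^sub>E i\<in>{..<m}. ball (x i) \<delta>)"
      then have "y \<in> ?S" by (auto simp: PiE_iff)
      moreover from y have "\<forall>i<m. dist (x i) (y i) < \<delta>" by (auto simp: PiE_iff)
      ultimately have "\<psi> y \<in> ball (\<psi> x) e" using \<delta>(2)[of y] by (simp add: dist_real_def)
      with e \<open>y \<in> ?S\<close> show "y \<in> {x \<in> topspace ?X. \<psi> x \<in> U}" by auto
    qed (use x \<delta>(1) in \<open>auto simp: PiE_iff\<close>)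
  qed
qed

text \<open>Tent functions at the points of a finite \<open>\<delta>\<close>-net, divided by their sum.\<close>
lemma partition_of_unity:
  assumes "compact (UNIV :: 'a::metric_space set)" "0 < \<delta>"
  obtains A :: "'a::metric_space set" and g :: "'a::metric_space \<Rightarrow> 'a::metric_space \<Rightarrow> real"
  where "finite A" "\<And>a. continuous_on UNIV (g a)" "\<And>a x. 0 \<le> g a x" "\<And>x. (\<Sum>a\<in>A. g a x) = 1"
    "\<And>a x. g a x \<noteq> 0 \<Longrightarrow> dist a x < \<delta>" "\<And>a x. a \<in> A \<Longrightarrow> g a x \<le> 1"
proof -
  have "(UNIV :: 'a set) \<subseteq> (\<Union>a\<in>UNIV. ball a \<delta>)" using assms(2) by auto
  then obtain A :: "'a set" where A: "finite A" "UNIV \<subseteq> (\<Union>a\<in>A. ball a \<delta>)"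
    using compactE_image[OF assms(1), of UNIV "\<lambda>a. ball a \<delta>"] by auto
  define t where "t a x = max 0 (\<delta> - dist a x)" for a x :: 'a
  define s where "s x = (\<Sum>a\<in>A. t a x)" for x
  have s: "0 < s x" for x
  proof -
    have "x \<in> (\<Union>a\<in>A. ball a \<delta>)" using A(2) by blast
    then obtain a where "a \<in> A" "dist a x < \<delta>" by auto
    then show ?thesis unfolding s_def using A(1) by (intro sum_pos2[of _ a]) (auto simp: t_def)
  qed
  have 1: "(\<Sum>a\<in>A. t a x / s x) = 1" for x
    using s[of x] by (simp add: sum_divide_distrib[symmetric] s_def[symmetric])
  show thesis
  proof (rule that[of A "\<lambda>a x. t a x / s x"])
    show "continuous_on UNIV (\<lambda>x. t a x / s x)" for a
      unfolding t_def s_def using s[unfolded s_def t_def]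
      by (intro continuous_intros) (auto simp: less_imp_neq[THEN not_sym])
    show "t a x / s x \<le> 1" if "a \<in> A" for a x
      unfolding 1[of x, symmetric] using A(1) that s[of x]
      by (intro member_le_sum) (auto simp: t_def)
  qed (use A s 1 in \<open>auto simp: t_def less_imp_le max_def split: if_splits\<close>)
qed

text \<open>The products \<open>\<Prod>\<^sub>i g\<^bsub>j\<^sub>i\<^esub>(x\<^sub>i)\<close> of a partition of unity on \<open>E\<close> form a partition of unity on \<open>E\<^sup>m\<close> that
  is subordinate to boxes of size \<open>\<delta>\<close>; \<open>\<psi>\<close> is replaced by its values at the centres \<open>j\<close> of the boxes.
  This reduces statements about \<open>C(E\<^sup>m)\<close> to functions of one variable.\<close>
lemma approx_by_products:
  assumes E: "compact (UNIV :: 'a::metric_space set)" and \<psi>: "cont_fun m (\<psi> :: (nat \<Rightarrow> 'a) \<Rightarrow> real)"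
    and e: "0 < e"
  obtains J :: "(nat \<Rightarrow> 'a::metric_space) set" and c :: "(nat \<Rightarrow> 'a::metric_space) \<Rightarrow> real" and G :: "(nat \<Rightarrow> 'a::metric_space) \<Rightarrow> nat \<Rightarrow> 'a::metric_space \<Rightarrow> real"
  where "finite J" "\<And>j i. continuous_on UNIV (G j i)" "\<And>j i x. \<bar>G j i x\<bar> \<le> 1"
    "\<And>x. x \<in> {..<m} \<rightarrow>\<^sub>E UNIV \<Longrightarrow> \<bar>\<psi> x - (\<Sum>j\<in>J. c j * (\<Prod>i<m. G j i (x i)))\<bar> \<le> e"
proof -
  let ?S = "{..<m} \<rightarrow>\<^sub>E (UNIV :: 'a set)"
  obtain \<delta> where \<delta>: "0 < \<delta>"
    "\<And>x y. x \<in> ?S \<Longrightarrow> y \<in> ?S \<Longrightarrow> (\<forall>i<m. dist (x i) (y i) < \<delta>) \<Longrightarrow> \<bar>\<psi> x - \<psi> y\<bar> < e"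
    using cont_fun_ucont(1)[OF E \<psi>] e unfolding ucont_def by meson
  obtain A :: "'a set" and g :: "'a \<Rightarrow> 'a \<Rightarrow> real" where g:
    "finite A" "\<And>a. continuous_on UNIV (g a)" "\<And>a x. 0 \<le> g a x" "\<And>x. (\<Sum>a\<in>A. g a x) = 1"
    "\<And>a x. g a x \<noteq> 0 \<Longrightarrow> dist a x < \<delta>" "\<And>a x. a \<in> A \<Longrightarrow> g a x \<le> 1"
    by (rule partition_of_unity[OF E \<delta>(1)]) (rule that)
  define G where "G j i = (if j i \<in> A then g (j i) else (\<lambda>_. 0))" for j :: "nat \<Rightarrow> 'a" and i :: nat
  let ?J = "{..<m} \<rightarrow>\<^sub>E A"
  show thesis
  proof (rule that[of ?J G \<psi>])
    show "finite ?J" using g(1) by (simp add: finite_PiE)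
    show "continuous_on UNIV (G j i)" for j i using g(2) by (simp add: G_def)
    show "\<bar>G j i x\<bar> \<le> 1" for j i x using g(3,6) by (simp add: G_def)
    fix x assume x: "x \<in> ?S"
    have eq: "(\<Prod>i<m. G j i (x i)) = (\<Prod>i<m. g (j i) (x i))" if "j \<in> ?J" for j
      using that by (intro prod.cong) (auto simp: G_def PiE_iff)
    have "(\<Sum>j\<in>?J. \<Prod>i<m. g (j i) (x i)) = (\<Prod>i<m. \<Sum>a\<in>A. g a (x i))"
      using g(1) by (subst prod_sum_PiE) auto
    also have "\<dots> = 1" using g(4) by simp
    finally have one: "(\<Sum>j\<in>?J. \<Prod>i<m. G j i (x i)) = 1" using eq by (simp cong: sum.cong)
    have nonneg: "0 \<le> (\<Prod>i<m. G j i (x i))" for j using g(3) by (auto intro!: prod_nonneg simp: G_def)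
    have "\<psi> x - (\<Sum>j\<in>?J. \<psi> j * (\<Prod>i<m. G j i (x i)))
       = (\<Sum>j\<in>?J. (\<psi> x - \<psi> j) * (\<Prod>i<m. G j i (x i)))"
      using one by (simp add: left_diff_distrib sum_subtractf sum_distrib_left[symmetric])
    also have "\<bar>\<dots>\<bar> \<le> (\<Sum>j\<in>?J. \<bar>(\<psi> x - \<psi> j) * (\<Prod>i<m. G j i (x i))\<bar>)" by (rule sum_abs)
    also have "\<dots> \<le> (\<Sum>j\<in>?J. e * (\<Prod>i<m. G j i (x i)))"
    proof (rule sum_mono)
      fix j assume j: "j \<in> ?J"
      show "\<bar>(\<psi> x - \<psi> j) * (\<Prod>i<m. G j i (x i))\<bar> \<le> e * (\<Prod>i<m. G j i (x i))"
      proof (cases "\<forall>i<m. dist (x i) (j i) < \<delta>")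
        case True
        have "j \<in> ?S" using j by (auto simp: PiE_iff)
        from \<delta>(2)[OF x this True] show ?thesis
          using nonneg[of j] by (simp add: abs_mult mult_right_mono)
      next
        case False
        then obtain i where "i < m" "\<not> dist (x i) (j i) < \<delta>" by auto
        then have "G j i (x i) = 0" using g(5)[of "j i" "x i"] by (auto simp: G_def dist_commute)
        with \<open>i < m\<close> have 0: "(\<Prod>i<m. G j i (x i)) = 0" by (intro prod_zero) auto
        show ?thesis unfolding 0 by simp
      qed
    qed
    also have "\<dots> = e" using one by (simp add: sum_distrib_left[symmetric])
    finally show "\<bar>\<psi> x - (\<Sum>j\<in>?J. \<psi> j * (\<Prod>i<m. G j i (x i)))\<bar> \<le> e" .
  qed
qed

lemma measurable_product_function:
  assumes "\<And>i. i < m \<Longrightarrow> G i \<in> borel_measurable borel"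
  shows "(\<lambda>x. \<Prod>i<m. G i (x i) :: real) \<in> borel_measurable (Pi\<^sub>M {..<m} (\<lambda>_. borel :: 'a::metric_space measure))"
proof (rule borel_measurable_prod)
  fix i assume "i \<in> {..<m}"
  then have "(\<lambda>x. x i) \<in> borel_measurable (Pi\<^sub>M {..<m} (\<lambda>_. borel :: 'a measure))" "G i \<in> borel_measurable borel"
    using assms by (auto intro: measurable_component_singleton)
  then show "(\<lambda>x. G i (x i)) \<in> borel_measurable (Pi\<^sub>M {..<m} (\<lambda>_. borel))"
    by (rule measurable_compose)
qed

lemma bdd_meas_product:
  assumes "\<And>i. i < m \<Longrightarrow> G i \<in> borel_measurable borel" "\<And>i x. i < m \<Longrightarrow> \<bar>G i x\<bar> \<le> 1"
  shows "bdd_meas m 1 (\<lambda>x. \<Prod>i<m. G i (x i))"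
  unfolding bdd_meas_def using assms
  by (auto intro!: measurable_product_function prod_le_1 simp: abs_prod)

lemma borel_measurable_uniform_approx:
  fixes f :: "'b \<Rightarrow> real"
  assumes "\<And>e. 0 < e \<Longrightarrow> \<exists>g\<in>borel_measurable M. \<forall>x\<in>space M. \<bar>f x - g x\<bar> \<le> e"
  shows "f \<in> borel_measurable M"
proof -
  have "\<exists>g. g \<in> borel_measurable M \<and> (\<forall>x\<in>space M. \<bar>f x - g x\<bar> \<le> 1 / real (Suc n))" for n
    using assms[of "1 / real (Suc n)"] by auto
  then obtain g where g: "\<And>n. g n \<in> borel_measurable M"
    "\<And>n x. x \<in> space M \<Longrightarrow> \<bar>f x - g n x\<bar> \<le> 1 / real (Suc n)" by metis
  show ?thesis
  proof (rule borel_measurable_LIMSEQ_real[OF _ g(1)])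
    fix x assume x: "x \<in> space M"
    have "(\<lambda>n. g n x - f x) \<longlonglongrightarrow> 0"
    proof (rule Lim_null_comparison)
      show "\<forall>\<^sub>F n in sequentially. norm (g n x - f x) \<le> 1 / real (Suc n)"
        using g(2)[OF x] by (auto simp: abs_minus_commute)
      show "(\<lambda>n. 1 / real (Suc n)) \<longlonglongrightarrow> 0" using LIMSEQ_inverse_real_of_nat by (simp add: inverse_eq_divide)
    qed
    then show "(\<lambda>n. g n x) \<longlonglongrightarrow> f x" by (simp add: LIM_zero_iff)
  qed
qed

text \<open>Continuity gives measurability for the Borel sets of the product topology; measurability for the
  product \<open>\<sigma>\<close>-algebra is seen from uniform approximation by sums of products.\<close>
lemma bdd_meas_cont_fun:
  assumes E: "compact (UNIV :: 'a::metric_space set)" and \<psi>: "cont_fun m (\<psi> :: (nat \<Rightarrow> 'a) \<Rightarrow> real)"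
    and C: "\<And>x. x \<in> {..<m} \<rightarrow>\<^sub>E UNIV \<Longrightarrow> \<bar>\<psi> x\<bar> \<le> C"
  shows "bdd_meas m C \<psi>"
proof -
  have "\<psi> \<in> borel_measurable (Pi\<^sub>M {..<m} (\<lambda>_. borel))"
  proof (rule borel_measurable_uniform_approx)
    fix e :: real assume "0 < e"
    then obtain J :: "(nat \<Rightarrow> 'a) set" and c and G :: "(nat \<Rightarrow> 'a) \<Rightarrow> nat \<Rightarrow> 'a \<Rightarrow> real" where *:
      "finite J" "\<And>j i. continuous_on UNIV (G j i)" "\<And>j i x. \<bar>G j i x\<bar> \<le> 1"
      "\<And>x. x \<in> {..<m} \<rightarrow>\<^sub>E UNIV \<Longrightarrow> \<bar>\<psi> x - (\<Sum>j\<in>J. c j * (\<Prod>i<m. G j i (x i)))\<bar> \<le> e"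
      by (rule approx_by_products[OF E \<psi>]) (rule that)
    have "(\<lambda>x. \<Sum>j\<in>J. c j * (\<Prod>i<m. G j i (x i))) \<in> borel_measurable (Pi\<^sub>M {..<m} (\<lambda>_. borel))"
      by (intro borel_measurable_sum borel_measurable_times borel_measurable_const
          measurable_product_function borel_measurable_continuous_onI *(2))
    then show "\<exists>g\<in>borel_measurable (Pi\<^sub>M {..<m} (\<lambda>_. borel)).
        \<forall>x\<in>space (Pi\<^sub>M {..<m} (\<lambda>_. borel)). \<bar>\<psi> x - g x\<bar> \<le> e"
      by (rule bexI[rotated]) (intro ballI *(4), simp add: space_PiM)
  qed
  with C show ?thesis by (simp add: bdd_meas_def)
qed

lemma M1_prob: "\<mu> \<in> space (prob_algebra borel) \<Longrightarrow> prob_space \<mu>"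
  by (simp add: space_prob_algebra)

lemma M1_measure: "(\<mu> :: 'a::metric_space measure) \<in> space (prob_algebra borel) \<Longrightarrow> measure \<mu> UNIV = 1"
  using prob_space.prob_space[OF M1_prob, of \<mu>] by (simp add: fin_measuresD(3)[OF M1_fin])

lemma pairing_product:
  assumes \<mu>: "\<mu> \<in> fin_measures" and "\<And>i. i < m \<Longrightarrow> G i \<in> borel_measurable borel" "\<And>i x. i < m \<Longrightarrow> \<bar>G i x\<bar> \<le> 1"
  shows "pairing m (\<lambda>x. \<Prod>i<m. G i (x i)) \<mu> = (\<Prod>i<m. \<integral>x. G i x \<partial>\<mu>)"
proof -
  interpret product_sigma_finite "\<lambda>_::nat. \<mu>" using \<mu> by (rule product_sigma_finite_fin_measures)
  show ?thesis
    unfolding pairing_def using integrable_bounded[OF fin_measuresD(1,2)[OF \<mu>] assms(2,3)]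
    by (intro product_integral_prod) auto
qed

lemma pairing_approx:
  assumes E: "compact (UNIV :: 'a::metric_space set)" and \<psi>: "cont_fun m (\<psi> :: (nat \<Rightarrow> 'a) \<Rightarrow> real)"
    and e: "0 < e"
  obtains J :: "(nat \<Rightarrow> 'a::metric_space) set" and c :: "(nat \<Rightarrow> 'a::metric_space) \<Rightarrow> real" and G :: "(nat \<Rightarrow> 'a::metric_space) \<Rightarrow> nat \<Rightarrow> 'a::metric_space \<Rightarrow> real"
  where "finite J" "\<And>j i. continuous_on UNIV (G j i)" "\<And>j i x. \<bar>G j i x\<bar> \<le> 1"
    "\<And>x. x \<in> {..<m} \<rightarrow>\<^sub>E UNIV \<Longrightarrow> \<bar>\<psi> x - (\<Sum>j\<in>J. c j * (\<Prod>i<m. G j i (x i)))\<bar> \<le> e"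
    "\<And>\<mu>. \<mu> \<in> space (prob_algebra borel) \<Longrightarrow>
      \<bar>pairing m \<psi> \<mu> - (\<Sum>j\<in>J. c j * (\<Prod>i<m. \<integral>x. G j i x \<partial>\<mu>))\<bar> \<le> e"
proof -
  obtain J :: "(nat \<Rightarrow> 'a) set" and c and G :: "(nat \<Rightarrow> 'a) \<Rightarrow> nat \<Rightarrow> 'a \<Rightarrow> real" where *:
    "finite J" "\<And>j i. continuous_on UNIV (G j i)" "\<And>j i x. \<bar>G j i x\<bar> \<le> 1"
    "\<And>x. x \<in> {..<m} \<rightarrow>\<^sub>E UNIV \<Longrightarrow> \<bar>\<psi> x - (\<Sum>j\<in>J. c j * (\<Prod>i<m. G j i (x i)))\<bar> \<le> e"
    by (rule approx_by_products[OF E \<psi> e]) (rule that)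
  have meas: "G j i \<in> borel_measurable borel" for j i by (intro borel_measurable_continuous_onI *(2))
  have bj: "bdd_meas m 1 (\<lambda>x. \<Prod>i<m. G j i (x i))" for j by (intro bdd_meas_product meas *(3))
  obtain C where "bdd_meas m C \<psi>" using cont_fun_ucont(2)[OF E \<psi>] bdd_meas_cont_fun[OF E \<psi>] by blast
  have "\<bar>pairing m \<psi> \<mu> - (\<Sum>j\<in>J. c j * (\<Prod>i<m. \<integral>x. G j i x \<partial>\<mu>))\<bar> \<le> e"
    if \<mu>: "\<mu> \<in> space (prob_algebra borel)" for \<mu>
  proof -
    note \<mu>' = M1_fin[OF \<mu>]
    have "(\<Sum>j\<in>J. c j * (\<Prod>i<m. \<integral>x. G j i x \<partial>\<mu>)) = pairing m (\<lambda>x. \<Sum>j\<in>J. c j * (\<Prod>i<m. G j i (x i))) \<mu>"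
      using pairing_product[OF \<mu>' meas *(3)] by (subst pairing_sum[OF \<mu>' bj]) simp
    also have "pairing m \<psi> \<mu> - \<dots> = pairing m (\<lambda>x. \<psi> x - (\<Sum>j\<in>J. c j * (\<Prod>i<m. G j i (x i)))) \<mu>"
      by (rule pairing_diff[OF \<mu>' \<open>bdd_meas m C \<psi>\<close> bdd_meas_sum[OF *(1) bdd_meas_cmult[OF bj]], symmetric])
    also have "\<bar>\<dots>\<bar> \<le> e * measure \<mu> UNIV ^ m" by (rule pairing_bound[OF \<mu>' *(4)])
    finally show ?thesis by (simp add: M1_measure[OF \<mu>])
  qed
  with * show thesis by (intro that[of J G c]) auto
qed

lemma measurable_integral_prob_algebra:
  "g \<in> borel_measurable borel \<Longrightarrow> (\<lambda>\<mu>. \<integral>x. (g x :: real) \<partial>\<mu>) \<in> borel_measurable (prob_algebra borel)"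
  unfolding prob_algebra_def by (intro measurable_restrict_space1 integral_measurable_subprob_algebra)

lemma measurable_pairing:
  assumes E: "compact (UNIV :: 'a::metric_space set)" and \<psi>: "cont_fun m (\<psi> :: (nat \<Rightarrow> 'a) \<Rightarrow> real)"
  shows "pairing m \<psi> \<in> borel_measurable (prob_algebra borel)"
proof (rule borel_measurable_uniform_approx)
  fix e :: real assume "0 < e"
  then obtain J :: "(nat \<Rightarrow> 'a) set" and c and G :: "(nat \<Rightarrow> 'a) \<Rightarrow> nat \<Rightarrow> 'a \<Rightarrow> real" where *:
    "finite J" "\<And>j i. continuous_on UNIV (G j i)" "\<And>j i x. \<bar>G j i x\<bar> \<le> 1"
    "\<And>\<mu>. \<mu> \<in> space (prob_algebra borel) \<Longrightarrow>
      \<bar>pairing m \<psi> \<mu> - (\<Sum>j\<in>J. c j * (\<Prod>i<m. \<integral>x. G j i x \<partial>\<mu>))\<bar> \<le> e"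
    by (rule pairing_approx[OF E \<psi>]) (rule that)
  have "(\<lambda>\<mu>. \<integral>x. G j i x \<partial>\<mu>) \<in> borel_measurable (prob_algebra borel)" for j i
    by (rule measurable_integral_prob_algebra[OF borel_measurable_continuous_onI[OF *(2)]])
  then have "(\<lambda>\<mu>. \<Sum>j\<in>J. c j * (\<Prod>i<m. \<integral>x. G j i x \<partial>\<mu>)) \<in> borel_measurable (prob_algebra borel)"
    by (intro borel_measurable_sum borel_measurable_times borel_measurable_const borel_measurable_prod)
  then show "\<exists>g\<in>borel_measurable (prob_algebra borel).
      \<forall>\<mu>\<in>space (prob_algebra borel). \<bar>pairing m \<psi> \<mu> - g \<mu>\<bar> \<le> e"
    by (rule bexI[rotated]) (intro ballI *(4))
qed

text \<open>Weak continuity of a path of measures concerns functions of one variable; uniform approximation by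
  sums of products extends it to \<open>C(E\<^sup>m)\<close>.\<close>
lemma continuous_on_pairing_path:
  assumes E: "compact (UNIV :: 'a::metric_space set)" and \<psi>: "cont_fun m (\<psi> :: (nat \<Rightarrow> 'a) \<Rightarrow> real)"
    and z: "\<And>t. t \<in> T \<Longrightarrow> z t \<in> space (prob_algebra borel)"
    and cont: "\<And>g :: 'a \<Rightarrow> real. continuous_on UNIV g \<Longrightarrow> continuous_on T (\<lambda>t. \<integral>x. g x \<partial>z t)"
  shows "continuous_on T (\<lambda>t. pairing m \<psi> (z t))"
proof -
  have "\<exists>f. continuous_on T f \<and> (\<forall>t\<in>T. \<bar>pairing m \<psi> (z t) - f t\<bar> \<le> 1 / real (Suc n))" for n
  proof -
    have "0 < 1 / real (Suc n)" by simp
    obtain J :: "(nat \<Rightarrow> 'a) set" and c and G :: "(nat \<Rightarrow> 'a) \<Rightarrow> nat \<Rightarrow> 'a \<Rightarrow> real" where *: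
      "finite J" "\<And>j i. continuous_on UNIV (G j i)" "\<And>j i x. \<bar>G j i x\<bar> \<le> 1"
      "\<And>\<mu>. \<mu> \<in> space (prob_algebra borel) \<Longrightarrow>
        \<bar>pairing m \<psi> \<mu> - (\<Sum>j\<in>J. c j * (\<Prod>i<m. \<integral>x. G j i x \<partial>\<mu>))\<bar> \<le> 1 / real (Suc n)"
      by (rule pairing_approx[OF E \<psi> \<open>0 < 1 / real (Suc n)\<close>]) (rule that)
    have "continuous_on T (\<lambda>t. \<Sum>j\<in>J. c j * (\<Prod>i<m. \<integral>x. G j i x \<partial>z t))"
      by (intro continuous_intros cont *(2))
    with *(4) z show ?thesis by blast
  qed
  then obtain f where f: "\<And>n. continuous_on T (f n)"
    "\<And>n t. t \<in> T \<Longrightarrow> \<bar>pairing m \<psi> (z t) - f n t\<bar> \<le> 1 / real (Suc n)" by metis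
  show ?thesis
  proof (rule uniform_limit_theorem[of _ f sequentially])
    show "uniform_limit T f (\<lambda>t. pairing m \<psi> (z t)) sequentially"
    proof (rule uniform_limitI)
      fix e :: real assume "0 < e"
      then obtain N where N: "1 / real (Suc N) < e" using nat_approx_posE by blast
      show "\<forall>\<^sub>F n in sequentially. \<forall>t\<in>T. dist (f n t) (pairing m \<psi> (z t)) < e"
        using eventually_ge_at_top[of N]
      proof eventually_elim
        case (elim n)
        then have "1 / real (Suc n) \<le> 1 / real (Suc N)" by (simp add: frac_le)
        with N f(2)[of _ n] show ?case by (fastforce simp: dist_real_def abs_minus_commute)
      qed
    qed
  qed (use f(1) in auto)
qed

section \<open>The mean transition of the dual process\<close>

lemma sum_moves:
  "(\<Sum>v\<in>moves m. f v) = (\<Sum>j<m. \<Sum>i<j. f (Coalesce i j)) + (\<Sum>i<m. f (Integrate i))"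
proof -
  have moves: "moves m = (\<lambda>(j, i). Coalesce i j) ` Sigma {..<m} (\<lambda>j. {..<j}) \<union> Integrate ` {..<m}"
    by (auto simp: moves_def image_iff)
  have "(\<Sum>v\<in>moves m. f v) = (\<Sum>v\<in>(\<lambda>(j, i). Coalesce i j) ` Sigma {..<m} (\<lambda>j. {..<j}). f v)
      + (\<Sum>v\<in>Integrate ` {..<m}. f v)"
    unfolding moves by (rule sum.union_disjoint) auto
  also have "(\<Sum>v\<in>(\<lambda>(j, i). Coalesce i j) ` Sigma {..<m} (\<lambda>j. {..<j}). f v) = (\<Sum>j<m. \<Sum>i<j. f (Coalesce i j))"
    by (subst sum.reindex) (auto simp: inj_on_def sum.Sigma case_prod_beta')
  also have "(\<Sum>v\<in>Integrate ` {..<m}. f v) = (\<Sum>i<m. f (Integrate i))"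
    by (subst sum.reindex) (auto simp: inj_on_def)
  finally show ?thesis .
qed

lemma exit_rate_eq: "exit_rate \<theta> m = real m * (real m - 1 + \<theta>) / 2"
proof -
  have "exit_rate \<theta> m = (\<Sum>j<m. real j) + real m * \<theta> / 2"
    by (simp add: exit_rate_def sum_moves)
  also have "(\<Sum>j<m. real j) = real m * (real m - 1) / 2"
    by (induction m) (simp_all add: field_simps)
  finally show ?thesis by (simp add: field_simps)
qed

lemma move_cases:
  assumes "v \<in> moves m"
  obtains (Coalesce) i j where "v = Coalesce i j" "i < j" "j < m"
    | (Integrate) i where "v = Integrate i" "i < m"
  using assms unfolding moves_def by blast

lemma bdd_meas_move:
  assumes \<psi>: "bdd_meas m C \<psi>" and v: "v \<in> moves m" and \<pi>: "\<pi> \<in> space (prob_algebra borel)"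
  shows "bdd_meas (m - 1) C (snd (apply_move \<pi> (m, \<psi>) v))"
  using v
proof (cases rule: move_cases)
  case (Coalesce i j)
  have "i < m - 1" using Coalesce by simp
  then have "(\<lambda>x. x i) \<in> borel_measurable (Pi\<^sub>M {..<m-1} (\<lambda>_. borel :: 'a measure))"
    by (intro measurable_component_singleton) simp
  then show ?thesis
    using Coalesce unfolding bdd_meas_def
    by (auto intro!: measurable_bdd_meas_insert[OF \<psi>] bdd_meas_abs_insert[OF \<psi>])
next
  case (Integrate i)
  interpret prob_space \<pi> using \<pi> by (rule M1_prob)
  have s: "sets \<pi> = sets borel" using fin_measuresD(2)[OF M1_fin[OF \<pi>]] .
  have "(\<lambda>(x, a). \<psi> (insert_coord m i a x)) \<in> borel_measurable (Pi\<^sub>M {..<m-1} (\<lambda>_. borel) \<Otimes>\<^sub>M \<pi>)"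
    unfolding case_prod_beta'
    by (rule measurable_bdd_meas_insert[OF \<psi> Integrate(2)]) (auto simp: measurable_cong_sets[OF refl s[symmetric]])
  then have "(\<lambda>x. \<integral>a. \<psi> (insert_coord m i a x) \<partial>\<pi>) \<in> borel_measurable (Pi\<^sub>M {..<m-1} (\<lambda>_. borel))"
    by (rule borel_measurable_lebesgue_integral)
  moreover have "\<bar>\<integral>a. \<psi> (insert_coord m i a x) \<partial>\<pi>\<bar> \<le> C" for x
    using bounded_integral_le[OF finite_measure_axioms bdd_meas_abs_insert[OF \<psi>]] by (simp add: prob_space)
  ultimately show ?thesis unfolding bdd_meas_def by (simp add: Integrate)
qed

text \<open>The conditional mean of the next state of the jump chain when the present state is \<open>(m, \<psi>)\<close>.\<close>
definition mean_step ::
  "real \<Rightarrow> 'a::metric_space measure \<Rightarrow> nat \<Rightarrow> ((nat \<Rightarrow> 'a) \<Rightarrow> real) \<Rightarrow> (nat \<Rightarrow> 'a) \<Rightarrow> real" where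
  "mean_step \<theta> \<pi> m \<psi> x =
     (\<Sum>v\<in>moves m. move_rate \<theta> v / exit_rate \<theta> m * snd (apply_move \<pi> (m, \<psi>) v) x)"

lemma sum_move_weights:
  assumes "0 < \<theta>" "1 \<le> m"
  shows "(\<Sum>v\<in>moves m. move_rate \<theta> v / exit_rate \<theta> m) = 1"
  using exit_rate_pos[OF assms] by (simp add: sum_divide_distrib[symmetric] exit_rate_def)

lemma bdd_meas_mean_step:
  assumes \<psi>: "bdd_meas m C \<psi>" and \<pi>: "\<pi> \<in> space (prob_algebra borel)" and \<theta>: "0 < \<theta>" and m: "1 \<le> m"
  shows "bdd_meas (m - 1) C (mean_step \<theta> \<pi> m \<psi>)"
proof -
  let ?w = "\<lambda>v. move_rate \<theta> v / exit_rate \<theta> m"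
  have pos: "0 \<le> ?w v" for v
    using exit_rate_pos[OF \<theta> m] move_rate_pos[OF \<theta>, of v] by simp
  have "bdd_meas (m - 1) (\<Sum>v\<in>moves m. \<bar>?w v\<bar> * C) (mean_step \<theta> \<pi> m \<psi>)"
    unfolding mean_step_def by (intro bdd_meas_sum finite_moves bdd_meas_cmult bdd_meas_move \<psi> \<pi>)
  moreover have "(\<Sum>v\<in>moves m. \<bar>?w v\<bar> * C) = C"
    unfolding abs_of_nonneg[OF pos] sum_distrib_right[symmetric] sum_move_weights[OF \<theta> m] by simp
  ultimately show ?thesis by simp
qed

lemma dist_insert_coord:
  assumes "0 < \<delta>" "\<And>l. l < m - 1 \<Longrightarrow> dist (x l) (y l) < \<delta>" "dist a b < \<delta>" "i < m" "l < m"
  shows "dist (insert_coord m i a x l) (insert_coord m i b y l) < \<delta>"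
  using assms(2)[of l] assms(2)[of "l - 1"] assms(3-5) by (auto simp: insert_coord_def)

lemma ucont_move:
  assumes E: "compact (UNIV :: 'a::metric_space set)"
    and \<psi>: "ucont m (\<psi> :: (nat \<Rightarrow> 'a) \<Rightarrow> real)" and v: "v \<in> moves m"
    and \<pi>: "\<pi> \<in> space (prob_algebra borel)"
  shows "ucont (m - 1) (snd (apply_move \<pi> (m, \<psi>) v))"
  unfolding ucont_def
proof (intro allI impI)
  fix e :: real assume "0 < e"
  then have "0 < e / 2" by simp
  then obtain \<delta> where \<delta>: "0 < \<delta>" "\<And>x y. x \<in> {..<m} \<rightarrow>\<^sub>E UNIV \<Longrightarrow> y \<in> {..<m} \<rightarrow>\<^sub>E UNIV \<Longrightarrow>
      (\<forall>i<m. dist (x i) (y i) < \<delta>) \<Longrightarrow> \<bar>\<psi> x - \<psi> y\<bar> < e / 2"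
    using \<psi> unfolding ucont_def by meson
  have ins: "\<bar>\<psi> (insert_coord m i a x) - \<psi> (insert_coord m i b y)\<bar> < e / 2"
    if "\<forall>l<m - 1. dist (x l) (y l) < \<delta>" "dist a b < \<delta>" "i < m" for x y a b i
    using that \<delta>(1) by (intro \<delta>(2) insert_coord_PiE allI impI dist_insert_coord) auto
  have "\<bar>snd (apply_move \<pi> (m, \<psi>) v) x - snd (apply_move \<pi> (m, \<psi>) v) y\<bar> < e"
    if xy: "\<forall>l<m - 1. dist (x l) (y l) < \<delta>" and PiE: "x \<in> {..<m-1} \<rightarrow>\<^sub>E UNIV" "y \<in> {..<m-1} \<rightarrow>\<^sub>E UNIV" for x y
    using v
  proof (cases rule: move_cases)
    case (Coalesce i j)
    then have "dist (x i) (y i) < \<delta>" using xy by auto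
    from ins[OF xy this Coalesce(3)] show ?thesis using \<open>0 < e\<close> by (simp add: Coalesce(1))
  next
    case (Integrate i)
    interpret prob_space \<pi> using \<pi> by (rule M1_prob)
    obtain C where \<psi>C: "bdd_meas m C \<psi>"
      using bdd_meas_cont_fun[OF E ucont_cont_fun[OF \<psi>]] cont_fun_ucont(2)[OF E ucont_cont_fun[OF \<psi>]] by blast
    have int: "integrable \<pi> (\<lambda>a. \<psi> (insert_coord m i a x))" if "x \<in> {..<m-1} \<rightarrow>\<^sub>E UNIV" for x
      using that
      by (intro integrable_bounded[OF fin_measuresD(1,2)[OF M1_fin[OF \<pi>]] measurable_bdd_meas_insert[OF \<psi>C Integrate(2)]
            bdd_meas_abs_insert[OF \<psi>C]] measurable_ident_sets[OF refl, unfolded id_def] measurable_const)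
         (auto simp: space_PiM)
    let ?d = "\<lambda>a. \<psi> (insert_coord m i a x) - \<psi> (insert_coord m i a y)"
    have "snd (apply_move \<pi> (m, \<psi>) v) x - snd (apply_move \<pi> (m, \<psi>) v) y = (\<integral>a. ?d a \<partial>\<pi>)"
      using int[OF PiE(1)] int[OF PiE(2)] by (simp add: Integrate)
    also have "\<bar>\<dots>\<bar> \<le> e / 2 * measure \<pi> (space \<pi>)"
      using ins[OF xy _ Integrate(2)] \<delta>(1)
      by (intro bounded_integral_le finite_measure_axioms) (simp add: less_imp_le)
    also have "\<dots> < e" using \<open>0 < e\<close> by (simp add: prob_space)
    finally show ?thesis .
  qed
  with \<delta>(1) show "\<exists>\<delta>>0. \<forall>x\<in>{..<m - 1} \<rightarrow>\<^sub>E UNIV. \<forall>y\<in>{..<m - 1} \<rightarrow>\<^sub>E UNIV.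
     (\<forall>i<m - 1. dist (x i) (y i) < \<delta>) \<longrightarrow> \<bar>snd (apply_move \<pi> (m, \<psi>) v) x - snd (apply_move \<pi> (m, \<psi>) v) y\<bar> < e"
    by blast
qed

lemma cont_fun_mean_step:
  assumes E: "compact (UNIV :: 'a::metric_space set)"
    and \<psi>: "cont_fun m (\<psi> :: (nat \<Rightarrow> 'a) \<Rightarrow> real)" and \<pi>: "\<pi> \<in> space (prob_algebra borel)"
  shows "cont_fun (m - 1) (mean_step \<theta> \<pi> m \<psi>)"
proof -
  have "cont_fun (m - 1) (snd (apply_move \<pi> (m, \<psi>) v))" if "v \<in> moves m" for v
    by (intro ucont_cont_fun ucont_move[OF E _ that \<pi>] cont_fun_ucont[OF E \<psi>])
  then show ?thesis
    unfolding cont_fun_def mean_step_def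
    by (intro continuous_map_sum finite_moves continuous_map_real_mult_left)
qed

section \<open>The generator on polynomial functionals\<close>

lemma sum_Sigma_pairs:
  assumes "finite A" "\<And>x. x \<in> A \<Longrightarrow> finite (B x)"
  shows "(\<Sum>p\<in>Sigma A B. f p) = (\<Sum>x\<in>A. \<Sum>y\<in>B x. f (x, y))"
  using assms by (subst sum.Sigma) auto

text \<open>Truncated subtraction is harmless here: when a dimension is too small, an index set is empty.\<close>
lemma mderivs_polynomial:
  assumes J: "finite J" and \<psi>: "\<And>j. j \<in> J \<Longrightarrow> bdd_meas (d j) (C j) (\<psi> j)"
    and F: "\<And>\<mu>. \<mu> \<in> fin_measures \<Longrightarrow> F \<mu> = c0 + (\<Sum>j\<in>J. c j * pairing (d j) (\<psi> j) \<mu>)"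
    and \<mu>: "\<mu> \<in> fin_measures"
  shows "mdifferentiable F x \<mu>" "mdifferentiable (mderiv F x) y \<mu>"
    "mdifferentiable (mderiv2 F x y) z \<mu>"
    "mderiv F x \<mu> = (\<Sum>j\<in>J. c j * (\<Sum>i<d j.
       pairing (d j - 1) (\<lambda>w. \<psi> j (insert_coord (d j) i x w)) \<mu>))"
    "mderiv2 F x y \<mu> = (\<Sum>j\<in>J. c j * (\<Sum>i<d j. \<Sum>l<d j - 1.
       pairing (d j - 1 - 1) (\<lambda>w. \<psi> j (insert_coord (d j) i x (insert_coord (d j - 1) l y w))) \<mu>))"
    "mderiv3 F x y z \<mu> = (\<Sum>j\<in>J. c j * (\<Sum>i<d j. \<Sum>l<d j - 1. \<Sum>n<d j - 1 - 1.
       pairing (d j - 1 - 1 - 1) (\<lambda>w. \<psi> j (insert_coord (d j) i x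
         (insert_coord (d j - 1) l y (insert_coord (d j - 1 - 1) n z w)))) \<mu>))"
proof -
  define J1 where "J1 = Sigma J (\<lambda>j. {..<d j})"
  define J2 where "J2 = Sigma J1 (\<lambda>p. {..<d (fst p) - 1})"
  define \<psi>1 where "\<psi>1 p w = \<psi> (fst p) (insert_coord (d (fst p)) (snd p) x w)" for p w
  define \<psi>2 where "\<psi>2 q w = \<psi>1 (fst q) (insert_coord (d (fst (fst q)) - 1) (snd q) y w)" for q w
  have fin: "finite J1" "finite J2" using J by (auto simp: J1_def J2_def)
  have \<psi>1: "bdd_meas (d (fst p) - 1) (C (fst p)) (\<psi>1 p)" if "p \<in> J1" for p
    using that unfolding \<psi>1_def J1_def by (intro bdd_meas_insert \<psi>) auto
  have \<psi>2: "bdd_meas (d (fst (fst q)) - 1 - 1) (C (fst (fst q))) (\<psi>2 q)" if "q \<in> J2" for q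
    using that unfolding \<psi>2_def J2_def by (intro bdd_meas_insert \<psi>1) auto
  have F1: "mderiv F x \<nu> = 0 + (\<Sum>p\<in>J1. c (fst p) * pairing (d (fst p) - 1) (\<psi>1 p) \<nu>)"
    "mdifferentiable F x \<nu>" if "\<nu> \<in> fin_measures" for \<nu>
    using mderiv_polynomial[of J d C \<psi> F c0 c \<nu> x, OF J \<psi> F that]
    unfolding J1_def \<psi>1_def by simp_all
  have F2: "mderiv2 F x y \<nu> = 0 + (\<Sum>q\<in>J2. c (fst (fst q)) * pairing (d (fst (fst q)) - 1 - 1) (\<psi>2 q) \<nu>)"
    "mdifferentiable (mderiv F x) y \<nu>" if "\<nu> \<in> fin_measures" for \<nu>
    using mderiv_polynomial[of J1 "\<lambda>p. d (fst p) - 1" "\<lambda>p. C (fst p)" \<psi>1 "mderiv F x" 0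
      "\<lambda>p. c (fst p)" \<nu> y, OF fin(1) \<psi>1 F1(1) that]
    unfolding mderiv2_def J2_def \<psi>2_def by simp_all
  have F3: "mderiv3 F x y z \<mu> = (\<Sum>r\<in>Sigma J2 (\<lambda>q. {..<d (fst (fst q)) - 1 - 1}). c (fst (fst (fst r))) *
      pairing (d (fst (fst (fst r))) - 1 - 1 - 1)
       (\<lambda>w. \<psi>2 (fst r) (insert_coord (d (fst (fst (fst r))) - 1 - 1) (snd r) z w)) \<mu>)"
    "mdifferentiable (mderiv2 F x y) z \<mu>"
    using mderiv_polynomial[of J2 "\<lambda>q. d (fst (fst q)) - 1 - 1" "\<lambda>q. C (fst (fst q))" \<psi>2 "mderiv2 F x y" 0
      "\<lambda>q. c (fst (fst q))" \<mu> z, OF fin(2) \<psi>2 F2(1) \<mu>]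
    unfolding mderiv3_def by simp_all
  show "mdifferentiable F x \<mu>" "mdifferentiable (mderiv F x) y \<mu>" "mdifferentiable (mderiv2 F x y) z \<mu>"
    using F1(2) F2(2) F3(2) \<mu> by blast+
  show "mderiv F x \<mu> = (\<Sum>j\<in>J. c j * (\<Sum>i<d j.
       pairing (d j - 1) (\<lambda>w. \<psi> j (insert_coord (d j) i x w)) \<mu>))"
    unfolding F1(1)[OF \<mu>] J1_def \<psi>1_def using J by (simp add: sum_Sigma_pairs sum_distrib_left)
  show "mderiv2 F x y \<mu> = (\<Sum>j\<in>J. c j * (\<Sum>i<d j. \<Sum>l<d j - 1.
       pairing (d j - 1 - 1) (\<lambda>w. \<psi> j (insert_coord (d j) i x (insert_coord (d j - 1) l y w))) \<mu>))"
    unfolding F2(1)[OF \<mu>] J2_def J1_def \<psi>1_def \<psi>2_def using J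
    by (simp add: sum_Sigma_pairs sum_distrib_left)
  show "mderiv3 F x y z \<mu> = (\<Sum>j\<in>J. c j * (\<Sum>i<d j. \<Sum>l<d j - 1. \<Sum>n<d j - 1 - 1.
       pairing (d j - 1 - 1 - 1) (\<lambda>w. \<psi> j (insert_coord (d j) i x
         (insert_coord (d j - 1) l y (insert_coord (d j - 1 - 1) n z w)))) \<mu>))"
    unfolding F3(1) J2_def J1_def \<psi>1_def \<psi>2_def using J
    by (simp add: sum_Sigma_pairs sum_distrib_left)
qed

lemma pairing_insert_integral:
  assumes \<mu>: "\<mu> \<in> fin_measures" and \<nu>: "\<nu> \<in> space (prob_algebra borel)" and \<psi>: "bdd_meas m C \<psi>" and i: "i < m"
  shows "(\<integral>x. pairing (m - 1) (\<lambda>y. \<psi> (insert_coord m i x y)) \<mu> \<partial>\<nu>)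
    = pairing (m - 1) (snd (apply_move \<nu> (m, \<psi>) (Integrate i))) \<mu>"
  using pairing_integral_swap(1)[OF \<mu> fin_measuresD(1)[OF M1_fin[OF \<nu>]]
      measurable_bdd_meas_insert_pair[OF \<psi> i fin_measuresD(2)[OF M1_fin[OF \<nu>]]] bdd_meas_abs_insert[OF \<psi>]]
  by simp

text \<open>Putting the same point into two coordinates and integrating it over \<open>\<mu>\<close> identifies the coordinates. This
  is how the resampling term of the generator produces the coalescences of the dual process.\<close>
lemma pairing_coalesce:
  assumes \<mu>: "\<mu> \<in> fin_measures" and \<psi>: "bdd_meas m C \<psi>" and ij: "i < j" "j < m"
  shows "(\<integral>x. pairing (m - 1 - 1) (\<lambda>w. \<psi> (insert_coord m j x (insert_coord (m - 1) i x w))) \<mu> \<partial>\<mu>)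
    = pairing (m - 1) (snd (apply_move \<pi> (m, \<psi>) (Coalesce i j))) \<mu>"
proof -
  have i: "i < m - 1" using ij by simp
  have "(\<lambda>x. x i) \<in> borel_measurable (Pi\<^sub>M {..<m-1} (\<lambda>_. borel :: 'a measure))"
    using i by (intro measurable_component_singleton) simp
  then have bdd_meas: "bdd_meas (m - 1) C (\<lambda>x. \<psi> (insert_coord m j (x i) x))"
    using ij unfolding bdd_meas_def
    by (auto intro!: measurable_bdd_meas_insert[OF \<psi>] bdd_meas_abs_insert[OF \<psi>])
  have "insert_coord (m - 1) i x w i = x" for x :: 'a and w using i by (simp add: insert_coord_def)
  then show ?thesis using pairing_insert[OF \<mu> bdd_meas i] by simp
qed

text \<open>When coordinate \<open>i\<close> has been removed, the \<open>l\<close>-th remaining one is the original coordinate \<open>l\<close> or \<open>l + 1\<close>,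
  according to whether \<open>l < i\<close>. Hence the left-hand side runs over ordered pairs of distinct coordinates.\<close>
lemma sum_ordered_pairs:
  fixes K :: "nat \<Rightarrow> nat \<Rightarrow> real"
  shows "(\<Sum>i<m. \<Sum>l<m - 1. if l < i then K l i else K i (Suc l)) = 2 * (\<Sum>j<m. \<Sum>i<j. K i j)"
proof (induction m)
  case (Suc m)
  have eq: "(\<Sum>l<m. if l < i then K l i else K i (Suc l)) =
      (\<Sum>l<m - 1. if l < i then K l i else K i (Suc l)) + K i m" if "i < m" for i
    using that by (cases m) (auto simp: not_less)
  have last: "(\<Sum>l<m. if l < m then K l m else K m (Suc l)) = (\<Sum>l<m. K l m)"
    by (intro sum.cong) auto
  have "(\<Sum>i<Suc m. \<Sum>l<Suc m - 1. if l < i then K l i else K i (Suc l))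
     = (\<Sum>i<m. \<Sum>l<m. if l < i then K l i else K i (Suc l)) + (\<Sum>l<m. K l m)"
    by (simp add: last)
  also have "(\<Sum>i<m. \<Sum>l<m. if l < i then K l i else K i (Suc l))
      = (\<Sum>i<m. (\<Sum>l<m - 1. if l < i then K l i else K i (Suc l)) + K i m)"
    using eq by (intro sum.cong) auto
  also have "\<dots> = 2 * (\<Sum>j<m. \<Sum>i<j. K i j) + (\<Sum>i<m. K i m)"
    using Suc by (simp add: sum.distrib)
  also have "2 * (\<Sum>j<m. \<Sum>i<j. K i j) + (\<Sum>i<m. K i m) + (\<Sum>l<m. K l m)
      = 2 * (\<Sum>j<Suc m. \<Sum>i<j. K i j)" by simp
  finally show ?case .
qed simp

lemma measurable_pairing_insert_insert:
  assumes \<mu>: "\<mu> \<in> fin_measures" and \<psi>: "bdd_meas m C \<psi>" and i: "i < m" and l: "l < m - 1"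
    and f: "f \<in> borel_measurable M" and g: "g \<in> borel_measurable M"
  shows "(\<lambda>p. pairing (m - 1 - 1) (\<lambda>w. \<psi> (insert_coord m i (f p) (insert_coord (m - 1) l (g p) w))) \<mu>)
    \<in> borel_measurable M"
proof (rule measurable_pairing_param[OF \<mu>])
  show "(\<lambda>(p, w). \<psi> (insert_coord m i (f p) (insert_coord (m - 1) l (g p) w)))
    \<in> borel_measurable (M \<Otimes>\<^sub>M Pi\<^sub>M {..<m - 1 - 1} (\<lambda>_. borel))"
    unfolding case_prod_beta'
    by (intro measurable_bdd_meas_insert[OF \<psi> i] measurable_insert_coord[OF l] measurable_compose[OF measurable_fst f]
        measurable_compose[OF measurable_fst g] measurable_snd)
qed

text \<open>The four integrals of the generator, for a single pairing: \<open>\<pi>\<close> produces the integration moves, the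
  diagonal part of the second-order term the coalescences, and the two remaining terms multiples of the
  pairing itself.\<close>
lemma generator_terms:
  assumes \<mu>: "\<mu> \<in> space (prob_algebra borel)" and \<pi>: "\<pi> \<in> space (prob_algebra borel)" and \<psi>: "bdd_meas m C \<psi>"
  defines "D1 \<equiv> \<lambda>x. \<Sum>i<m. pairing (m - 1) (\<lambda>w. \<psi> (insert_coord m i x w)) \<mu>"
    and "D2 \<equiv> \<lambda>x y. \<Sum>i<m. \<Sum>l<m - 1.
       pairing (m - 1 - 1) (\<lambda>w. \<psi> (insert_coord m i x (insert_coord (m - 1) l y w))) \<mu>"
  shows "integrable \<pi> D1" "integrable \<mu> D1" "integrable \<mu> (\<lambda>x. D2 x x)"
    "integrable (\<mu> \<Otimes>\<^sub>M \<mu>) (\<lambda>(x, y). D2 x y)" "D2 x \<in> borel_measurable borel"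
    "(\<integral>x. D1 x \<partial>\<pi>) = (\<Sum>i<m. pairing (m - 1) (snd (apply_move \<pi> (m, \<psi>) (Integrate i))) \<mu>)"
    "(\<integral>x. D1 x \<partial>\<mu>) = real m * pairing m \<psi> \<mu>"
    "(\<integral>x. D2 x x \<partial>\<mu>) = 2 * (\<Sum>j<m. \<Sum>i<j. pairing (m - 1) (snd (apply_move \<pi> (m, \<psi>) (Coalesce i j))) \<mu>)"
    "(\<integral>(x, y). D2 x y \<partial>(\<mu> \<Otimes>\<^sub>M \<mu>)) = real m * (real m - 1) * pairing m \<psi> \<mu>"
proof -
  note \<mu>' = M1_fin[OF \<mu>] and \<pi>' = M1_fin[OF \<pi>]
  interpret P: prob_space \<mu> using \<mu> by (rule M1_prob)
  interpret PP: pair_prob_space \<mu> \<mu> by unfold_locales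
  note s = fin_measuresD(2)[OF \<mu>']
  let ?p1 = "\<lambda>i x. pairing (m - 1) (\<lambda>w. \<psi> (insert_coord m i x w)) \<mu>"
  let ?p2 = "\<lambda>i l x y. pairing (m - 1 - 1) (\<lambda>w. \<psi> (insert_coord m i x (insert_coord (m - 1) l y w))) \<mu>"
  have i1: "integrable \<nu> (?p1 i)" if "\<nu> \<in> fin_measures" "i < m" for \<nu> i
    by (rule integrable_pairing_insert[OF \<mu>' fin_measuresD(1,2)[OF that(1)] \<psi> that(2)])
  show "integrable \<pi> D1" "integrable \<mu> D1" unfolding D1_def using i1 \<mu>' \<pi>' by auto
  have bd: "\<bar>?p2 i l x y\<bar> \<le> C" for i l x y
    using pairing_bound[OF \<mu>' bdd_meas_abs_insert[OF \<psi>]] by (simp add: M1_measure[OF \<mu>])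
  have i2: "integrable \<mu> (\<lambda>x. ?p2 i l x x)" if "i < m" "l < m - 1" for i l
    using bd by (intro integrable_bounded[OF fin_measuresD(1,2)[OF \<mu>']] measurable_pairing_insert_insert[OF \<mu>' \<psi> that]) auto
  have i3: "integrable (\<mu> \<Otimes>\<^sub>M \<mu>) (\<lambda>(x, y). ?p2 i l x y)" if "i < m" "l < m - 1" for i l
  proof -
    have "(\<lambda>p. ?p2 i l (fst p) (snd p)) \<in> borel_measurable (\<mu> \<Otimes>\<^sub>M \<mu>)"
      by (intro measurable_pairing_insert_insert[OF \<mu>' \<psi> that]) (auto simp: measurable_cong_sets[OF refl s[symmetric]])
    then show ?thesis
      using bd by (intro PP.P.integrable_const_bound[of _ C]) (auto simp: case_prod_beta')
  qed
  show "integrable \<mu> (\<lambda>x. D2 x x)" unfolding D2_def by (intro Bochner_Integration.integrable_sum i2) auto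
  show "integrable (\<mu> \<Otimes>\<^sub>M \<mu>) (\<lambda>(x, y). D2 x y)"
    unfolding D2_def case_prod_beta'
    by (intro Bochner_Integration.integrable_sum i3[unfolded case_prod_beta']) auto
  show "D2 x \<in> borel_measurable borel"
    unfolding D2_def by (intro borel_measurable_sum measurable_pairing_insert_insert[OF \<mu>' \<psi>]) auto
  show "(\<integral>x. D1 x \<partial>\<pi>) = (\<Sum>i<m. pairing (m - 1) (snd (apply_move \<pi> (m, \<psi>) (Integrate i))) \<mu>)"
    unfolding D1_def using i1[OF \<pi>'] pairing_insert_integral[OF \<mu>' \<pi> \<psi>]
    by (subst Bochner_Integration.integral_sum) auto
  have I1: "(\<integral>x. ?p1 i x \<partial>\<mu>) = pairing m \<psi> \<mu>" if "i < m" for i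
    by (rule pairing_insert[OF \<mu>' \<psi> that, symmetric])
  show "(\<integral>x. D1 x \<partial>\<mu>) = real m * pairing m \<psi> \<mu>"
    unfolding D1_def using i1[OF \<mu>'] I1 by (subst Bochner_Integration.integral_sum) auto
  let ?K = "\<lambda>i j. pairing (m - 1) (snd (apply_move \<pi> (m, \<psi>) (Coalesce i j))) \<mu>"
  have I2: "(\<integral>x. ?p2 i l x x \<partial>\<mu>) = (if l < i then ?K l i else ?K i (Suc l))" if "i < m" "l < m - 1" for i l
  proof (cases "l < i")
    case True
    then show ?thesis using pairing_coalesce[OF \<mu>' \<psi> True that(1)] by simp
  next
    case False
    then have "i \<le> l" by simp
    show ?thesis
      unfolding insert_coord_commute[OF \<open>i \<le> l\<close> that(2)]
      using pairing_coalesce[OF \<mu>' \<psi>, of i "Suc l"] that False by simp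
  qed
  have "(\<integral>x. D2 x x \<partial>\<mu>) = (\<Sum>i<m. \<integral>x. (\<Sum>l<m - 1. ?p2 i l x x) \<partial>\<mu>)"
    unfolding D2_def by (intro Bochner_Integration.integral_sum Bochner_Integration.integrable_sum i2) auto
  also have "\<dots> = (\<Sum>i<m. \<Sum>l<m - 1. \<integral>x. ?p2 i l x x \<partial>\<mu>)"
    by (intro sum.cong refl Bochner_Integration.integral_sum i2) auto
  also have "\<dots> = (\<Sum>i<m. \<Sum>l<m - 1. if l < i then ?K l i else ?K i (Suc l))"
    by (intro sum.cong refl I2) auto
  finally show "(\<integral>x. D2 x x \<partial>\<mu>) = 2 * (\<Sum>j<m. \<Sum>i<j. ?K i j)"
    by (simp only: sum_ordered_pairs[where K = ?K])
  have I3: "(\<integral>p. (case p of (x, y) \<Rightarrow> ?p2 i l x y) \<partial>(\<mu> \<Otimes>\<^sub>M \<mu>)) = pairing m \<psi> \<mu>" if "i < m" "l < m - 1" for i l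
  proof -
    have "(\<integral>p. (case p of (x, y) \<Rightarrow> ?p2 i l x y) \<partial>(\<mu> \<Otimes>\<^sub>M \<mu>)) = (\<integral>x. (\<integral>y. ?p2 i l x y \<partial>\<mu>) \<partial>\<mu>)"
      using PP.integral_fst[OF i3[OF that]] by simp
    also have "\<dots> = (\<integral>x. ?p1 i x \<partial>\<mu>)"
      by (simp only: pairing_insert[OF \<mu>' bdd_meas_insert[OF \<psi> that(1)] that(2), symmetric])
    finally show ?thesis using I1[OF that(1)] by simp
  qed
  have "(\<integral>(x, y). D2 x y \<partial>(\<mu> \<Otimes>\<^sub>M \<mu>))
      = (\<Sum>i<m. \<integral>p. (\<Sum>l<m - 1. ?p2 i l (fst p) (snd p)) \<partial>(\<mu> \<Otimes>\<^sub>M \<mu>))"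
    unfolding D2_def case_prod_beta'
    by (intro Bochner_Integration.integral_sum Bochner_Integration.integrable_sum i3[unfolded case_prod_beta']) auto
  also have "\<dots> = (\<Sum>i<m. \<Sum>l<m - 1. \<integral>p. ?p2 i l (fst p) (snd p) \<partial>(\<mu> \<Otimes>\<^sub>M \<mu>))"
    by (intro sum.cong refl Bochner_Integration.integral_sum i3[unfolded case_prod_beta']) auto
  also have "\<dots> = (\<Sum>i<m. \<Sum>l<m - 1. pairing m \<psi> \<mu>)"
    by (intro sum.cong refl I3[unfolded case_prod_beta']) auto
  finally show "(\<integral>(x, y). D2 x y \<partial>(\<mu> \<Otimes>\<^sub>M \<mu>)) = real m * (real m - 1) * pairing m \<psi> \<mu>"
    by (cases m) simp_all
qed

text \<open>Duality on the level of generators. The multiples \<open>\<theta> m / 2\<close> and \<open>m (m - 1) / 2\<close> of the pairing add up to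
  the exit rate, and the other two terms are the rates of the moves times their results.\<close>
lemma fv_gen_polynomial:
  fixes F :: "'a::metric_space measure \<Rightarrow> real"
  assumes J: "finite J" and \<psi>: "\<And>j. j \<in> J \<Longrightarrow> bdd_meas (d j) (C j) (\<psi> j)"
    and F: "\<And>\<mu>. \<mu> \<in> fin_measures \<Longrightarrow> F \<mu> = c0 + (\<Sum>j\<in>J. c j * pairing (d j) (\<psi> j) \<mu>)"
    and \<mu>: "\<mu> \<in> space (prob_algebra borel)" and \<pi>: "\<pi> \<in> space (prob_algebra borel)"
    and \<theta>: "0 < \<theta>"
  shows "fv_gen_defined \<pi> F \<mu>"
    "fv_gen \<theta> \<pi> F \<mu> = (\<Sum>j\<in>J. c j * (exit_rate \<theta> (d j) *
        (pairing (d j - 1) (mean_step \<theta> \<pi> (d j) (\<psi> j)) \<mu> - pairing (d j) (\<psi> j) \<mu>)))"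
proof -
  note \<mu>' = M1_fin[OF \<mu>]
  define D1 where "D1 j x = (\<Sum>i<d j. pairing (d j - 1) (\<lambda>w. \<psi> j (insert_coord (d j) i x w)) \<mu>)" for j x
  define D2 where "D2 j x y = (\<Sum>i<d j. \<Sum>l<d j - 1.
       pairing (d j - 1 - 1) (\<lambda>w. \<psi> j (insert_coord (d j) i x (insert_coord (d j - 1) l y w))) \<mu>)" for j x y
  have m1: "mderiv F x \<mu> = (\<Sum>j\<in>J. c j * D1 j x)" for x
    using mderivs_polynomial(4)[of J d C \<psi> F c0 c \<mu> x, OF J \<psi> F \<mu>'] by (simp add: D1_def)
  have m2: "mderiv2 F x y \<mu> = (\<Sum>j\<in>J. c j * D2 j x y)" for x y
    using mderivs_polynomial(5)[of J d C \<psi> F c0 c \<mu> x y, OF J \<psi> F \<mu>'] by (simp add: D2_def)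
  note T = generator_terms[OF \<mu> \<pi> \<psi>, folded D1_def D2_def]
  have meas: "(\<lambda>y. \<Sum>j\<in>J. c j * D2 j x y) \<in> borel_measurable borel" for x
    using T(5) by (intro borel_measurable_sum borel_measurable_times borel_measurable_const) auto
  have ret: "(\<integral>y. (\<Sum>j\<in>J. c j * D2 j x y) \<partial>return borel x) = (\<Sum>j\<in>J. c j * D2 j x x)" for x
    by (rule integral_return) (use meas in auto)
  have intret: "integrable (return borel x) (\<lambda>y. \<Sum>j\<in>J. c j * D2 j x y)" for x :: 'a
  proof (subst integrable_iff_bounded, intro conjI)
    show "(\<lambda>y. \<Sum>j\<in>J. c j * D2 j x y) \<in> borel_measurable (return borel x)" using meas by simp
    show "(\<integral>\<^sup>+y. ennreal (norm (\<Sum>j\<in>J. c j * D2 j x y)) \<partial>return borel x) < \<infinity>"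
      using meas[of x] by (subst nn_integral_return) auto
  qed
  have i1: "integrable \<pi> (\<lambda>x. \<Sum>j\<in>J. c j * D1 j x)" "integrable \<mu> (\<lambda>x. \<Sum>j\<in>J. c j * D1 j x)"
    "integrable \<mu> (\<lambda>x. \<Sum>j\<in>J. c j * D2 j x x)"
    using T(1-3) by auto
  have i2: "integrable (\<mu> \<Otimes>\<^sub>M \<mu>) (\<lambda>(x, y). \<Sum>j\<in>J. c j * D2 j x y)"
    using T(4) unfolding case_prod_beta' by (intro Bochner_Integration.integrable_sum integrable_mult_right) auto
  show "fv_gen_defined \<pi> F \<mu>"
    unfolding fv_gen_defined_def m1 m2 ret using i1 i2 intret by blast
  let ?I = "\<lambda>j i. pairing (d j - 1) (snd (apply_move \<pi> (d j, \<psi> j) (Integrate i))) \<mu>"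
  let ?K = "\<lambda>j i l. pairing (d j - 1) (snd (apply_move \<pi> (d j, \<psi> j) (Coalesce i l))) \<mu>"
  have I1: "(\<integral>x. (\<Sum>j\<in>J. c j * D1 j x) \<partial>\<pi>) = (\<Sum>j\<in>J. c j * (\<Sum>i<d j. ?I j i))"
    using T(1,6) by (subst Bochner_Integration.integral_sum) auto
  have I2: "(\<integral>x. (\<Sum>j\<in>J. c j * D1 j x) \<partial>\<mu>) = (\<Sum>j\<in>J. c j * (real (d j) * pairing (d j) (\<psi> j) \<mu>))"
    using T(2,7) by (subst Bochner_Integration.integral_sum) auto
  have I3: "(\<integral>x. (\<Sum>j\<in>J. c j * D2 j x x) \<partial>\<mu>) = (\<Sum>j\<in>J. c j * (2 * (\<Sum>l<d j. \<Sum>i<l. ?K j i l)))"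
    using T(3,8) by (subst Bochner_Integration.integral_sum) auto
  have I4: "(\<integral>(x, y). (\<Sum>j\<in>J. c j * D2 j x y) \<partial>(\<mu> \<Otimes>\<^sub>M \<mu>))
      = (\<Sum>j\<in>J. c j * (real (d j) * (real (d j) - 1) * pairing (d j) (\<psi> j) \<mu>))"
    using T(4,9) unfolding case_prod_beta' by (subst Bochner_Integration.integral_sum) auto
  have step: "exit_rate \<theta> (d j) * pairing (d j - 1) (mean_step \<theta> \<pi> (d j) (\<psi> j)) \<mu>
      = (\<Sum>l<d j. \<Sum>i<l. ?K j i l) + \<theta> / 2 * (\<Sum>i<d j. ?I j i)" if j: "j \<in> J" for j
  proof (cases "d j = 0")
    case True
    then show ?thesis by (simp add: exit_rate_eq)
  next
    case False
    then have "exit_rate \<theta> (d j) \<noteq> 0" using exit_rate_pos[OF \<theta>, of "d j"] by simp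
    then have "exit_rate \<theta> (d j) * pairing (d j - 1) (mean_step \<theta> \<pi> (d j) (\<psi> j)) \<mu>
       = (\<Sum>v\<in>moves (d j). move_rate \<theta> v * pairing (d j - 1) (snd (apply_move \<pi> (d j, \<psi> j) v)) \<mu>)"
      unfolding mean_step_def
      by (subst pairing_sum[OF \<mu>' bdd_meas_move[OF \<psi>[OF j] _ \<pi>]]) (auto simp: sum_distrib_left)
    then show ?thesis by (simp add: sum_moves sum_distrib_left)
  qed
  define A where "A j = (\<Sum>l<d j. \<Sum>i<l. ?K j i l)" for j
  define B where "B j = (\<Sum>i<d j. ?I j i)" for j
  have "fv_gen \<theta> \<pi> F \<mu> = (\<Sum>j\<in>J. c j * ((\<Sum>l<d j. \<Sum>i<l. ?K j i l) + \<theta> / 2 * (\<Sum>i<d j. ?I j i)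
      - exit_rate \<theta> (d j) * pairing (d j) (\<psi> j) \<mu>))"
    unfolding fv_gen_def m1 m2 ret I1 I2 I3 I4 exit_rate_eq A_def[symmetric] B_def[symmetric]
    by (simp add: sum_subtractf[symmetric] sum_distrib_left sum.distrib[symmetric])
       (intro sum.cong refl, simp add: field_simps)
  also have "\<dots> = (\<Sum>j\<in>J. c j * (exit_rate \<theta> (d j) *
        (pairing (d j - 1) (mean_step \<theta> \<pi> (d j) (\<psi> j)) \<mu> - pairing (d j) (\<psi> j) \<mu>)))"
    by (intro sum.cong refl) (simp only: step right_diff_distrib)
  finally show "fv_gen \<theta> \<pi> F \<mu> = (\<Sum>j\<in>J. c j * (exit_rate \<theta> (d j) *
        (pairing (d j - 1) (mean_step \<theta> \<pi> (d j) (\<psi> j)) \<mu> - pairing (d j) (\<psi> j) \<mu>)))" .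
qed

section \<open>The mean state of the jump chain\<close>

text \<open>The mean of the state that the jump chain reaches from \<open>(m, \<psi>)\<close> in \<open>n\<close> jumps. The first jump is taken
  off, in accordance with \<^const>\<open>dual_chain\<close>; \<open>mean_state_Suc\<close> takes off the last one.\<close>
primrec mean_state ::
  "real \<Rightarrow> 'a::metric_space measure \<Rightarrow> nat \<Rightarrow> nat \<Rightarrow> ((nat \<Rightarrow> 'a) \<Rightarrow> real) \<Rightarrow> (nat \<Rightarrow> 'a) \<Rightarrow> real" where
  "mean_state \<theta> \<pi> 0 m \<psi> = \<psi>"
| "mean_state \<theta> \<pi> (Suc n) m \<psi> = mean_state \<theta> \<pi> n (m - 1) (mean_step \<theta> \<pi> m \<psi>)"

lemma mean_state_Suc:
  "mean_state \<theta> \<pi> (Suc n) m \<psi> = mean_step \<theta> \<pi> (m - n) (mean_state \<theta> \<pi> n m \<psi>)"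
proof (induction n arbitrary: m \<psi>)
  case (Suc n)
  have "mean_state \<theta> \<pi> (Suc (Suc n)) m \<psi> = mean_state \<theta> \<pi> (Suc n) (m - 1) (mean_step \<theta> \<pi> m \<psi>)"
    by (rule mean_state.simps(2))
  also have "\<dots> = mean_step \<theta> \<pi> (m - 1 - n) (mean_state \<theta> \<pi> n (m - 1) (mean_step \<theta> \<pi> m \<psi>))"
    by (rule Suc.IH)
  also have "\<dots> = mean_step \<theta> \<pi> (m - Suc n) (mean_state \<theta> \<pi> (Suc n) m \<psi>)" by simp
  finally show ?case .
qed simp

lemma bdd_meas_mean_state:
  assumes "0 < \<theta>" "\<pi> \<in> space (prob_algebra borel)"
  shows "bdd_meas m C \<psi> \<Longrightarrow> n \<le> m \<Longrightarrow> bdd_meas (m - n) C (mean_state \<theta> \<pi> n m \<psi>)"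
proof (induction n)
  case (Suc n)
  then have "bdd_meas (m - n - 1) C (mean_step \<theta> \<pi> (m - n) (mean_state \<theta> \<pi> n m \<psi>))"
    by (intro bdd_meas_mean_step assms) auto
  then show ?case by (simp add: mean_state_Suc del: mean_state.simps)
qed simp

lemma cont_fun_mean_state:
  assumes "compact (UNIV :: 'a::metric_space set)" "\<pi> \<in> space (prob_algebra borel)" "cont_fun m (\<psi> :: (nat \<Rightarrow> 'a) \<Rightarrow> real)"
  shows "cont_fun (m - n) (mean_state \<theta> \<pi> n m \<psi>)"
proof (induction n)
  case (Suc n)
  from cont_fun_mean_step[OF assms(1) this assms(2)] show ?case
    by (simp add: mean_state_Suc del: mean_state.simps)
qed (simp add: assms)

lemma insert_coord_restrict:
  "i < m \<Longrightarrow> insert_coord m i a (restrict x {..<m - 1}) = insert_coord m i a x"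
  by (auto simp: insert_coord_def fun_eq_iff)

lemma apply_move_sum:
  assumes \<pi>: "\<pi> \<in> space (prob_algebra borel)" and I: "finite I"
    and \<psi>: "\<And>w. w \<in> I \<Longrightarrow> bdd_meas m (C w) (\<psi> w)" and v: "v \<in> moves m"
  shows "snd (apply_move \<pi> (m, \<lambda>x. \<Sum>w\<in>I. c w * \<psi> w x) v) x
    = (\<Sum>w\<in>I. c w * snd (apply_move \<pi> (m, \<psi> w) v) x)"
  using v
proof (cases rule: move_cases)
  case (Integrate i)
  have "integrable \<pi> (\<lambda>a. \<psi> w (insert_coord m i a x))" if w: "w \<in> I" for w
  proof -
    have "restrict x {..<m - 1} \<in> space (Pi\<^sub>M {..<m - 1} (\<lambda>_. borel))" by (simp add: space_PiM)
    then have "(\<lambda>a. \<psi> w (insert_coord m i a (restrict x {..<m - 1}))) \<in> borel_measurable borel"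
      by (intro measurable_bdd_meas_insert[OF \<psi>[OF w] Integrate(2)] measurable_const) simp_all
    then show ?thesis
      unfolding insert_coord_restrict[OF Integrate(2)]
      by (rule integrable_bounded[OF fin_measuresD(1,2)[OF M1_fin[OF \<pi>]]]) (rule bdd_meas_abs_insert[OF \<psi>[OF w]])
  qed
  then show ?thesis by (simp add: Integrate(1) Bochner_Integration.integral_sum)
qed simp

lemma mean_step_sum:
  assumes "\<pi> \<in> space (prob_algebra borel)" "finite I" "\<And>w. w \<in> I \<Longrightarrow> bdd_meas m (C w) (\<psi> w)"
  shows "mean_step \<theta> \<pi> m (\<lambda>x. \<Sum>w\<in>I. c w * \<psi> w x) = (\<lambda>x. \<Sum>w\<in>I. c w * mean_step \<theta> \<pi> m (\<psi> w) x)"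
proof
  fix x
  have "mean_step \<theta> \<pi> m (\<lambda>x. \<Sum>w\<in>I. c w * \<psi> w x) x
     = (\<Sum>v\<in>moves m. \<Sum>w\<in>I. c w * (move_rate \<theta> v / exit_rate \<theta> m * snd (apply_move \<pi> (m, \<psi> w) v) x))"
    unfolding mean_step_def
    by (intro sum.cong refl) (simp add: apply_move_sum[OF assms] sum_distrib_left mult_ac)
  also have "\<dots> = (\<Sum>w\<in>I. c w * mean_step \<theta> \<pi> m (\<psi> w) x)"
    unfolding mean_step_def sum_distrib_left by (rule sum.swap)
  finally show "mean_step \<theta> \<pi> m (\<lambda>x. \<Sum>w\<in>I. c w * \<psi> w x) x = (\<Sum>w\<in>I. c w * mean_step \<theta> \<pi> m (\<psi> w) x)" .
qed

lemma mean_state_sum: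
  assumes "0 < \<theta>" "\<pi> \<in> space (prob_algebra borel)" "finite I"
  shows "(\<And>w. w \<in> I \<Longrightarrow> bdd_meas m (C w) (\<psi> w)) \<Longrightarrow> n \<le> m \<Longrightarrow>
    mean_state \<theta> \<pi> n m (\<lambda>x. \<Sum>w\<in>I. c w * \<psi> w x) = (\<lambda>x. \<Sum>w\<in>I. c w * mean_state \<theta> \<pi> n m (\<psi> w) x)"
proof (induction n)
  case (Suc n)
  have bdd_meas: "bdd_meas (m - n) (C w) (mean_state \<theta> \<pi> n m (\<psi> w))" if "w \<in> I" for w
    using Suc.prems that by (intro bdd_meas_mean_state assms) auto
  have IH: "mean_state \<theta> \<pi> n m (\<lambda>x. \<Sum>w\<in>I. c w * \<psi> w x) = (\<lambda>x. \<Sum>w\<in>I. c w * mean_state \<theta> \<pi> n m (\<psi> w) x)"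
    using Suc by simp
  show ?case unfolding mean_state_Suc IH
    by (rule mean_step_sum[OF assms(2,3) bdd_meas])
qed simp

lemma set_move_pmf:
  assumes "0 < \<theta>" "1 \<le> m"
  shows "set_pmf (move_pmf \<theta> m) \<subseteq> moves m"
  using pmf_move_pmf[OF assms] by (auto simp: set_pmf_iff split: if_splits)

lemma dual_chain_Suc:
  "dual_chain \<theta> \<pi> (Suc n) s = bind_pmf (move_pmf \<theta> (fst s)) (\<lambda>v. map_pmf ((#) s) (dual_chain \<theta> \<pi> n (apply_move \<pi> s v)))"
  by (simp add: bind_map_pmf)

lemma apply_move_pair: "apply_move \<pi> (m, \<psi>) v = (m - 1, snd (apply_move \<pi> (m, \<psi>) v))"
  by (cases v) simp_all

lemma dual_chain_support:
  assumes \<theta>: "0 < \<theta>"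
  shows "n \<le> m \<Longrightarrow> finite (set_pmf (dual_chain \<theta> \<pi> n (m, \<psi>))) \<and>
    (\<forall>l\<in>set_pmf (dual_chain \<theta> \<pi> n (m, \<psi>)). \<forall>i\<le>n. fst (l ! i) = m - i)"
proof (induction n arbitrary: m \<psi>)
  case (Suc n)
  then have m: "1 \<le> m" "n \<le> m - 1" by simp_all
  let ?s = "\<lambda>v. apply_move \<pi> (m, \<psi>) v"
  have IH: "finite (set_pmf (dual_chain \<theta> \<pi> n (?s v)))"
    "l \<in> set_pmf (dual_chain \<theta> \<pi> n (?s v)) \<Longrightarrow> i \<le> n \<Longrightarrow> fst (l ! i) = m - 1 - i" for v l i
    using Suc.IH[OF m(2), of "snd (?s v)"] unfolding apply_move_pair[of \<pi> m \<psi> v, symmetric] by blast+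
  have "finite (set_pmf (move_pmf \<theta> m))"
    using finite_subset[OF set_move_pmf[OF \<theta> m(1)] finite_moves] .
  with IH(1) have "finite (set_pmf (dual_chain \<theta> \<pi> (Suc n) (m, \<psi>)))"
    unfolding dual_chain_Suc by auto
  moreover have "fst (l ! i) = m - i" if "l \<in> set_pmf (dual_chain \<theta> \<pi> (Suc n) (m, \<psi>))" "i \<le> Suc n" for l i
    using that IH(2) unfolding dual_chain_Suc by (cases i) auto
  ultimately show ?case by blast
qed simp

text \<open>The transitions and the pairing are linear in \<open>\<psi>\<close>, so that the expectation can be taken after each jump.\<close>
lemma dual_chain_mean:
  assumes \<theta>: "0 < \<theta>" and \<pi>: "\<pi> \<in> space (prob_algebra borel)" and \<mu>: "\<mu> \<in> fin_measures"
  shows "n \<le> N \<Longrightarrow> N \<le> m \<Longrightarrow> bdd_meas m C \<psi> \<Longrightarrow>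
    measure_pmf.expectation (dual_chain \<theta> \<pi> N (m, \<psi>)) (\<lambda>l. pairing (m - n) (snd (l ! n)) \<mu>)
      = pairing (m - n) (mean_state \<theta> \<pi> n m \<psi>) \<mu>"
proof (induction N arbitrary: n m \<psi>)
  case (Suc N)
  show ?case
  proof (cases n)
    case 0
    have "l ! 0 = (m, \<psi>)" if "l \<in> set_pmf (dual_chain \<theta> \<pi> (Suc N) (m, \<psi>))" for l
      using that unfolding dual_chain_Suc by auto
    then have "measure_pmf.expectation (dual_chain \<theta> \<pi> (Suc N) (m, \<psi>)) (\<lambda>l. pairing (m - n) (snd (l ! n)) \<mu>)
       = measure_pmf.expectation (dual_chain \<theta> \<pi> (Suc N) (m, \<psi>)) (\<lambda>l. pairing m \<psi> \<mu>)"
      by (intro integral_cong_AE) (auto simp: AE_measure_pmf_iff 0 simp del: dual_chain.simps)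
    then show ?thesis by (simp add: 0 del: dual_chain.simps)
  next
    case (Suc n')
    have m: "1 \<le> m" "N \<le> m - 1" and n': "n' \<le> N" using Suc.prems Suc by auto
    let ?s = "\<lambda>v. apply_move \<pi> (m, \<psi>) v"
    let ?w = "\<lambda>v. move_rate \<theta> v / exit_rate \<theta> m"
    have b: "bdd_meas (m - 1) C (snd (?s v))" if "v \<in> moves m" for v
      by (rule bdd_meas_move[OF Suc.prems(3) that \<pi>])
    have fin: "finite (set_pmf (dual_chain \<theta> \<pi> N (?s v)))" for v
      using dual_chain_support[OF \<theta> m(2), of \<pi> "snd (?s v)"]
      unfolding apply_move_pair[of \<pi> m \<psi> v, symmetric] by blast
    have "measure_pmf.expectation (dual_chain \<theta> \<pi> (Suc N) (m, \<psi>)) (\<lambda>l. pairing (m - n) (snd (l ! n)) \<mu>)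
      = (\<Sum>v\<in>moves m. pmf (move_pmf \<theta> m) v * measure_pmf.expectation (dual_chain \<theta> \<pi> N (?s v))
          (\<lambda>l. pairing (m - 1 - n') (snd (l ! n')) \<mu>))"
      unfolding dual_chain_Suc fst_conv using m
      by (subst pmf_expectation_bind[OF finite_moves[of m] _ set_move_pmf[OF \<theta> m(1)]])
         (simp_all add: fin Suc)
    also have "\<dots> = (\<Sum>v\<in>moves m. ?w v * pairing (m - 1 - n') (mean_state \<theta> \<pi> n' (m - 1) (snd (?s v))) \<mu>)"
    proof (intro sum.cong refl)
      fix v assume v: "v \<in> moves m"
      show "pmf (move_pmf \<theta> m) v * measure_pmf.expectation (dual_chain \<theta> \<pi> N (?s v))
          (\<lambda>l. pairing (m - 1 - n') (snd (l ! n')) \<mu>) = ?w v * pairing (m - 1 - n') (mean_state \<theta> \<pi> n' (m - 1) (snd (?s v))) \<mu>"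
        using Suc.IH[OF n' m(2) b[OF v]] v
        unfolding apply_move_pair[of \<pi> m \<psi> v, symmetric] pmf_move_pmf[OF \<theta> m(1)] by simp
    qed
    also have "\<dots> = pairing (m - 1 - n') (\<lambda>x. \<Sum>v\<in>moves m. ?w v * mean_state \<theta> \<pi> n' (m - 1) (snd (?s v)) x) \<mu>"
      using n' m by (intro pairing_sum[OF \<mu> bdd_meas_mean_state[OF \<theta> \<pi> b], symmetric]) auto
    also have "(\<lambda>x. \<Sum>v\<in>moves m. ?w v * mean_state \<theta> \<pi> n' (m - 1) (snd (?s v)) x)
       = mean_state \<theta> \<pi> n' (m - 1) (mean_step \<theta> \<pi> m \<psi>)"
      unfolding mean_step_def using n' m b
      by (intro mean_state_sum[OF \<theta> \<pi> finite_moves, symmetric]) auto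
    finally show ?thesis by (simp add: Suc)
  qed
qed simp

section \<open>Occupation times of the dual process\<close>

definition exp_seq :: "(nat \<Rightarrow> real) measure" where
  "exp_seq = Pi\<^sub>M UNIV (\<lambda>_::nat. density lborel (\<lambda>x. ennreal (exponential_density 1 x)))"

definition hold_sum :: "real \<Rightarrow> nat \<Rightarrow> nat \<Rightarrow> (nat \<Rightarrow> real) \<Rightarrow> real" where
  "hold_sum \<theta> k n e = (\<Sum>i<n. e i / exit_rate \<theta> (k - i))"

text \<open>Along every path of the jump chain the \<open>i\<close>-th state has dimension \<open>k - i\<close>, so that the jump times are
  functions of the exponential variables alone. This is \<^const>\<open>dual_jumps\<close> with the path eliminated.\<close>
definition jump_count :: "real \<Rightarrow> nat \<Rightarrow> real \<Rightarrow> (nat \<Rightarrow> real) \<Rightarrow> nat" where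
  "jump_count \<theta> k t e = card {n. n < k \<and> hold_sum \<theta> k (Suc n) e \<le> t}"

lemma prob_space_exp_seq: "prob_space exp_seq"
  unfolding exp_seq_def by (intro prob_space_PiM prob_space_exponential_density) simp

lemma sets_exp_seq: "sets exp_seq = sets (Pi\<^sub>M UNIV (\<lambda>_. borel))"
  unfolding exp_seq_def by (intro sets_PiM_cong) auto

lemma measurable_exp_seq: "(\<lambda>e. e i) \<in> borel_measurable exp_seq"
  by (simp add: measurable_cong_sets[OF sets_exp_seq refl])

lemma AE_exp_seq_nonneg: "AE e in exp_seq. \<forall>i. 0 \<le> e i"
proof -
  have "AE x in density lborel (\<lambda>x. ennreal (exponential_density 1 x)). 0 \<le> x"
    by (subst AE_density) (auto simp: exponential_density_def)
  then show ?thesis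
    unfolding AE_all_countable exp_seq_def
    by (intro allI AE_PiM_component prob_space_exponential_density) auto
qed

lemma nn_integral_exp_seq: "(\<integral>\<^sup>+e. ennreal (e i) \<partial>exp_seq) = 1"
proof -
  let ?D = "density lborel (\<lambda>x. ennreal (exponential_density 1 x))"
  have D: "distr exp_seq ?D (\<lambda>e. e i) = ?D"
    unfolding exp_seq_def by (rule distr_PiM_component) (auto intro: prob_space_exponential_density)
  have "(\<integral>\<^sup>+e. ennreal (e i) \<partial>exp_seq) = (\<integral>\<^sup>+x. ennreal x \<partial>distr exp_seq ?D (\<lambda>e. e i))"
    using measurable_exp_seq by (subst nn_integral_distr) (auto simp: measurable_cong_sets[OF refl sets_density])
  also have "\<dots> = (\<integral>\<^sup>+x. ennreal (exponential_density 1 x) * ennreal x \<partial>lborel)"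
    unfolding D by (subst nn_integral_density) auto
  also have "\<dots> = (\<integral>\<^sup>+x. ennreal (erlang_density 0 1 x * x ^ 1) \<partial>lborel)"
    by (intro nn_integral_cong) (auto simp: ennreal_mult'[symmetric] exponential_density_nonneg)
  also have "\<dots> = 1"
    by (subst nn_integral_erlang_ith_moment) auto
  finally show ?thesis .
qed

lemma jump_count_eq:
  assumes e: "\<And>i. 0 \<le> e i" and \<theta>: "0 < \<theta>" and n: "n < k" and t: "0 \<le> t"
  shows "jump_count \<theta> k t e = n \<longleftrightarrow> hold_sum \<theta> k n e \<le> t \<and> t < hold_sum \<theta> k (Suc n) e"
proof -
  have "0 \<le> exit_rate \<theta> j" for j
    using exit_rate_pos[OF \<theta>, of j] by (cases j) (auto simp: exit_rate_eq)
  note nonneg = divide_nonneg_nonneg[OF e this]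
  have mono: "hold_sum \<theta> k i e \<le> hold_sum \<theta> k j e" if "i \<le> j" "j \<le> k" for i j
    unfolding hold_sum_def using that nonneg by (intro sum_mono2) auto
  let ?D = "{n. n < k \<and> hold_sum \<theta> k (Suc n) e \<le> t}"
  show ?thesis
  proof
    assume *: "hold_sum \<theta> k n e \<le> t \<and> t < hold_sum \<theta> k (Suc n) e"
    have "?D = {..<n}"
    proof (intro set_eqI iffI)
      fix i assume "i \<in> ?D"
      then show "i \<in> {..<n}" using * mono[of "Suc n" "Suc i"] by (cases "i < n") auto
    next
      fix i assume "i \<in> {..<n}"
      then show "i \<in> ?D" using * n mono[of "Suc i" n] by auto
    qed
    then show "jump_count \<theta> k t e = n" by (simp add: jump_count_def)
  next
    assume c: "jump_count \<theta> k t e = n"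
    have fin: "finite ?D" by auto
    have 1: "t < hold_sum \<theta> k (Suc n) e"
    proof (rule ccontr)
      assume "\<not> ?thesis"
      then have "{..n} \<subseteq> ?D" using n mono[of _ "Suc n"] by fastforce
      from card_mono[OF fin this] c show False by (simp add: jump_count_def)
    qed
    have "?D \<subseteq> {..<n}"
    proof
      fix i assume "i \<in> ?D"
      then show "i \<in> {..<n}" using 1 mono[of "Suc n" "Suc i"] by (cases "i < n") auto
    qed
    then have "?D = {..<n}" using c by (intro card_subset_eq) (auto simp: jump_count_def)
    then have "hold_sum \<theta> k n e \<le> t"
      using t by (cases n) (auto simp: hold_sum_def)
    with 1 show "hold_sum \<theta> k n e \<le> t \<and> t < hold_sum \<theta> k (Suc n) e" by simp
  qed
qed

lemma measurable_count:
  fixes k :: nat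
  assumes "\<And>n. n < k \<Longrightarrow> f n \<in> borel_measurable M" "g \<in> borel_measurable M"
  shows "(\<lambda>x. card {n. n < k \<and> f n x \<le> (g x :: real)}) \<in> measurable M (count_space UNIV)"
proof -
  have "{x \<in> space M. n \<in> {n. n < k \<and> f n x \<le> g x}} \<in> sets M" for n
  proof (cases "n < k")
    case True
    then have [measurable]: "f n \<in> borel_measurable M" "g \<in> borel_measurable M" using assms by auto
    show ?thesis using True by simp
  qed simp
  note sets = this
  show ?thesis by (rule measurable_card[where S = "\<lambda>x. {n. n < k \<and> f n x \<le> g x}"]) (rule sets)
qed

lemma measurable_jump_count:
  assumes "g \<in> borel_measurable M" "\<And>i. (\<lambda>x. e x i) \<in> borel_measurable M"
  shows "(\<lambda>x. jump_count \<theta> k (g x) (e x)) \<in> measurable M (count_space UNIV)"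
  unfolding jump_count_def hold_sum_def
  by (intro measurable_count assms borel_measurable_sum borel_measurable_divide borel_measurable_const)

text \<open>By Tonelli's theorem, the integral is the mean length of the time interval between the \<open>n\<close>-th and the
  following jump, and that length is a standard exponential variable divided by the exit rate.\<close>
lemma occupation_time:
  assumes \<theta>: "0 < \<theta>" and n: "n < k"
  shows "has_bochner_integral lborel
     (\<lambda>t. indicator {0..} t * measure exp_seq {e \<in> space exp_seq. jump_count \<theta> k t e = n})
     (1 / exit_rate \<theta> (k - n))"
proof -
  interpret E: prob_space exp_seq by (rule prob_space_exp_seq)
  interpret pair_sigma_finite lborel exp_seq by unfold_locales
  let ?r = "exit_rate \<theta> (k - n)"
  let ?A = "\<lambda>t. {e \<in> space exp_seq. jump_count \<theta> k t e = n}"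
  have r: "0 < ?r" using n by (intro exit_rate_pos[OF \<theta>]) simp
  define f where "f t e = indicator {0..} t * (if jump_count \<theta> k t e = n then 1 else 0 :: ennreal)" for t :: real and e
  have [measurable]: "(\<lambda>p. jump_count \<theta> k (fst p) (snd p)) \<in> measurable (lborel \<Otimes>\<^sub>M exp_seq) (count_space UNIV)"
    by (intro measurable_jump_count measurable_compose[OF measurable_snd measurable_exp_seq]) simp
  have [measurable]: "(\<lambda>(t, e). f t e) \<in> borel_measurable (lborel \<Otimes>\<^sub>M exp_seq)"
    unfolding f_def case_prod_beta' by measurable
  have [measurable]: "(\<lambda>e. jump_count \<theta> k t e) \<in> measurable exp_seq (count_space UNIV)" for t
    by (intro measurable_jump_count measurable_exp_seq) simp
  have A: "?A t \<in> sets exp_seq" for t by measurable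
  have inner: "(\<integral>\<^sup>+e. f t e \<partial>exp_seq) = ennreal (indicator {0..} t * measure exp_seq (?A t))" for t
  proof -
    have "(\<integral>\<^sup>+e. f t e \<partial>exp_seq) = (\<integral>\<^sup>+e. indicator {0..} t * indicator (?A t) e \<partial>exp_seq)"
      by (intro nn_integral_cong) (auto simp: f_def)
    also have "\<dots> = indicator {0..} t * emeasure exp_seq (?A t)"
      using A by (simp add: nn_integral_cmult)
    finally show ?thesis by (simp add: E.emeasure_eq_measure indicator_def)
  qed
  have "(\<integral>\<^sup>+t. (\<integral>\<^sup>+e. f t e \<partial>exp_seq) \<partial>lborel) = (\<integral>\<^sup>+e. (\<integral>\<^sup>+t. f t e \<partial>lborel) \<partial>exp_seq)"
    by (rule Fubini'[symmetric]) measurable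
  also have "\<dots> = (\<integral>\<^sup>+e. ennreal (1 / ?r) * ennreal (e n) \<partial>exp_seq)"
  proof (rule nn_integral_cong_AE)
    show "AE e in exp_seq. (\<integral>\<^sup>+t. f t e \<partial>lborel) = ennreal (1 / ?r) * ennreal (e n)"
      using AE_exp_seq_nonneg
    proof eventually_elim
      case (elim e)
      let ?L = "hold_sum \<theta> k n e" and ?U = "hold_sum \<theta> k (Suc n) e"
      have L: "0 \<le> ?L" unfolding hold_sum_def using elim exit_rate_pos[OF \<theta>] n
        by (intro sum_nonneg divide_nonneg_pos) auto
      have U: "?U = ?L + e n / ?r" by (simp add: hold_sum_def)
      have "(\<integral>\<^sup>+t. f t e \<partial>lborel) = (\<integral>\<^sup>+t. indicator {?L..<?U} t \<partial>lborel)"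
      proof (intro nn_integral_cong)
        fix t :: real
        show "f t e = indicator {?L..<?U} t"
        proof (cases "0 \<le> t")
          case True
          then show ?thesis
            using jump_count_eq[of e \<theta> n k t] elim \<theta> n by (auto simp: f_def indicator_def)
        next
          case False
          then show ?thesis using L by (auto simp: f_def indicator_def)
        qed
      qed
      also have "\<dots> = ennreal (e n / ?r)"
        using elim r by (simp add: U)
      also have "\<dots> = ennreal (1 / ?r) * ennreal (e n)"
        using elim r by (simp add: ennreal_mult'[symmetric])
      finally show ?case .
    qed
  qed
  also have "\<dots> = ennreal (1 / ?r)"
    using measurable_exp_seq[of n] by (simp add: nn_integral_cmult nn_integral_exp_seq)
  finally have *: "(\<integral>\<^sup>+t. ennreal (indicator {0..} t * measure exp_seq (?A t)) \<partial>lborel) = ennreal (1 / ?r)"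
    unfolding inner .
  have "(\<lambda>t. \<integral>\<^sup>+e. f t e \<partial>exp_seq) \<in> borel_measurable lborel" by measurable
  then have "(\<lambda>t. enn2real (ennreal (indicator {0..} t * measure exp_seq (?A t)))) \<in> borel_measurable lborel"
    unfolding inner by measurable
  then have "(\<lambda>t. indicator {0..} t * measure exp_seq (?A t)) \<in> borel_measurable lborel" by simp
  then show ?thesis
    using r * by (intro has_bochner_integral_nn_integral) auto
qed

section \<open>The Stein solution as a polynomial functional\<close>

lemma integrable_product_functions:
  fixes u :: "'x \<Rightarrow> real" and v :: "'y \<Rightarrow> real"
  assumes "sigma_finite_measure M" "sigma_finite_measure N" "integrable M u" "integrable N v"
  shows "integrable (M \<Otimes>\<^sub>M N) (\<lambda>p. u (fst p) * v (snd p))"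
    "(\<integral>p. u (fst p) * v (snd p) \<partial>(M \<Otimes>\<^sub>M N)) = (\<integral>x. u x \<partial>M) * (\<integral>y. v y \<partial>N)"
proof -
  interpret pair_sigma_finite M N using assms by (simp add: pair_sigma_finite_def)
  note [measurable] = borel_measurable_integrable[OF assms(3)] borel_measurable_integrable[OF assms(4)]
  show int: "integrable (M \<Otimes>\<^sub>M N) (\<lambda>p. u (fst p) * v (snd p))"
    using assms(3,4) by (intro Fubini_integrable) (auto simp: abs_mult)
  then have "integrable (M \<Otimes>\<^sub>M N) (\<lambda>(x, y). u x * v y)" by (simp add: case_prod_beta')
  from integral_fst[OF this] show "(\<integral>p. u (fst p) * v (snd p) \<partial>(M \<Otimes>\<^sub>M N)) = (\<integral>x. u x \<partial>M) * (\<integral>y. v y \<partial>N)"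
    by (simp add: case_prod_beta')
qed

text \<open>The jump chain and the holding times are independent, so that the expectation factorises on each of the
  events of exactly \<open>n\<close> jumps.\<close>
lemma stein_integrand_integral:
  fixes \<mu> :: "'a::metric_space measure"
  assumes \<theta>: "0 < \<theta>" and \<pi>: "\<pi> \<in> space (prob_algebra borel)" and \<mu>: "\<mu> \<in> fin_measures"
    and \<phi>: "bdd_meas k C \<phi>"
  shows "integrable (dual_space \<theta> \<pi> k \<phi>) (stein_integrand \<theta> k c \<mu> t)"
    "(\<integral>\<omega>. stein_integrand \<theta> k c \<mu> t \<omega> \<partial>dual_space \<theta> \<pi> k \<phi>) =
      (\<Sum>n<k. (pairing (k - n) (mean_state \<theta> \<pi> n k \<phi>) \<mu> - c)
         * measure exp_seq {e \<in> space exp_seq. jump_count \<theta> k t e = n})"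
proof -
  interpret E: prob_space exp_seq by (rule prob_space_exp_seq)
  let ?p = "dual_chain \<theta> \<pi> k (k, \<phi>)"
  interpret pair_prob_space "measure_pmf ?p" exp_seq by unfold_locales
  let ?A = "\<lambda>n. {e \<in> space exp_seq. jump_count \<theta> k t e = n}"
  define G where "G n l = pairing (k - n) (snd (l ! n)) \<mu> - c" for n and l :: "'a dual_state list"
  define F where "F \<omega> = (\<Sum>n<k. G n (fst \<omega>) * indicator (?A n) (snd \<omega>))" for \<omega>
  have ds: "dual_space \<theta> \<pi> k \<phi> = measure_pmf ?p \<Otimes>\<^sub>M exp_seq" by (simp add: dual_space_def exp_seq_def)
  have supp: "finite (set_pmf ?p)" "\<And>l i. l \<in> set_pmf ?p \<Longrightarrow> i \<le> k \<Longrightarrow> fst (l ! i) = k - i"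
    using dual_chain_support[OF \<theta>, of k k \<pi> \<phi>] by auto
  have [measurable]: "(\<lambda>e. jump_count \<theta> k t e) \<in> measurable exp_seq (count_space UNIV)"
    by (intro measurable_jump_count measurable_exp_seq) simp
  have A: "?A n \<in> sets exp_seq" for n by measurable
  have G: "integrable (measure_pmf ?p) (G n)" for n by (rule integrable_measure_pmf_finite[OF supp(1)])
  have intA: "integrable exp_seq (indicator (?A n) :: _ \<Rightarrow> real)" for n
    by (rule integrable_real_indicator[OF A]) (simp add: E.emeasure_eq_measure)
  note prod = integrable_product_functions[OF measure_pmf.sigma_finite_measure_axioms E.sigma_finite_measure_axioms G intA]
  have F: "integrable (measure_pmf ?p \<Otimes>\<^sub>M exp_seq) F"
    unfolding F_def by (intro Bochner_Integration.integrable_sum prod(1))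
  have IF: "(\<integral>\<omega>. F \<omega> \<partial>(measure_pmf ?p \<Otimes>\<^sub>M exp_seq)) =
      (\<Sum>n<k. (pairing (k - n) (mean_state \<theta> \<pi> n k \<phi>) \<mu> - c) * measure exp_seq (?A n))"
  proof -
    have "(\<integral>\<omega>. F \<omega> \<partial>(measure_pmf ?p \<Otimes>\<^sub>M exp_seq)) = (\<Sum>n<k. (\<integral>l. G n l \<partial>measure_pmf ?p) * measure exp_seq (?A n))"
      unfolding F_def using A by (subst Bochner_Integration.integral_sum[OF prod(1)]) (simp add: prod(2))
    moreover have "(\<integral>l. G n l \<partial>measure_pmf ?p) = pairing (k - n) (mean_state \<theta> \<pi> n k \<phi>) \<mu> - c" if "n < k" for n
      unfolding G_def using that supp(1) dual_chain_mean[OF \<theta> \<pi> \<mu>, of n k k C \<phi>] \<phi>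
      by (subst Bochner_Integration.integral_diff) (auto intro: integrable_measure_pmf_finite)
    ultimately show ?thesis by simp
  qed
  have jt: "jump_time \<theta> n \<in> borel_measurable (measure_pmf ?p \<Otimes>\<^sub>M exp_seq)" for n
    unfolding jump_time_def
  proof (intro borel_measurable_sum borel_measurable_divide)
    show "(\<lambda>\<omega>. snd \<omega> i) \<in> borel_measurable (measure_pmf ?p \<Otimes>\<^sub>M exp_seq)" for i
      by (rule measurable_compose[OF measurable_snd measurable_exp_seq])
    show "(\<lambda>\<omega>. exit_rate \<theta> (fst (fst \<omega> ! i))) \<in> borel_measurable (measure_pmf ?p \<Otimes>\<^sub>M exp_seq)" for i
      by (rule measurable_compose[OF measurable_fst]) simp
  qed
  have dj [measurable]: "dual_jumps \<theta> k t \<in> measurable (measure_pmf ?p \<Otimes>\<^sub>M exp_seq) (count_space UNIV)"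
    unfolding dual_jumps_def by (intro measurable_count jt) simp
  have le: "dual_jumps \<theta> k t \<omega> \<le> k" for \<omega> :: "'a dual_state list \<times> (nat \<Rightarrow> real)"
    unfolding dual_jumps_def by (rule order_trans[OF card_mono[of "{..<k}"]]) auto
  have form: "stein_integrand \<theta> k c \<mu> t = (\<lambda>\<omega>. \<Sum>n<k. if dual_jumps \<theta> k t \<omega> = n
      then pairing (fst (fst \<omega> ! n)) (snd (fst \<omega> ! n)) \<mu> - c else 0)"
    by (auto simp: fun_eq_iff stein_integrand_def dual_process_def)
  have meas: "stein_integrand \<theta> k c \<mu> t \<in> borel_measurable (measure_pmf ?p \<Otimes>\<^sub>M exp_seq)"
    unfolding form
  proof (intro borel_measurable_sum measurable_If)
    show "(\<lambda>\<omega>. pairing (fst (fst \<omega> ! n)) (snd (fst \<omega> ! n)) \<mu> - c) \<in> borel_measurable (measure_pmf ?p \<Otimes>\<^sub>M exp_seq)" for n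
      by (rule measurable_compose[OF measurable_fst]) simp
    show "{\<omega> \<in> space (measure_pmf ?p \<Otimes>\<^sub>M exp_seq). dual_jumps \<theta> k t \<omega> = n} \<in> sets (measure_pmf ?p \<Otimes>\<^sub>M exp_seq)" for n
      by measurable
  qed simp
  have AE: "AE \<omega> in measure_pmf ?p \<Otimes>\<^sub>M exp_seq. stein_integrand \<theta> k c \<mu> t \<omega> = F \<omega>"
  proof (rule AE_pair_measure)
    show "{\<omega> \<in> space (measure_pmf ?p \<Otimes>\<^sub>M exp_seq). stein_integrand \<theta> k c \<mu> t \<omega> = F \<omega>} \<in> sets (measure_pmf ?p \<Otimes>\<^sub>M exp_seq)"
      using meas borel_measurable_integrable[OF F] by measurable
    have "stein_integrand \<theta> k c \<mu> t (l, e) = F (l, e)" if l: "l \<in> set_pmf ?p" and e: "e \<in> space exp_seq" for l e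
    proof -
      have "jump_time \<theta> n (l, e) = hold_sum \<theta> k (Suc n) e" if "n < k" for n
        unfolding jump_time_def hold_sum_def lessThan_Suc_atMost
        using supp(2)[OF l] that by (intro sum.cong) auto
      then have dj: "dual_jumps \<theta> k t (l, e) = jump_count \<theta> k t e"
        unfolding dual_jumps_def jump_count_def by (intro arg_cong[where f = card]) auto
      show ?thesis
        unfolding form F_def G_def dj using e supp(2)[OF l] by (intro sum.cong refl) auto
    qed
    then show "AE l in measure_pmf ?p. AE e in exp_seq. stein_integrand \<theta> k c \<mu> t (l, e) = F (l, e)"
      by (auto simp: AE_measure_pmf_iff)
  qed
  show "integrable (dual_space \<theta> \<pi> k \<phi>) (stein_integrand \<theta> k c \<mu> t)"
    unfolding ds using integrable_cong_AE[OF meas borel_measurable_integrable[OF F] AE] F by simp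
  show "(\<integral>\<omega>. stein_integrand \<theta> k c \<mu> t \<omega> \<partial>dual_space \<theta> \<pi> k \<phi>) =
      (\<Sum>n<k. (pairing (k - n) (mean_state \<theta> \<pi> n k \<phi>) \<mu> - c) * measure exp_seq (?A n))"
    unfolding ds IF[symmetric] by (rule integral_cong_AE[OF meas borel_measurable_integrable[OF F] AE])
qed

text \<open>Integration over time turns the probability of exactly \<open>n\<close> jumps into the mean holding time
  \<open>1 / \<lambda>\<^bsub>k-n\<^esub>\<close>.\<close>
lemma stein_solution_polynomial:
  fixes \<mu> :: "'a::metric_space measure"
  assumes \<theta>: "0 < \<theta>" and \<pi>: "\<pi> \<in> space (prob_algebra borel)" and \<mu>: "\<mu> \<in> fin_measures"
    and \<phi>: "bdd_meas k C \<phi>"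
  shows "set_integrable lborel {0..} (\<lambda>t. \<integral>\<omega>. stein_integrand \<theta> k c \<mu> t \<omega> \<partial>dual_space \<theta> \<pi> k \<phi>)"
    "stein_solution \<theta> \<pi> k \<phi> c \<mu> =
      - (\<Sum>n<k. (pairing (k - n) (mean_state \<theta> \<pi> n k \<phi>) \<mu> - c) / exit_rate \<theta> (k - n))"
proof -
  let ?a = "\<lambda>n. pairing (k - n) (mean_state \<theta> \<pi> n k \<phi>) \<mu> - c"
  let ?P = "\<lambda>n t. measure exp_seq {e \<in> space exp_seq. jump_count \<theta> k t e = n}"
  have eq: "indicator {0..} t *\<^sub>R (\<integral>\<omega>. stein_integrand \<theta> k c \<mu> t \<omega> \<partial>dual_space \<theta> \<pi> k \<phi>)
      = (\<Sum>n<k. ?a n * (indicator {0..} t * ?P n t))" for t :: real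
    unfolding stein_integrand_integral(2)[OF assms] by (simp add: sum_distrib_left mult_ac)
  have "has_bochner_integral lborel (\<lambda>t. \<Sum>n<k. ?a n * (indicator {0..} t * ?P n t))
      (\<Sum>n<k. ?a n * (1 / exit_rate \<theta> (k - n)))"
    by (intro has_bochner_integral_sum has_bochner_integral_mult_right occupation_time[OF \<theta>]) auto
  then have *: "has_bochner_integral lborel
     (\<lambda>t. indicator {0..} t *\<^sub>R (\<integral>\<omega>. stein_integrand \<theta> k c \<mu> t \<omega> \<partial>dual_space \<theta> \<pi> k \<phi>))
      (\<Sum>n<k. ?a n / exit_rate \<theta> (k - n))"
    unfolding eq by simp
  show "set_integrable lborel {0..} (\<lambda>t. \<integral>\<omega>. stein_integrand \<theta> k c \<mu> t \<omega> \<partial>dual_space \<theta> \<pi> k \<phi>)"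
    unfolding set_integrable_def using * by (simp add: has_bochner_integral_iff)
  show "stein_solution \<theta> \<pi> k \<phi> c \<mu> = - (\<Sum>n<k. ?a n / exit_rate \<theta> (k - n))"
    unfolding stein_solution_def set_lebesgue_integral_def
    using * by (simp add: has_bochner_integral_iff)
qed

section \<open>A linear relaxation equation\<close>

lemma set_integrable_exp_decay:
  assumes r: "0 < (r::real)"
  shows "set_integrable lborel {0..} (\<lambda>t. exp (- r * t))"
proof -
  interpret prob_space "density lborel (\<lambda>x. ennreal (exponential_density r x))"
    by (rule prob_space_exponential_density[OF r])
  have "(\<integral>\<^sup>+x. ennreal (exponential_density r x) \<partial>lborel) = ennreal 1"
    using emeasure_space_1 by (simp add: emeasure_density)
  then have "integrable lborel (exponential_density r)"
    using has_bochner_integral_nn_integral[of "exponential_density r" lborel 1] r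
    by (auto simp: exponential_density_nonneg has_bochner_integral_iff)
  then have "integrable lborel (\<lambda>t. exponential_density r t / r)" by simp
  then show ?thesis
    unfolding set_integrable_def
    by (rule Bochner_Integration.integrable_cong[THEN iffD1, rotated -1])
       (use r in \<open>auto simp: exponential_density_def indicator_def mult_ac\<close>)
qed

lemma LBINT_continuous:
  assumes "continuous_on {0..t::real} (f :: real \<Rightarrow> real)"
  shows "(LBINT s:{0..t}. f s) = integral {0..t} f"
  using set_borel_integral_eq_integral(2)[OF borel_integrable_atLeastAtMost'[OF assms]] .

lemma LBINT_point: "(LBINT s:{a..a::real}. (f s :: real)) = 0"
  unfolding set_lebesgue_integral_def
proof (rule integral_eq_zero_AE)
  show "AE s in lborel. indicator {a..a} s *\<^sub>R f s = 0"
    using AE_lborel_singleton[of a] by eventually_elim simp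
qed

text \<open>The integral equation says \<open>w' = l (v - w)\<close>. With \<open>M = l K / (l - r)\<close> the bound on \<open>v\<close> makes
  \<open>exp (l x) w x - M exp ((l - r) x)\<close> non-increasing.\<close>
lemma relaxation_upper_bound:
  fixes w v :: "real \<Rightarrow> real"
  assumes lam: "0 < r" "r < l" and w: "continuous_on {0..} w" and v: "continuous_on {0..} v"
    and eq: "\<And>t. 0 \<le> t \<Longrightarrow> w t = w 0 + l * (LBINT s:{0..t}. v s - w s)"
    and vK: "\<And>t. 0 \<le> t \<Longrightarrow> v t \<le> K * exp (- r * t)" and K: "0 \<le> K" and t: "0 \<le> t"
  shows "w t \<le> (\<bar>w 0\<bar> + l * K / (l - r)) * exp (- r * t)"
proof -
  define M where "M = l * K / (l - r)"
  have M: "M * (l - r) = l * K" using lam by (simp add: M_def)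
  define z where "z x = exp (l * x) * w x - M * exp ((l - r) * x)" for x
  have cont: "continuous_on {0..x} w" "continuous_on {0..x} v" for x
    using w v by (auto intro: continuous_on_subset)
  have der: "(w has_real_derivative l * (v x - w x)) (at x)" if x: "0 < x" for x
  proof -
    have "continuous_on {0..x+1} (\<lambda>s. v s - w s)" by (intro continuous_intros cont)
    from integral_has_real_derivative[OF this, of x]
    have "((\<lambda>u. integral {0..u} (\<lambda>s. v s - w s)) has_real_derivative v x - w x) (at x within {0..x+1})"
      using x by simp
    then have "((\<lambda>u. integral {0..u} (\<lambda>s. v s - w s)) has_real_derivative v x - w x) (at x)"
      using x by (simp add: at_within_Icc_at)
    then have D: "((\<lambda>u. w 0 + l * integral {0..u} (\<lambda>s. v s - w s)) has_real_derivative l * (v x - w x)) (at x)"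
      by (auto intro!: derivative_eq_intros)
    have "eventually (\<lambda>u. u \<in> {0<..}) (nhds x)"
      using x by (intro eventually_nhds_in_open) auto
    then have ev: "eventually (\<lambda>u. w 0 + l * integral {0..u} (\<lambda>s. v s - w s) = w u) (nhds x)"
    proof eventually_elim
      case (elim u)
      have "continuous_on {0..u} (\<lambda>s. v s - w s)" by (intro continuous_intros cont)
      from LBINT_continuous[OF this] show ?case using eq[of u] elim by simp
    qed
    show ?thesis using D unfolding DERIV_cong_ev[OF refl ev refl] .
  qed
  have "z t \<le> z 0"
  proof (rule DERIV_nonpos_imp_decreasing_open[OF t])
    show "continuous_on {0..t} z" unfolding z_def by (intro continuous_intros cont)
    fix x assume x: "0 < x" "x < t"
    let ?d = "l * exp (l * x) * v x - l * K * exp ((l - r) * x)"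
    have "(z has_real_derivative l * exp (l * x) * v x - M * (l - r) * exp ((l - r) * x)) (at x)"
      unfolding z_def by (auto intro!: derivative_eq_intros der[OF x(1)] simp: algebra_simps)
    then have "(z has_real_derivative ?d) (at x)" unfolding M .
    moreover have "?d \<le> 0"
    proof -
      have "l * exp (l * x) * v x \<le> l * exp (l * x) * (K * exp (- r * x))"
        using lam vK[of x] x by (intro mult_left_mono) auto
      also have "\<dots> = l * K * exp ((l - r) * x)" by (simp add: left_diff_distrib exp_diff exp_minus field_simps)
      finally show ?thesis by simp
    qed
    ultimately show "\<exists>y. (z has_real_derivative y) (at x) \<and> y \<le> 0" by blast
  qed
  then have "exp (l * t) * w t \<le> w 0 - M + M * exp ((l - r) * t)" by (simp add: z_def)
  also have "\<dots> \<le> \<bar>w 0\<bar> * exp ((l - r) * t) + M * exp ((l - r) * t)"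
  proof -
    have "0 \<le> M" using lam K by (simp add: M_def)
    moreover have "\<bar>w 0\<bar> * 1 \<le> \<bar>w 0\<bar> * exp ((l - r) * t)" using lam t by (intro mult_left_mono) auto
    ultimately show ?thesis by simp
  qed
  finally have "exp (l * t) * w t \<le> exp (l * t) * ((\<bar>w 0\<bar> + M) * exp (- r * t))"
    by (simp add: left_diff_distrib exp_diff exp_minus field_simps)
  then show ?thesis unfolding M_def by simp
qed

text \<open>Once \<open>w\<close> is known to decay, letting \<open>t \<rightarrow> \<infinity>\<close> in the integral equation gives the value of its integral.\<close>
lemma relaxation:
  fixes w v :: "real \<Rightarrow> real"
  assumes lam: "0 < r" "r < l" and w: "continuous_on {0..} w" and v: "continuous_on {0..} v"
    and eq: "\<And>t. 0 \<le> t \<Longrightarrow> w t = w 0 + l * (LBINT s:{0..t}. v s - w s)"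
    and vK: "\<And>t. 0 \<le> t \<Longrightarrow> \<bar>v t\<bar> \<le> K * exp (- r * t)" and vint: "set_integrable lborel {0..} v"
  shows "\<exists>K. \<forall>t\<ge>0. \<bar>w t\<bar> \<le> K * exp (- r * t)" "set_integrable lborel {0..} w"
    "(LBINT t:{0..}. w t) = (LBINT t:{0..}. v t) + w 0 / l"
proof -
  have K: "0 \<le> K" using vK[of 0] by simp
  define L where "L = \<bar>w 0\<bar> + l * K / (l - r)"
  have L: "\<bar>w t\<bar> \<le> L * exp (- r * t)" if t: "0 \<le> t" for t
  proof -
    have vb: "v t \<le> K * exp (- r * t)" "- v t \<le> K * exp (- r * t)" if "0 \<le> t" for t
      using vK[OF that] by linarith+
    have "w t \<le> L * exp (- r * t)"
      unfolding L_def by (rule relaxation_upper_bound[OF lam w v eq vb(1) K t])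
    moreover have "- w t \<le> (\<bar>- w 0\<bar> + l * K / (l - r)) * exp (- r * t)"
    proof (rule relaxation_upper_bound[OF lam _ _ _ vb(2) K t])
      show "continuous_on {0..} (\<lambda>t. - w t)" "continuous_on {0..} (\<lambda>t. - v t)"
        using w v by (auto intro: continuous_intros)
      show "- w t = - w 0 + l * (LBINT s:{0..t}. - v s - - w s)" if "0 \<le> t" for t
      proof -
        have "(LBINT s:{0..t}. - v s - - w s) = (LBINT s:{0..t}. - (v s - w s))" by simp
        also have "\<dots> = - (LBINT s:{0..t}. v s - w s)" by (rule set_integral_uminus) 
           (intro borel_integrable_atLeastAtMost' continuous_intros continuous_on_subset[OF w] continuous_on_subset[OF v], auto)
        finally show ?thesis using eq[OF that] by simp
      qed
    qed
    ultimately show ?thesis unfolding L_def by simp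
  qed
  then show "\<exists>K. \<forall>t\<ge>0. \<bar>w t\<bar> \<le> K * exp (- r * t)" by blast
  show wint: "set_integrable lborel {0..} w"
    unfolding set_integrable_def
  proof (rule Bochner_Integration.integrable_bound)
    show "integrable lborel (\<lambda>t. L * (indicator {0..} t *\<^sub>R exp (- r * t)))"
      using set_integrable_exp_decay[OF lam(1)] unfolding set_integrable_def by (rule integrable_mult_right)
    show "(\<lambda>t. indicator {0..} t *\<^sub>R w t) \<in> borel_measurable lborel"
      using borel_measurable_continuous_on_indicator[OF _ w] by simp
    show "AE t in lborel. norm (indicator {0..} t *\<^sub>R w t) \<le> norm (L * (indicator {0..} t *\<^sub>R exp (- r * t)))"
      using order_trans[OF L abs_ge_self] by (intro AE_I2) (auto simp: indicator_def)
  qed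
  have "set_integrable lborel {0..} (\<lambda>s. v s - w s)" using vint wint by simp
  then have "((\<lambda>t. LBINT s:{0..t}. v s - w s) \<longlongrightarrow> (LBINT s:{0..}. v s - w s)) at_top"
    by (intro tendsto_set_lebesgue_integral_at_top) auto
  then have "((\<lambda>t. w 0 + l * (LBINT s:{0..t}. v s - w s)) \<longlongrightarrow> w 0 + l * (LBINT s:{0..}. v s - w s)) at_top"
    by (intro tendsto_intros)
  moreover have "eventually (\<lambda>t::real. w 0 + l * (LBINT s:{0..t}. v s - w s) = w t) at_top"
    using eventually_ge_at_top[of 0] by eventually_elim (metis eq)
  ultimately have "(w \<longlongrightarrow> w 0 + l * (LBINT s:{0..}. v s - w s)) at_top"
    by (rule Lim_transform_eventually)
  moreover have "(w \<longlongrightarrow> 0) at_top"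
  proof (rule Lim_null_comparison)
    show "\<forall>\<^sub>F t in at_top. norm (w t) \<le> L * exp (- r * t)"
      using eventually_ge_at_top[of 0] by eventually_elim (use L in simp)
    have "filterlim (\<lambda>t. - r * t) at_bot at_top"
      using lam(1) by (intro filterlim_tendsto_neg_mult_at_bot[OF tendsto_const]) (auto simp: filterlim_ident)
    then have "((\<lambda>t. exp (- r * t)) \<longlongrightarrow> 0) at_top"
      by (rule filterlim_compose[OF exp_at_bot])
    then show "((\<lambda>t. L * exp (- r * t)) \<longlongrightarrow> 0) at_top" by (rule tendsto_mult_right_zero)
  qed
  ultimately have "w 0 + l * (LBINT s:{0..}. v s - w s) = 0"
    by (rule tendsto_unique[OF trivial_limit_at_top_linorder])
  moreover have "(LBINT s:{0..}. v s - w s) = (LBINT s:{0..}. v s) - (LBINT s:{0..}. w s)"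
    using vint wint by (rule set_integral_diff(2))
  ultimately show "(LBINT t:{0..}. w t) = (LBINT t:{0..}. v t) + w 0 / l"
    using lam by (simp add: field_simps)
qed

section \<open>Moments of the Fleming--Viot process\<close>

text \<open>Sampling the paths on the grid of mesh \<open>1 / (n + 1)\<close> gives jointly measurable functions, which converge
  by continuity.\<close>
lemma measurable_continuous_paths:
  fixes K :: "real \<Rightarrow> 'w \<Rightarrow> real"
  assumes meas: "\<And>t. 0 \<le> t \<Longrightarrow> K t \<in> borel_measurable N"
    and cont: "\<And>\<omega>. \<omega> \<in> space N \<Longrightarrow> continuous_on {0..} (\<lambda>t. K t \<omega>)"
  shows "(\<lambda>(t, \<omega>). indicator {0..} t * K t \<omega>) \<in> borel_measurable (lborel \<Otimes>\<^sub>M N)"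
proof -
  define d where "d n t = real (nat \<lfloor>real (Suc n) * t\<rfloor>) / real (Suc n)" for n t
  have d: "(\<lambda>n. d n t) \<longlonglongrightarrow> t" if t: "0 \<le> t" for t
  proof -
    have "(\<lambda>n. d n t - t) \<longlonglongrightarrow> 0"
    proof (rule Lim_null_comparison)
      show "\<forall>\<^sub>F n in sequentially. norm (d n t - t) \<le> 1 / real (Suc n)"
      proof (intro always_eventually allI)
        fix n
        have "0 \<le> real (Suc n) * t" using t by simp
        then have "\<bar>real (nat \<lfloor>real (Suc n) * t\<rfloor>) - real (Suc n) * t\<bar> \<le> 1"
          by (simp add: of_nat_nat) linarith
        moreover have "d n t - t = (real (nat \<lfloor>real (Suc n) * t\<rfloor>) - real (Suc n) * t) / real (Suc n)"
          by (simp add: d_def field_simps)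
        ultimately show "norm (d n t - t) \<le> 1 / real (Suc n)"
          by (simp add: abs_divide divide_right_mono)
      qed
      show "(\<lambda>n. 1 / real (Suc n)) \<longlonglongrightarrow> 0" using LIMSEQ_inverse_real_of_nat by (simp add: inverse_eq_divide)
    qed
    then show ?thesis by (simp add: LIM_zero_iff)
  qed
  have "(\<lambda>p. indicator {0..} (fst p) * K (fst p) (snd p)) \<in> borel_measurable (lborel \<Otimes>\<^sub>M N)"
  proof (rule borel_measurable_LIMSEQ_real)
    show "(\<lambda>p. indicator {0..} (fst p) * K (d n (fst p)) (snd p)) \<in> borel_measurable (lborel \<Otimes>\<^sub>M N)" for n
    proof (intro borel_measurable_times)
      show "(\<lambda>p::real \<times> 'w. indicator {0..} (fst p) :: real) \<in> borel_measurable (lborel \<Otimes>\<^sub>M N)"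
        by (rule measurable_compose[OF measurable_fst]) (auto intro: borel_measurable_indicator)
      have "(\<lambda>p. nat \<lfloor>real (Suc n) * fst p\<rfloor>) \<in> measurable (lborel \<Otimes>\<^sub>M N) (count_space UNIV)"
        by measurable
      moreover have "(\<lambda>p. K (real i / real (Suc n)) (snd p)) \<in> borel_measurable (lborel \<Otimes>\<^sub>M N)" for i :: nat
        by (rule measurable_compose[OF measurable_snd meas]) simp
      ultimately show "(\<lambda>p. K (d n (fst p)) (snd p)) \<in> borel_measurable (lborel \<Otimes>\<^sub>M N)"
        unfolding d_def by (rule measurable_compose_countable[rotated])
    qed
    fix p :: "real \<times> 'w" assume p: "p \<in> space (lborel \<Otimes>\<^sub>M N)"
    show "(\<lambda>n. indicator {0..} (fst p) * K (d n (fst p)) (snd p)) \<longlonglongrightarrow> indicator {0..} (fst p) * K (fst p) (snd p)"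
    proof (cases "0 \<le> fst p")
      case True
      have "snd p \<in> space N" using p by (auto simp: space_pair_measure)
      from continuous_on_tendsto_compose[OF cont[OF this] d[OF True]] True
      show ?thesis by (simp add: d_def)
    qed simp
  qed
  then show ?thesis by (simp add: case_prod_beta')
qed

lemma fv_M1:
  assumes "fleming_viot_process \<theta> \<pi> \<mu> N Z" "\<omega> \<in> space N" "0 \<le> t"
  shows "Z t \<omega> \<in> space (prob_algebra borel)"
  using assms measurable_space[of "Z t" N "prob_algebra borel" \<omega>] by (simp add: fleming_viot_process_def)

lemma fv_pairing:
  fixes \<psi> :: "(nat \<Rightarrow> 'a::metric_space) \<Rightarrow> real"
  assumes E: "compact (UNIV :: 'a set)" and fv: "fleming_viot_process \<theta> \<pi> \<mu> N Z" and \<psi>: "cont_fun m \<psi>"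
    and C: "bdd_meas m C \<psi>"
  shows "0 \<le> t \<Longrightarrow> (\<lambda>\<omega>. pairing m \<psi> (Z t \<omega>)) \<in> borel_measurable N"
    "\<omega> \<in> space N \<Longrightarrow> continuous_on {0..} (\<lambda>t. pairing m \<psi> (Z t \<omega>))"
    "\<omega> \<in> space N \<Longrightarrow> 0 \<le> t \<Longrightarrow> \<bar>pairing m \<psi> (Z t \<omega>)\<bar> \<le> C"
    "0 \<le> t \<Longrightarrow> integrable N (\<lambda>\<omega>. pairing m \<psi> (Z t \<omega>))"
    "continuous_on {0..} (\<lambda>t. \<integral>\<omega>. pairing m \<psi> (Z t \<omega>) \<partial>N)"
proof -
  interpret prob_space N using fv by (simp add: fleming_viot_process_def)
  have meas: "(\<lambda>\<omega>. pairing m \<psi> (Z t \<omega>)) \<in> borel_measurable N" if "0 \<le> t" for t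
    using fv that measurable_compose[OF _ measurable_pairing[OF E \<psi>], of "Z t" N]
    by (simp add: fleming_viot_process_def)
  have cont: "continuous_on {0..} (\<lambda>t. pairing m \<psi> (Z t \<omega>))" if "\<omega> \<in> space N" for \<omega>
  proof (rule continuous_on_pairing_path[OF E \<psi>])
    show "Z t \<omega> \<in> space (prob_algebra borel)" if "t \<in> {0..}" for t
      using fv_M1[OF fv \<open>\<omega> \<in> space N\<close>] that by simp
    show "continuous_on {0..} (\<lambda>t. \<integral>x. g x \<partial>Z t \<omega>)" if "continuous_on UNIV g" for g :: "'a \<Rightarrow> real"
      using fv \<open>\<omega> \<in> space N\<close> that by (simp add: fleming_viot_process_def)
  qed
  have bd: "\<bar>pairing m \<psi> (Z t \<omega>)\<bar> \<le> C" if "\<omega> \<in> space N" "0 \<le> t" for t \<omega>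
    using pairing_bound[OF M1_fin[OF fv_M1[OF fv that]] bdd_meas_le[OF C]] by (simp add: M1_measure[OF fv_M1[OF fv that]])
  show "0 \<le> t \<Longrightarrow> (\<lambda>\<omega>. pairing m \<psi> (Z t \<omega>)) \<in> borel_measurable N"
    "\<omega> \<in> space N \<Longrightarrow> continuous_on {0..} (\<lambda>t. pairing m \<psi> (Z t \<omega>))"
    "\<omega> \<in> space N \<Longrightarrow> 0 \<le> t \<Longrightarrow> \<bar>pairing m \<psi> (Z t \<omega>)\<bar> \<le> C" using meas cont bd by auto
  show "integrable N (\<lambda>\<omega>. pairing m \<psi> (Z t \<omega>))" if "0 \<le> t"
    using meas[OF that] bd that by (intro integrable_const_bound[of _ C]) auto
  show "continuous_on {0..} (\<lambda>t. \<integral>\<omega>. pairing m \<psi> (Z t \<omega>) \<partial>N)"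
  proof (rule continuous_on_sequentiallyI)
    fix u :: "nat \<Rightarrow> real" and a assume u: "\<forall>n. u n \<in> {0..}" "a \<in> {0..}" "u \<longlonglongrightarrow> a"
    show "(\<lambda>n. \<integral>\<omega>. pairing m \<psi> (Z (u n) \<omega>) \<partial>N) \<longlonglongrightarrow> (\<integral>\<omega>. pairing m \<psi> (Z a \<omega>) \<partial>N)"
    proof (rule integral_dominated_convergence[where w = "\<lambda>_. C"])
      show "AE \<omega> in N. (\<lambda>n. pairing m \<psi> (Z (u n) \<omega>)) \<longlonglongrightarrow> pairing m \<psi> (Z a \<omega>)"
        using u by (intro AE_I2 continuous_on_tendsto_compose[OF cont u(3)]) auto
    qed (use meas bd u in auto)
  qed
qed

text \<open>The expectation of the martingale does not change with time; its drift is given by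
  \<open>fv_gen_polynomial\<close>.\<close>
lemma fv_moment_equation:
  fixes \<psi> :: "(nat \<Rightarrow> 'a::metric_space) \<Rightarrow> real" and N :: "'w measure"
  assumes E: "compact (UNIV :: 'a set)" and \<theta>: "0 < \<theta>" and \<pi>: "\<pi> \<in> space (prob_algebra borel)"
    and fv: "fleming_viot_process \<theta> \<pi> \<mu> N Z" and \<psi>: "cont_fun m \<psi>" and m: "1 \<le> m" and t: "0 \<le> t"
  shows "(\<integral>\<omega>. pairing m \<psi> (Z t \<omega>) \<partial>N) = pairing m \<psi> \<mu> + exit_rate \<theta> m *
    (LBINT s:{0..t}. (\<integral>\<omega>. pairing (m - 1) (mean_step \<theta> \<pi> m \<psi>) (Z s \<omega>) \<partial>N) - (\<integral>\<omega>. pairing m \<psi> (Z s \<omega>) \<partial>N))"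
proof -
  interpret prob_space N using fv by (simp add: fleming_viot_process_def)
  obtain C where C: "bdd_meas m C \<psi>" using cont_fun_ucont(2)[OF E \<psi>] bdd_meas_cont_fun[OF E \<psi>] by blast
  note \<psi>' = cont_fun_mean_step[OF E \<psi> \<pi>] and C' = bdd_meas_mean_step[OF C \<pi> \<theta> m]
  note P = fv_pairing[OF E fv \<psi> C] and P' = fv_pairing[OF E fv \<psi>' C']
  let ?A = "\<lambda>s \<omega>. exit_rate \<theta> m * (pairing (m - 1) (mean_step \<theta> \<pi> m \<psi>) (Z s \<omega>) - pairing m \<psi> (Z s \<omega>))"
  have gen: "fv_gen \<theta> \<pi> (pairing m \<psi>) \<nu> = exit_rate \<theta> m * (pairing (m - 1) (mean_step \<theta> \<pi> m \<psi>) \<nu> - pairing m \<psi> \<nu>)"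
    if "\<nu> \<in> space (prob_algebra borel)" for \<nu>
    using fv_gen_polynomial(2)[of "{()}" "\<lambda>_. m" "\<lambda>_. C" "\<lambda>_. \<psi>" "pairing m \<psi>" 0 "\<lambda>_. 1" \<nu> \<pi> \<theta>] C that \<pi> \<theta> by simp
  have comp: "fv_compensated \<theta> \<pi> (pairing m \<psi>) Z u \<omega> = pairing m \<psi> (Z u \<omega>) - (LBINT s:{0..u}. ?A s \<omega>)"
    if "\<omega> \<in> space N" for u \<omega>
    unfolding fv_compensated_def
    using gen[OF fv_M1[OF fv that]] by (intro arg_cong2[of _ _ _ _ "(-)"] refl set_lebesgue_integral_cong) auto
  have int_comp: "integrable N (fv_compensated \<theta> \<pi> (pairing m \<psi>) Z u)" if "0 \<le> u" for u
    using fv \<psi> that by (simp add: fleming_viot_process_def)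
  have "(\<integral>\<omega>. fv_compensated \<theta> \<pi> (pairing m \<psi>) Z t \<omega> \<partial>N) = (\<integral>\<omega>. fv_compensated \<theta> \<pi> (pairing m \<psi>) Z 0 \<omega> \<partial>N)"
  proof -
    have "Z 0 \<in> N \<rightarrow>\<^sub>M prob_algebra borel" using fv by (simp add: fleming_viot_process_def)
    then have "subalgebra N (past N Z 0)"
      by (simp add: past_def subalgebra_def sets_image_in_sets)
    then interpret finite_measure_subalgebra N "past N Z 0" by unfold_locales
    have "AE \<omega> in N. real_cond_exp N (past N Z 0) (fv_compensated \<theta> \<pi> (pairing m \<psi>) Z t) \<omega>
       = fv_compensated \<theta> \<pi> (pairing m \<psi>) Z 0 \<omega>"
      using fv \<psi> t unfolding fleming_viot_process_def by blast
    then have "(\<integral>\<omega>. real_cond_exp N (past N Z 0) (fv_compensated \<theta> \<pi> (pairing m \<psi>) Z t) \<omega> \<partial>N)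
       = (\<integral>\<omega>. fv_compensated \<theta> \<pi> (pairing m \<psi>) Z 0 \<omega> \<partial>N)"
      using int_comp[of 0] by (intro integral_cong_AE) auto
    then show ?thesis using real_cond_exp_int(2)[OF int_comp[OF t]] by simp
  qed
  also have "\<dots> = (\<integral>\<omega>. pairing m \<psi> \<mu> \<partial>N)"
  proof (rule integral_cong_AE)
    have "AE \<omega> in N. Z 0 \<omega> = \<mu>" using fv by (simp add: fleming_viot_process_def)
    then show "AE \<omega> in N. fv_compensated \<theta> \<pi> (pairing m \<psi>) Z 0 \<omega> = pairing m \<psi> \<mu>"
    proof eventually_elim
      case (elim \<omega>)
      show ?case unfolding fv_compensated_def LBINT_point elim by simp
    qed
  qed (use int_comp[of 0] in auto)
  also have "\<dots> = pairing m \<psi> \<mu>" by (simp add: prob_space)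
  finally have mart: "(\<integral>\<omega>. fv_compensated \<theta> \<pi> (pairing m \<psi>) Z t \<omega> \<partial>N) = pairing m \<psi> \<mu>" .
  interpret pair_sigma_finite lborel N by unfold_locales
  let ?B = "\<bar>exit_rate \<theta> m\<bar> * (C + C)"
  have Abd: "\<bar>?A s \<omega>\<bar> \<le> ?B" if "\<omega> \<in> space N" "0 \<le> s" for s \<omega>
    using P(3)[OF that] P'(3)[OF that] unfolding abs_mult by (intro mult_left_mono) auto
  have meas: "(\<lambda>(s, \<omega>). indicator {0..t} s * ?A s \<omega>) \<in> borel_measurable (lborel \<Otimes>\<^sub>M N)"
  proof -
    have "(\<lambda>(s, \<omega>). indicator {0..} s * ?A s \<omega>) \<in> borel_measurable (lborel \<Otimes>\<^sub>M N)"
      using P(1,2) P'(1,2) by (intro measurable_continuous_paths) (auto intro!: continuous_intros)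
    then have "(\<lambda>p. indicator {0..t} (fst p) * (case p of (s, \<omega>) \<Rightarrow> indicator {0..} s * ?A s \<omega>)) \<in> borel_measurable (lborel \<Otimes>\<^sub>M N)"
      by (intro borel_measurable_times) (simp_all add: measurable_compose[OF measurable_fst])
    moreover have "(\<lambda>p. indicator {0..t} (fst p) * (case p of (s, \<omega>) \<Rightarrow> indicator {0..} s * ?A s \<omega>))
       = (\<lambda>(s, \<omega>). indicator {0..t} s * ?A s \<omega>)"
      by (auto simp: fun_eq_iff indicator_def)
    ultimately show ?thesis by simp
  qed
  have int: "integrable (lborel \<Otimes>\<^sub>M N) (\<lambda>(s, \<omega>). indicator {0..t} s * ?A s \<omega>)"
  proof (rule Bochner_Integration.integrable_bound[OF _ meas])
    have "integrable lborel (\<lambda>s. indicator {0..t} s * ?B)"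
      by (intro integrable_mult_left integrable_real_indicator) (auto simp: emeasure_lborel_Icc_eq)
    moreover have "integrable N (\<lambda>_. 1 :: real)" by simp
    ultimately show "integrable (lborel \<Otimes>\<^sub>M N) (\<lambda>p. indicator {0..t} (fst p) * ?B * 1)"
      by (rule integrable_product_functions(1)[where u = "\<lambda>s. indicator {0..t} s * ?B" and v = "\<lambda>_. 1", OF lborel.sigma_finite_measure_axioms prob_space_imp_sigma_finite[OF prob_space_axioms]])
    show "AE p in lborel \<Otimes>\<^sub>M N. norm (case p of (s, \<omega>) \<Rightarrow> indicator {0..t} s * ?A s \<omega>) \<le> norm (indicator {0..t} (fst p) * ?B * 1)"
    proof (rule AE_I2)
      fix p :: "real \<times> 'w" assume "p \<in> space (lborel \<Otimes>\<^sub>M N)"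
      then obtain s \<omega> where p: "p = (s, \<omega>)" "\<omega> \<in> space N" by (auto simp: space_pair_measure)
      show "norm (case p of (s, \<omega>) \<Rightarrow> indicator {0..t} s * ?A s \<omega>) \<le> norm (indicator {0..t} (fst p) * ?B * 1)"
      proof (cases "s \<in> {0..t}")
        case True
        then have "\<bar>?A s \<omega>\<bar> \<le> ?B" using Abd[OF p(2), of s] by simp
        then show ?thesis using True bdd_meas_nonneg[OF C] by (simp add: p(1) abs_mult)
      qed (simp add: p(1))
    qed
  qed
  have I: "integrable N (\<lambda>\<omega>. LBINT s:{0..t}. ?A s \<omega>)"
    unfolding set_lebesgue_integral_def using integrable_snd[OF int] by simp
  have "(\<integral>\<omega>. (LBINT s:{0..t}. ?A s \<omega>) \<partial>N) = (LBINT s:{0..t}. (\<integral>\<omega>. ?A s \<omega> \<partial>N))"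
    unfolding set_lebesgue_integral_def using Fubini_integral[OF int] by simp
  also have "\<dots> = (LBINT s:{0..t}. exit_rate \<theta> m *
    ((\<integral>\<omega>. pairing (m - 1) (mean_step \<theta> \<pi> m \<psi>) (Z s \<omega>) \<partial>N) - (\<integral>\<omega>. pairing m \<psi> (Z s \<omega>) \<partial>N)))"
    using P(4) P'(4) by (intro set_lebesgue_integral_cong) auto
  also have "\<dots> = exit_rate \<theta> m * (LBINT s:{0..t}.
    (\<integral>\<omega>. pairing (m - 1) (mean_step \<theta> \<pi> m \<psi>) (Z s \<omega>) \<partial>N) - (\<integral>\<omega>. pairing m \<psi> (Z s \<omega>) \<partial>N))"
    by (rule set_integral_mult_right)
  finally have Fub: "(\<integral>\<omega>. (LBINT s:{0..t}. ?A s \<omega>) \<partial>N) = \<dots>" .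
  have "(\<integral>\<omega>. fv_compensated \<theta> \<pi> (pairing m \<psi>) Z t \<omega> \<partial>N)
      = (\<integral>\<omega>. pairing m \<psi> (Z t \<omega>) - (LBINT s:{0..t}. ?A s \<omega>) \<partial>N)"
    by (intro Bochner_Integration.integral_cong refl comp)
  also have "\<dots> = (\<integral>\<omega>. pairing m \<psi> (Z t \<omega>) \<partial>N) - (\<integral>\<omega>. (LBINT s:{0..t}. ?A s \<omega>) \<partial>N)"
    using P(4)[OF t] I by (rule Bochner_Integration.integral_diff)
  finally show ?thesis unfolding mart Fub by simp
qed

text \<open>The moment equation in dimension \<open>m\<close> is the relaxation of the moment of \<open>\<psi>\<close> towards that of its mean
  step in dimension \<open>m - 1\<close>, so that each dimension adds one summand. The exponential decay is what the
  induction needs in order to apply \<open>relaxation\<close>.\<close>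
lemma fv_occupation:
  fixes \<psi> :: "(nat \<Rightarrow> 'a::metric_space) \<Rightarrow> real"
  assumes E: "compact (UNIV :: 'a set)" and \<theta>: "0 < \<theta>" and \<pi>: "\<pi> \<in> space (prob_algebra borel)"
    and fv: "fleming_viot_process \<theta> \<pi> \<mu> N Z"
  shows "cont_fun m \<psi> \<Longrightarrow> c = mean_state \<theta> \<pi> m m \<psi> (\<lambda>_. undefined) \<Longrightarrow>
    (\<exists>K. \<forall>t\<ge>0. \<bar>(\<integral>\<omega>. pairing m \<psi> (Z t \<omega>) \<partial>N) - c\<bar> \<le> K * exp (- (\<theta> / 4) * t)) \<and>
    set_integrable lborel {0..} (\<lambda>t. (\<integral>\<omega>. pairing m \<psi> (Z t \<omega>) \<partial>N) - c) \<and>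
    (LBINT t:{0..}. (\<integral>\<omega>. pairing m \<psi> (Z t \<omega>) \<partial>N) - c) =
      (\<Sum>n<m. (pairing (m - n) (mean_state \<theta> \<pi> n m \<psi>) \<mu> - c) / exit_rate \<theta> (m - n))"
proof (induction m arbitrary: \<psi>)
  case 0
  interpret prob_space N using fv by (simp add: fleming_viot_process_def)
  have "(\<integral>\<omega>. pairing 0 \<psi> (Z t \<omega>) \<partial>N) - c = 0" for t
    using 0 by (simp add: pairing_0 prob_space)
  then show ?case by (auto simp: set_integrable_def intro!: exI[of _ 0])
next
  case (Suc m)
  let ?\<psi> = "mean_step \<theta> \<pi> (Suc m) \<psi>"
  define w where "w t = (\<integral>\<omega>. pairing (Suc m) \<psi> (Z t \<omega>) \<partial>N) - c" for t
  define v where "v t = (\<integral>\<omega>. pairing m ?\<psi> (Z t \<omega>) \<partial>N) - c" for t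
  have c': "cont_fun m ?\<psi>" using cont_fun_mean_step[OF E Suc.prems(1) \<pi>] by simp
  have IH: "\<exists>K. \<forall>t\<ge>0. \<bar>v t\<bar> \<le> K * exp (- (\<theta> / 4) * t)" "set_integrable lborel {0..} v"
    "(LBINT t:{0..}. v t) = (\<Sum>n<m. (pairing (m - n) (mean_state \<theta> \<pi> n m ?\<psi>) \<mu> - c) / exit_rate \<theta> (m - n))"
    using Suc.IH[OF c'] Suc.prems(2) unfolding v_def[symmetric] by simp_all
  then obtain K where K: "\<And>t. 0 \<le> t \<Longrightarrow> \<bar>v t\<bar> \<le> K * exp (- (\<theta> / 4) * t)" by blast
  obtain C where C: "bdd_meas (Suc m) C \<psi>" using cont_fun_ucont(2)[OF E Suc.prems(1)] bdd_meas_cont_fun[OF E Suc.prems(1)] by blast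
  obtain C' where C': "bdd_meas m C' ?\<psi>" using cont_fun_ucont(2)[OF E c'] bdd_meas_cont_fun[OF E c'] by blast
  have cont: "continuous_on {0..} w" "continuous_on {0..} v"
    unfolding w_def v_def by (intro continuous_intros fv_pairing(5)[OF E fv Suc.prems(1) C] fv_pairing(5)[OF E fv c' C'])+
  have eq0: "w t = (pairing (Suc m) \<psi> \<mu> - c) + exit_rate \<theta> (Suc m) * (LBINT s:{0..t}. v s - w s)" if "0 \<le> t" for t
    using fv_moment_equation[OF E \<theta> \<pi> fv Suc.prems(1) _ that] by (simp add: w_def v_def)
  have w0: "w 0 = pairing (Suc m) \<psi> \<mu> - c"
    using eq0[of 0] LBINT_point[of 0 "\<lambda>s. v s - w s"] by simp
  have eq: "w t = w 0 + exit_rate \<theta> (Suc m) * (LBINT s:{0..t}. v s - w s)" if "0 \<le> t" for t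
    using eq0[OF that] w0 by simp
  \<comment> \<open>The smallest exit rate is \<open>\<theta> / 2\<close>, attained in dimension \<open>1\<close>; any common rate below it would do.\<close>
  have r: "0 < \<theta> / 4" "\<theta> / 4 < exit_rate \<theta> (Suc m)"
  proof -
    have "\<theta> \<le> (real m + 1) * (real m + \<theta>)" using \<theta> by (simp add: algebra_simps)
    moreover have "exit_rate \<theta> (Suc m) = (real m + 1) * (real m + \<theta>) / 2" by (simp add: exit_rate_eq algebra_simps)
    ultimately show "0 < \<theta> / 4" "\<theta> / 4 < exit_rate \<theta> (Suc m)" using \<theta> by linarith+
  qed
  have R: "\<exists>K. \<forall>t\<ge>0. \<bar>w t\<bar> \<le> K * exp (- (\<theta> / 4) * t)" "set_integrable lborel {0..} w"
    "(LBINT t:{0..}. w t) = (LBINT t:{0..}. v t) + w 0 / exit_rate \<theta> (Suc m)"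
    by (rule relaxation[OF r cont eq K IH(2)]; assumption)+
  have "(LBINT t:{0..}. w t) = (\<Sum>n<Suc m. (pairing (Suc m - n) (mean_state \<theta> \<pi> n (Suc m) \<psi>) \<mu> - c) / exit_rate \<theta> (Suc m - n))"
    unfolding R(3) IH(3) sum.lessThan_Suc_shift by (simp add: w0)
  with R(1,2) show ?case unfolding w_def[symmetric] by blast
qed

section \<open>From a distributional fixed point to a moment recursion\<close>

text \<open>The value of \<open>E V\<^sup>s (1 - V)\<^bsup>m-s\<^esup>\<close> for \<open>V\<close> with distribution \<open>Beta(1, \<theta>)\<close>; see \<open>beta_law_moment\<close>.\<close>
definition beta_moment :: "real \<Rightarrow> nat \<Rightarrow> nat \<Rightarrow> real" where
  "beta_moment \<theta> m s = \<theta> * fact s * Gamma (real m - real s + \<theta>) / Gamma (real m + 1 + \<theta>)"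

lemma Gamma_step: "0 < (x::real) \<Longrightarrow> Gamma (x + 1) = x * Gamma x"
  using Gamma_plus1[of x] nonpos_Ints_nonpos[of x] by fastforce

lemma beta_moment_0:
  assumes "0 < \<theta>" shows "beta_moment \<theta> m 0 = \<theta> / (real m + \<theta>)"
proof -
  have "Gamma (real m + 1 + \<theta>) = (real m + \<theta>) * Gamma (real m + \<theta>)"
    using Gamma_step[of "real m + \<theta>"] assms by (simp add: add_ac)
  moreover have "Gamma (real m + \<theta>) \<noteq> 0" using Gamma_real_pos[of "real m + \<theta>"] assms by linarith
  ultimately show ?thesis by (simp add: beta_moment_def)
qed

text \<open>The comparison of coefficients behind \<open>moment_recursion\<close>: on the left, the first term counts the
  coalescences inside a set of \<open>s\<close> factors and the second all moves outside of it.\<close>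
lemma beta_moment_balance:
  assumes \<theta>: "0 < \<theta>" and s: "1 \<le> s" "s \<le> m"
  shows "real s * (real s - 1) / 2 * beta_moment \<theta> (m - 1) (s - 1) + beta_moment \<theta> (m - 1) s * exit_rate \<theta> (m - s)
     = beta_moment \<theta> m s * ((real m + \<theta>) * (real m - 1) / 2)"
proof -
  define G where "G = Gamma (real m + \<theta>)"
  have G: "G \<noteq> 0" using Gamma_real_pos[of "real m + \<theta>"] \<theta> unfolding G_def by linarith
  have m1: "Gamma (real m + 1 + \<theta>) = (real m + \<theta>) * G"
    using Gamma_step[of "real m + \<theta>"] \<theta> by (simp add: add_ac G_def)
  have mt: "real m + \<theta> \<noteq> 0" using \<theta> by simp
  define H where "H = Gamma (real m - real s + \<theta>)"
  have f: "fact s = real s * fact (s - 1)" using s by (simp add: fact_reduce)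
  have b1: "beta_moment \<theta> (m - 1) (s - 1) = \<theta> * fact (s - 1) * H / G"
    using s by (simp add: beta_moment_def H_def G_def of_nat_diff add_ac)
  have b2: "beta_moment \<theta> (m - 1) s * exit_rate \<theta> (m - s) = \<theta> * fact s * H / G * ((real m - real s) / 2)"
  proof (cases "s = m")
    case True
    then show ?thesis by (simp add: exit_rate_eq)
  next
    case False
    then have sm: "s < m" using s by simp
    have pos: "0 < real m - 1 - real s + \<theta>" using sm \<theta> by linarith
    have H: "H = (real m - 1 - real s + \<theta>) * Gamma (real m - 1 - real s + \<theta>)"
      using Gamma_step[OF pos] by (simp add: H_def algebra_simps)
    have b: "beta_moment \<theta> (m - 1) s = \<theta> * fact s * Gamma (real m - 1 - real s + \<theta>) / G"
      using s by (simp add: beta_moment_def G_def of_nat_diff)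
    have e: "exit_rate \<theta> (m - s) = (real m - 1 - real s + \<theta>) * ((real m - real s) / 2)"
      using sm by (simp add: exit_rate_eq of_nat_diff algebra_simps)
    show ?thesis unfolding b e unfolding H by simp
  qed
  have b3: "beta_moment \<theta> m s = \<theta> * fact s * H / ((real m + \<theta>) * G)"
    by (simp add: beta_moment_def H_def m1)
  define Q where "Q = \<theta> * fact (s - 1) * H / G"
  have b2': "\<theta> * fact s * H / G * ((real m - real s) / 2) = real s * Q * ((real m - real s) / 2)"
    by (simp add: Q_def f)
  have b3': "\<theta> * fact s * H / ((real m + \<theta>) * G) * ((real m + \<theta>) * (real m - 1) / 2) = real s * Q * ((real m - 1) / 2)"
    using mt by (simp add: Q_def f)
  show ?thesis
    unfolding b2 b2' b1 Q_def[symmetric] b3 b3' by (simp add: field_simps)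
qed

lemma sum_Pow_remove:
  assumes "finite I"
  shows "(\<Sum>j\<in>I. \<Sum>T\<in>Pow (I - {j}). f j T) = (\<Sum>T\<in>Pow I. \<Sum>j\<in>I - T. (f j T :: real))"
proof -
  have "(\<Sum>j\<in>I. \<Sum>T\<in>Pow (I - {j}). f j T) = (\<Sum>j\<in>I. \<Sum>T\<in>{T. T \<in> Pow I \<and> j \<notin> T}. f j T)"
    by (intro sum.cong) auto
  also have "\<dots> = (\<Sum>T\<in>Pow I. \<Sum>j\<in>{j. j \<in> I \<and> j \<notin> T}. f j T)"
    using assms by (intro sum.swap_restrict) auto
  also have "\<dots> = (\<Sum>T\<in>Pow I. \<Sum>j\<in>I - T. f j T)" by (intro sum.cong) auto
  finally show ?thesis .
qed

lemma sum_Pow_insert: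
  assumes "finite I"
  shows "(\<Sum>j\<in>I. \<Sum>T\<in>Pow (I - {j}). f (insert j T)) = (\<Sum>S\<in>Pow I. real (card S) * (f S :: real))"
proof -
  have "(\<Sum>T\<in>Pow (I - {j}). f (insert j T)) = (\<Sum>S\<in>{S. S \<in> Pow I \<and> j \<in> S}. f S)" if "j \<in> I" for j
    by (rule sum.reindex_bij_witness[of _ "\<lambda>S. S - {j}" "insert j"]) (use that in auto)
  then have "(\<Sum>j\<in>I. \<Sum>T\<in>Pow (I - {j}). f (insert j T)) = (\<Sum>j\<in>I. \<Sum>S\<in>{S. S \<in> Pow I \<and> j \<in> S}. f S)"
    by simp
  also have "\<dots> = (\<Sum>S\<in>Pow I. \<Sum>j\<in>{j. j \<in> I \<and> j \<in> S}. f S)"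
    using assms by (intro sum.swap_restrict) auto
  also have "\<dots> = (\<Sum>S\<in>Pow I. real (card S) * f S)"
  proof (intro sum.cong refl)
    fix S assume "S \<in> Pow I"
    then have "{j. j \<in> I \<and> j \<in> S} = S" by auto
    then show "(\<Sum>j\<in>{j. j \<in> I \<and> j \<in> S}. f S) = real (card S) * f S" by simp
  qed
  finally show ?thesis .
qed

text \<open>Here \<open>a I g\<close> stands for \<open>E \<Prod>\<^sub>i\<^sub>\<in>\<^sub>I \<langle>g\<^sub>i, Z\<rangle>\<close> and \<open>p g\<close> for \<open>\<langle>g, \<pi>\<rangle>\<close>. Let \<open>X I\<close> be the right-hand side of
  the recursion. Inserting the fixed point equation into each of its terms and collecting by the set \<open>S\<close> of
  factors that meet in the first atom expresses \<open>X I\<close> through \<open>a (I - S)\<close> and \<open>X (I - S)\<close>. For \<open>S \<noteq> {}\<close> the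
  induction hypothesis evaluates \<open>X (I - S)\<close>, and by \<open>beta_moment_balance\<close> the sum over these \<open>S\<close> becomes
  a multiple of the corresponding sum in the fixed point equation for \<open>a I g\<close>. Both equations can be solved,
  and the solutions agree up to the exit rate.\<close>
lemma moment_recursion:
  fixes a :: "nat set \<Rightarrow> (nat \<Rightarrow> 'a \<Rightarrow> real) \<Rightarrow> real" and p :: "('a \<Rightarrow> real) \<Rightarrow> real"
  assumes \<theta>: "0 < \<theta>"
    and G: "\<And>u v. G u \<Longrightarrow> G v \<Longrightarrow> G (\<lambda>x. u x * v x)"
    and p1: "p (\<lambda>_. 1) = 1"
    and a_cong: "\<And>I g g'. (\<And>i. i \<in> I \<Longrightarrow> g i = g' i) \<Longrightarrow> a I g = a I g'"
    and fixed: "\<And>I g. finite I \<Longrightarrow> (\<And>i. i \<in> I \<Longrightarrow> G (g i)) \<Longrightarrow>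
      a I g = (\<Sum>S\<in>Pow I. beta_moment \<theta> (card I) (card S) * p (\<lambda>x. \<Prod>i\<in>S. g i x) * a (I - S) g)"
  shows "finite I \<Longrightarrow> (\<And>i. i \<in> I \<Longrightarrow> G (g i)) \<Longrightarrow>
    exit_rate \<theta> (card I) * a I g =
      1 / 2 * (\<Sum>j\<in>I. \<Sum>i\<in>I - {j}. a (I - {j}) (g(i := \<lambda>x. g i x * g j x)))
      + \<theta> / 2 * (\<Sum>i\<in>I. p (g i) * a (I - {i}) g)"
proof (induction "card I" arbitrary: I rule: less_induct)
  case less
  define m where "m = card I"
  define b where "b = beta_moment \<theta>"
  let ?P = "\<lambda>S. p (\<lambda>x. \<Prod>i\<in>S. g i x)"
  let ?A = "\<lambda>S. a (I - S) g"
  define X where "X J = 1 / 2 * (\<Sum>j\<in>J. \<Sum>i\<in>J - {j}. a (J - {j}) (g(i := \<lambda>x. g i x * g j x)))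
      + \<theta> / 2 * (\<Sum>i\<in>J. p (g i) * a (J - {i}) g)" for J
  have fin: "finite I" by fact
  note Gg = less.prems(2)
  \<comment> \<open>In the general step a factor \<open>m - 1\<close> is cancelled, whence the separate case \<open>m = 1\<close>.\<close>
  consider "m = 0" | "m = 1" | "2 \<le> m" by linarith
  then show ?case
  proof cases
    case 1
    then show ?thesis using fin by (simp add: m_def exit_rate_eq)
  next
    case 2
    then obtain i where I: "I = {i}" unfolding m_def by (metis card_1_singletonE)
    have g1: "Gamma (1 + \<theta>) = \<theta> * Gamma \<theta>" "Gamma (2 + \<theta>) = (1 + \<theta>) * (\<theta> * Gamma \<theta>)" "Gamma \<theta> \<noteq> 0"
      using Gamma_step[of \<theta>] Gamma_step[of "\<theta> + 1"] Gamma_real_pos[of \<theta>] \<theta>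
      by (auto simp: add_ac simp del: Gamma_real_pos)
    have b11: "beta_moment \<theta> 1 1 = 1 / (1 + \<theta>)"
      using \<theta> g1(3) by (simp add: beta_moment_def g1)
    have "a {i} g = \<theta> / (1 + \<theta>) * a {i} g + 1 / (1 + \<theta>) * p (g i) * a {} g"
      using fixed[of "{i}" g] Gg b11 by (simp add: I Pow_insert Pow_empty beta_moment_0[OF \<theta>] p1)
    then have "a {i} g = (\<theta> * a {i} g + p (g i) * a {} g) / (1 + \<theta>)" by (simp add: add_divide_distrib)
    then have "a {i} g * (1 + \<theta>) = \<theta> * a {i} g + p (g i) * a {} g" using \<theta> by (simp add: eq_divide_eq)
    then have "a {i} g = p (g i) * a {} g" by (simp add: algebra_simps)
    then show ?thesis by (simp add: I exit_rate_eq)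
  next
    case 3
    have IH: "exit_rate \<theta> (card (I - T)) * a (I - T) g = X (I - T)" if "T \<subseteq> I" "T \<noteq> {}" for T
    proof -
      have "card (I - T) < card I" using that fin by (intro psubset_card_mono) auto
      from less.hyps[OF this] fin Gg show ?thesis unfolding X_def by simp
    qed
    let ?g = "\<lambda>i j. g(i := \<lambda>x. g i x * g j x)"
    define f where "f S = (real (card S) - 1) * b (m - 1) (card S - 1) * ?P S * ?A S" for S
    define h where "h j T = (\<Sum>i\<in>I - T - {j}. a (I - T - {j}) (?g i j))" for j T
    have coalesce: "(\<Sum>i\<in>I - {j}. a (I - {j}) (?g i j))
        = (\<Sum>T\<in>Pow (I - {j}). f (insert j T)) + (\<Sum>T\<in>Pow (I - {j}). b (m - 1) (card T) * ?P T * h j T)"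
      if j: "j \<in> I" for j
    proof -
      have card: "card (I - {j}) = m - 1" using j fin by (simp add: m_def)
      have "(\<Sum>i\<in>I - {j}. a (I - {j}) (?g i j))
         = (\<Sum>i\<in>I - {j}. \<Sum>T\<in>Pow (I - {j}). b (m - 1) (card T) * p (\<lambda>x. \<Prod>l\<in>T. (?g i j) l x) * a (I - {j} - T) (?g i j))"
        using j fin Gg G unfolding card[symmetric] b_def
        by (intro sum.cong refl fixed) auto
      also have "\<dots> = (\<Sum>T\<in>Pow (I - {j}). \<Sum>i\<in>I - {j}. b (m - 1) (card T) * p (\<lambda>x. \<Prod>l\<in>T. (?g i j) l x) * a (I - {j} - T) (?g i j))"
        by (rule sum.swap)
      also have "\<dots> = (\<Sum>T\<in>Pow (I - {j}). f (insert j T) + b (m - 1) (card T) * ?P T * h j T)"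
      proof (intro sum.cong refl)
        fix T assume "T \<in> Pow (I - {j})"
        then have T: "T \<subseteq> I - {j}" "finite T" "j \<notin> T" using fin finite_subset by auto
        let ?e = "\<lambda>i. b (m - 1) (card T) * p (\<lambda>x. \<Prod>l\<in>T. (?g i j) l x) * a (I - {j} - T) (?g i j)"
        \<comment> \<open>If \<open>i\<close> picks the first atom, then the factors that meet there include \<open>j\<close>.\<close>
        have in_T: "?e i = b (m - 1) (card T) * ?P (insert j T) * ?A (insert j T)" if i: "i \<in> T" for i
        proof -
          have "(\<Prod>l\<in>T. (?g i j) l x) = (\<Prod>l\<in>insert j T. g l x)" for x
          proof -
            have "(\<Prod>l\<in>T. (?g i j) l x) = (g i x * g j x) * (\<Prod>l\<in>T - {i}. g l x)"
              using T i by (simp add: prod.remove[of T i])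
            also have "\<dots> = (\<Prod>l\<in>insert j T. g l x)"
              using T i by (simp add: prod.remove[of T i])
            finally show ?thesis .
          qed
          moreover have "a (I - {j} - T) (?g i j) = a (I - insert j T) g"
          proof -
            have "I - {j} - T = I - insert j T" by auto
            moreover have "a (I - insert j T) (?g i j) = a (I - insert j T) g" by (rule a_cong) (use i in auto)
            ultimately show ?thesis by simp
          qed
          ultimately show ?thesis by simp
        qed
        have out_T: "?e i = b (m - 1) (card T) * ?P T * a (I - T - {j}) (?g i j)" if i: "i \<in> I - T - {j}" for i
        proof -
          have "(\<Prod>l\<in>T. (?g i j) l x) = (\<Prod>l\<in>T. g l x)" for x using i by (intro prod.cong) auto
          moreover have "I - {j} - T = I - T - {j}" by auto
          ultimately show ?thesis by simp
        qed
        have "(\<Sum>i\<in>I - {j}. ?e i) = (\<Sum>i\<in>T. ?e i) + (\<Sum>i\<in>I - T - {j}. ?e i)"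
        proof -
          have "I - {j} - T = I - T - {j}" by auto
          then show ?thesis using sum.subset_diff[of T "I - {j}" ?e] fin T by simp
        qed
        also have "(\<Sum>i\<in>T. ?e i) = (\<Sum>i\<in>T. b (m - 1) (card T) * ?P (insert j T) * ?A (insert j T))"
          by (intro sum.cong refl in_T)
        also have "\<dots> = f (insert j T)"
          using T by (simp add: f_def)
        also have "(\<Sum>i\<in>I - T - {j}. ?e i) = b (m - 1) (card T) * ?P T * h j T"
          unfolding h_def sum_distrib_left by (intro sum.cong refl out_T)
        finally show "(\<Sum>i\<in>I - {j}. ?e i) = f (insert j T) + b (m - 1) (card T) * ?P T * h j T" .
      qed
      finally show ?thesis by (simp add: sum.distrib)
    qed
    have C: "(\<Sum>j\<in>I. \<Sum>i\<in>I - {j}. a (I - {j}) (?g i j))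
       = (\<Sum>S\<in>Pow I. real (card S) * f S) + (\<Sum>T\<in>Pow I. b (m - 1) (card T) * ?P T * (\<Sum>j\<in>I - T. h j T))"
    proof -
      have "(\<Sum>j\<in>I. \<Sum>i\<in>I - {j}. a (I - {j}) (?g i j))
       = (\<Sum>j\<in>I. \<Sum>T\<in>Pow (I - {j}). f (insert j T)) + (\<Sum>j\<in>I. \<Sum>T\<in>Pow (I - {j}). b (m - 1) (card T) * ?P T * h j T)"
        by (simp add: coalesce sum.distrib)
      then show ?thesis unfolding sum_Pow_insert[OF fin] sum_Pow_remove[OF fin] by (simp add: sum_distrib_left)
    qed
    have D: "(\<Sum>i\<in>I. p (g i) * a (I - {i}) g)
       = (\<Sum>T\<in>Pow I. b (m - 1) (card T) * ?P T * (\<Sum>i\<in>I - T. p (g i) * a (I - T - {i}) g))"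
    proof -
      have "(\<Sum>i\<in>I. p (g i) * a (I - {i}) g)
         = (\<Sum>i\<in>I. \<Sum>T\<in>Pow (I - {i}). b (m - 1) (card T) * ?P T * (p (g i) * a (I - T - {i}) g))"
      proof (intro sum.cong refl)
        fix i assume i: "i \<in> I"
        have card: "card (I - {i}) = m - 1" using i fin by (simp add: m_def)
        have "a (I - {i}) g = (\<Sum>T\<in>Pow (I - {i}). b (m - 1) (card T) * ?P T * a (I - {i} - T) g)"
          using fixed[of "I - {i}" g] fin Gg by (simp add: card b_def)
        moreover have "I - {i} - T = I - T - {i}" for T by auto
        ultimately show "p (g i) * a (I - {i}) g
           = (\<Sum>T\<in>Pow (I - {i}). b (m - 1) (card T) * ?P T * (p (g i) * a (I - T - {i}) g))"
          by (simp add: sum_distrib_left mult_ac)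
      qed
      then show ?thesis unfolding sum_Pow_remove[OF fin] by (simp add: sum_distrib_left)
    qed
    have XI: "X I = (\<Sum>S\<in>Pow I. real (card S) / 2 * f S + b (m - 1) (card S) * ?P S * X (I - S))"
    proof -
      have "X I = (\<Sum>S\<in>Pow I. real (card S) / 2 * f S) + (\<Sum>S\<in>Pow I. b (m - 1) (card S) * ?P S *
          (1 / 2 * (\<Sum>j\<in>I - S. h j S) + \<theta> / 2 * (\<Sum>i\<in>I - S. p (g i) * a (I - S - {i}) g)))"
        unfolding X_def C D distrib_left sum.distrib sum_distrib_left by (simp add: mult_ac)
      also have "\<dots> = (\<Sum>S\<in>Pow I. real (card S) / 2 * f S) + (\<Sum>S\<in>Pow I. b (m - 1) (card S) * ?P S * X (I - S))"
      proof -
        have "I - S - T - {j} = I - S - {j} - T" for S T j by auto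
        moreover have "(\<Sum>j\<in>I - S. h j S) = (\<Sum>j\<in>I - S. \<Sum>i\<in>I - S - {j}. a (I - S - {j}) (?g i j))" for S
          by (simp add: h_def)
        ultimately show ?thesis by (simp add: X_def)
      qed
      finally show ?thesis by (simp add: sum.distrib)
    qed
    \<comment> \<open>The term \<open>S = {}\<close> reproduces the unknown itself, both in \<open>X I\<close> and in \<open>a I g\<close>.\<close>
    define R where "R = (\<Sum>S\<in>Pow I - {{}}. b m (card S) * ?P S * ?A S)"
    define K where "K = (real m + \<theta>) * (real m - 1) / 2"
    have "X I = b (m - 1) 0 * X I + (\<Sum>S\<in>Pow I - {{}}. real (card S) / 2 * f S + b (m - 1) (card S) * ?P S * X (I - S))"
      using fin by (subst XI, subst sum.remove[of _ "{}"]) (auto simp: p1)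
    also have "(\<Sum>S\<in>Pow I - {{}}. real (card S) / 2 * f S + b (m - 1) (card S) * ?P S * X (I - S))
       = (\<Sum>S\<in>Pow I - {{}}. K * (b m (card S) * ?P S * ?A S))"
    proof (intro sum.cong refl)
      fix S assume "S \<in> Pow I - {{}}"
      then have S: "S \<subseteq> I" "S \<noteq> {}" "finite S" using fin finite_subset by auto
      then have s: "1 \<le> card S" "card S \<le> m" using fin by (auto simp: m_def card_mono Suc_le_eq card_gt_0_iff)
      have "card (I - S) = m - card S" using S by (simp add: m_def card_Diff_subset)
      then have X: "X (I - S) = exit_rate \<theta> (m - card S) * ?A S" using IH[OF S(1,2)] by simp
      have "real (card S) / 2 * f S + b (m - 1) (card S) * ?P S * X (I - S) =
        (real (card S) * (real (card S) - 1) / 2 * beta_moment \<theta> (m - 1) (card S - 1)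
          + beta_moment \<theta> (m - 1) (card S) * exit_rate \<theta> (m - card S)) * ?P S * ?A S"
        unfolding X f_def b_def by (simp add: field_simps)
      also have "\<dots> = K * (b m (card S) * ?P S * ?A S)"
        unfolding beta_moment_balance[OF \<theta> s] K_def b_def by simp
      finally show "real (card S) / 2 * f S + b (m - 1) (card S) * ?P S * X (I - S) = K * (b m (card S) * ?P S * ?A S)" .
    qed
    also have "\<dots> = K * R" by (simp add: R_def sum_distrib_left)
    finally have 1: "X I = b (m - 1) 0 * X I + K * R" .
    have "a I g = (\<Sum>S\<in>Pow I. b m (card S) * ?P S * ?A S)"
      using fixed[OF fin Gg] by (simp add: b_def m_def)
    also have "\<dots> = b m 0 * a I g + R"
      unfolding R_def using fin by (subst sum.remove[of _ "{}"]) (auto simp: p1)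
    finally have 2: "a I g = b m 0 * a I g + R" .
    have b0: "b (m - 1) 0 = \<theta> / (real m - 1 + \<theta>)" "b m 0 = \<theta> / (real m + \<theta>)"
      using 3 by (simp_all add: b_def beta_moment_0[OF \<theta>] of_nat_diff)
    have pos: "0 < real m - 1 + \<theta>" "0 < real m + \<theta>" "0 < real m - 1" using 3 \<theta> by linarith+
    have 3: "X I * (real m - 1) = K * R * (real m - 1 + \<theta>)"
      using 1 pos unfolding b0 by (simp add: field_simps)
    have 4: "real m * a I g = R * (real m + \<theta>)"
      using 2 pos unfolding b0 by (simp add: field_simps)
    have "X I * (real m - 1) = (real m - 1) * (real m - 1 + \<theta>) / 2 * (R * (real m + \<theta>))"
      unfolding 3 K_def by simp
    also have "\<dots> = (real m - 1) * (exit_rate \<theta> m * a I g)"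
      unfolding 4[symmetric] exit_rate_eq by simp
    finally have "X I = exit_rate \<theta> m * a I g" using pos by simp
    then show ?thesis by (simp add: X_def m_def)
  qed
qed

section \<open>The Beta law\<close>

lemma space_beta_law: "space (beta_law a b) = {0<..<1}"
  by (simp add: beta_law_def space_restrict_space)

lemma measurable_beta_law: "f \<in> borel_measurable borel \<Longrightarrow> f \<in> borel_measurable (beta_law a b)"
  unfolding beta_law_def by (simp add: measurable_restrict_space1)

lemma nn_integral_beta_law:
  assumes \<theta>: "0 < \<theta>"
  shows "(\<integral>\<^sup>+v. ennreal (v ^ s * (1 - v) ^ r) \<partial>beta_law 1 \<theta>) = ennreal (beta_moment \<theta> (s + r) s)"
proof -
  let ?B = "Beta 1 \<theta>" and ?a = "real s + 1" and ?b = "real r + \<theta>"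
  have B: "?B = 1 / \<theta>"
    using Gamma_step[OF \<theta>] Gamma_real_pos[OF \<theta>] \<theta> by (simp add: Beta_def add_ac del: Gamma_real_pos)
  define g where "g v = v powr (?a - 1) * (1 - v) powr (?b - 1)" for v :: real
  have g: "set_integrable lborel {0..1} g"
    unfolding g_def using integrable_Beta[of ?a ?b] \<theta> by simp
  have Ig: "(LBINT v:{0..1}. g v) = Beta ?a ?b"
    using set_borel_integral_eq_integral(2)[OF g] has_integral_Beta_real[of ?a ?b] \<theta>
    unfolding g_def by (simp add: integral_unique)
  have beta: "Beta ?a ?b / ?B = beta_moment \<theta> (s + r) s"
    unfolding B by (simp add: Beta_def beta_moment_def Gamma_fact[symmetric] add_ac)
  have "(\<integral>\<^sup>+v. ennreal (v ^ s * (1 - v) ^ r) \<partial>beta_law 1 \<theta>)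
     = (\<integral>\<^sup>+v. ennreal (v powr (1 - 1) * (1 - v) powr (\<theta> - 1) / ?B) * ennreal (v ^ s * (1 - v) ^ r) \<partial>restrict_space lborel {0<..<1})"
    unfolding beta_law_def by (subst nn_integral_density) (auto intro!: measurable_restrict_space1)
  also have "\<dots> = (\<integral>\<^sup>+v. ennreal (v powr (1 - 1) * (1 - v) powr (\<theta> - 1) / ?B) * ennreal (v ^ s * (1 - v) ^ r) * indicator {0<..<1} v \<partial>lborel)"
    by (subst nn_integral_restrict_space) auto
  also have "\<dots> = (\<integral>\<^sup>+v. ennreal (1 / ?B) * ennreal (indicator {0..1} v *\<^sub>R g v) \<partial>lborel)"
  proof (rule nn_integral_cong)
    fix v :: real
    consider "v \<in> {0<..<1}" | "v = 0 \<or> v = 1" | "v \<notin> {0..1}" by fastforce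
    then show "ennreal (v powr (1 - 1) * (1 - v) powr (\<theta> - 1) / ?B) * ennreal (v ^ s * (1 - v) ^ r) * indicator {0<..<1} v
        = ennreal (1 / ?B) * ennreal (indicator {0..1} v *\<^sub>R g v)"
    proof cases
      case 1
      then have "g v = v ^ s * ((1 - v) ^ r * (1 - v) powr (\<theta> - 1))"
        unfolding g_def by (simp add: powr_realpow powr_add powr_diff field_simps)
      with 1 B \<theta> show ?thesis by (simp add: ennreal_mult'[symmetric] mult_ac)
    next
      case 2
      then show ?thesis by (auto simp: g_def)
    next
      case 3
      then have "indicator {0<..<1} v = (0 :: ennreal)" "indicator {0..1} v = (0 :: real)"
        by (auto simp: indicator_def)
      then show ?thesis by simp
    qed
  qed
  also have "\<dots> = ennreal (1 / ?B) * ennreal (\<integral>v. indicator {0..1} v *\<^sub>R g v \<partial>lborel)"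
    using g unfolding set_integrable_def
    by (subst nn_integral_cmult) (auto simp: nn_integral_eq_integral g_def intro!: arg_cong2[of _ _ _ _ "(*)"] nn_integral_eq_integral AE_I2)
  also have "\<dots> = ennreal (1 / ?B * Beta ?a ?b)"
    using B \<theta> Ig by (simp add: set_lebesgue_integral_def ennreal_mult'[symmetric])
  also have "1 / ?B * Beta ?a ?b = beta_moment \<theta> (s + r) s" using beta by simp
  finally show ?thesis .
qed

lemma beta_moment_nonneg: "0 < \<theta> \<Longrightarrow> s \<le> m \<Longrightarrow> 0 \<le> beta_moment \<theta> m s"
  using Gamma_real_pos[of "real m - real s + \<theta>"] Gamma_real_pos[of "real m + 1 + \<theta>"]
  by (simp add: beta_moment_def less_imp_le)

lemma beta_law_moment:
  assumes \<theta>: "0 < \<theta>"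
  shows "integrable (beta_law 1 \<theta>) (\<lambda>v. v ^ s * (1 - v) ^ r)"
    "(\<integral>v. v ^ s * (1 - v) ^ r \<partial>beta_law 1 \<theta>) = beta_moment \<theta> (s + r) s"
proof -
  have "has_bochner_integral (beta_law 1 \<theta>) (\<lambda>v. v ^ s * (1 - v) ^ r) (beta_moment \<theta> (s + r) s)"
    using nn_integral_beta_law[OF \<theta>] beta_moment_nonneg[OF \<theta>]
    by (intro has_bochner_integral_nn_integral AE_I2 measurable_beta_law) (auto simp: space_beta_law)
  then show "integrable (beta_law 1 \<theta>) (\<lambda>v. v ^ s * (1 - v) ^ r)"
    "(\<integral>v. v ^ s * (1 - v) ^ r \<partial>beta_law 1 \<theta>) = beta_moment \<theta> (s + r) s"
    by (auto simp: has_bochner_integral_iff)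
qed

lemma prob_space_beta_law:
  assumes \<theta>: "0 < \<theta>"
  shows "prob_space (beta_law 1 \<theta>)"
proof (rule prob_spaceI)
  have "beta_moment \<theta> 0 0 = 1" using beta_moment_0[OF \<theta>, of 0] \<theta> by simp
  then have "(\<integral>\<^sup>+v. 1 \<partial>beta_law 1 \<theta>) = 1" using nn_integral_beta_law[OF \<theta>, of 0 0] by simp
  then show "emeasure (beta_law 1 \<theta>) (space (beta_law 1 \<theta>)) = 1" by simp
qed

section \<open>Stick breaking\<close>

lemma seq_measure_split:
  fixes f :: "(nat \<Rightarrow> 'b) \<Rightarrow> real"
  assumes M: "prob_space M" and f: "f \<in> borel_measurable (Pi\<^sub>M UNIV (\<lambda>_::nat. M))"
    and bd: "\<And>\<omega>. \<omega> \<in> space (Pi\<^sub>M UNIV (\<lambda>_::nat. M)) \<Longrightarrow> \<bar>f \<omega>\<bar> \<le> C"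
  shows "(\<integral>\<omega>. f \<omega> \<partial>Pi\<^sub>M UNIV (\<lambda>_::nat. M)) = (\<integral>s. \<integral>\<omega>. f (case_nat s \<omega>) \<partial>Pi\<^sub>M UNIV (\<lambda>_::nat. M) \<partial>M)"
proof -
  interpret M: prob_space M by fact
  interpret sequence_space M by unfold_locales
  interpret S: prob_space S by (intro prob_space_PiM M)
  interpret MS: pair_prob_space M S by unfold_locales
  have m: "(\<lambda>(s, \<omega>). case_nat s \<omega>) \<in> measurable (M \<Otimes>\<^sub>M S) S" by simp
  have f': "(\<lambda>p. f (case_nat (fst p) (snd p))) \<in> borel_measurable (M \<Otimes>\<^sub>M S)"
    using measurable_compose[OF m f] by (simp add: case_prod_beta')
  have int: "integrable (M \<Otimes>\<^sub>M S) (\<lambda>(s, \<omega>). f (case_nat s \<omega>))"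
    using f' bd measurable_space[OF m]
    by (intro MS.P.integrable_const_bound[of _ C] AE_I2) (auto simp: case_prod_beta')
  have "(\<integral>\<omega>. f \<omega> \<partial>S) = (\<integral>\<omega>. f \<omega> \<partial>distr (M \<Otimes>\<^sub>M S) S (\<lambda>(s, \<omega>). case_nat s \<omega>))"
    unfolding PiM_iter ..
  also have "\<dots> = (\<integral>p. f (case_nat (fst p) (snd p)) \<partial>(M \<Otimes>\<^sub>M S))"
    using f by (subst integral_distr[OF m]) (auto simp: case_prod_beta')
  also have "\<dots> = (\<integral>s. \<integral>\<omega>. f (case_nat s \<omega>) \<partial>S \<partial>M)"
    using MS.integral_fst[OF int] by (simp add: case_prod_beta')
  finally show ?thesis .
qed

lemma stick_breaking_case_nat:
  "stick_breaking (case_nat v V) 0 = v"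
  "stick_breaking (case_nat v V) (Suc n) = (1 - v) * stick_breaking V n"
  by (simp_all add: stick_breaking_def prod.lessThan_Suc_shift del: prod.lessThan_Suc)

lemma sum_stick_breaking: "(\<Sum>i<n. stick_breaking V i) = 1 - (\<Prod>j<n. 1 - V j)"
  by (induction n) (simp_all add: stick_breaking_def algebra_simps)

lemma stick_breaking_pos: "(\<And>n. V n \<in> {0<..<1}) \<Longrightarrow> 0 < stick_breaking V n"
  unfolding stick_breaking_def by (auto intro!: mult_pos_pos prod_pos)

lemma stick_remainder:
  fixes V :: "nat \<Rightarrow> real"
  assumes "\<And>n. V n \<in> {0<..<1}"
  shows "0 \<le> (\<Prod>j<n. 1 - V j)" "(\<Prod>j<n. 1 - V j) \<le> 1"
  using assms by (auto intro!: prod_nonneg prod_le_1 simp: less_imp_le)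

lemma summable_stick_breaking:
  assumes "\<And>n. V n \<in> {0<..<1}"
  shows "summable (stick_breaking V)" "(\<Sum>n. stick_breaking V n) \<le> 1"
proof -
  have le: "(\<Sum>i<n. stick_breaking V i) \<le> 1" for n
    unfolding sum_stick_breaking using stick_remainder(1)[OF assms] by simp
  show "summable (stick_breaking V)"
  proof (rule bounded_imp_summable[of _ 1])
    show "0 \<le> stick_breaking V n" for n using stick_breaking_pos[of V n] assms by simp
    show "(\<Sum>i\<le>n. stick_breaking V i) \<le> 1" for n using le[of "Suc n"] unfolding lessThan_Suc_atMost .
  qed
  then show "(\<Sum>n. stick_breaking V n) \<le> 1" using le by (intro suminf_le_const) auto
qed

text \<open>The integral of \<open>g\<close> with respect to the random measure with atoms \<open>\<xi>\<close> and stick-breaking weights.\<close>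
definition stick_mean :: "('a \<Rightarrow> real) \<Rightarrow> (nat \<Rightarrow> real) \<Rightarrow> (nat \<Rightarrow> 'a) \<Rightarrow> real" where
  "stick_mean g V \<xi> = (\<Sum>n. stick_breaking V n * g (\<xi> n))"

lemma stick_mean_summable:
  assumes "\<And>n. V n \<in> {0<..<1}" "\<And>x. \<bar>g x\<bar> \<le> 1"
  shows "summable (\<lambda>n. \<bar>stick_breaking V n * g (\<xi> n)\<bar>)" "\<bar>stick_mean g V \<xi>\<bar> \<le> 1"
proof -
  have le: "\<bar>stick_breaking V n * g (\<xi> n)\<bar> \<le> stick_breaking V n" for n
    using stick_breaking_pos[of V n] assms by (simp add: abs_mult mult_left_le)
  show s: "summable (\<lambda>n. \<bar>stick_breaking V n * g (\<xi> n)\<bar>)"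
    by (rule summable_comparison_test'[OF summable_stick_breaking(1)[OF assms(1)], of 0]) (use le in auto)
  have "\<bar>stick_mean g V \<xi>\<bar> \<le> (\<Sum>n. \<bar>stick_breaking V n * g (\<xi> n)\<bar>)"
    unfolding stick_mean_def by (rule summable_rabs[OF s])
  also have "\<dots> \<le> (\<Sum>n. stick_breaking V n)"
    by (intro suminf_le le s summable_stick_breaking(1)[OF assms(1)])
  also have "\<dots> \<le> 1" by (rule summable_stick_breaking(2)[OF assms(1)])
  finally show "\<bar>stick_mean g V \<xi>\<bar> \<le> 1" .
qed

text \<open>The self-similarity of stick breaking: the random measure is \<open>v \<delta>\<^sub>x + (1 - v) Z\<close>, where \<open>Z\<close> is built in
  the same way from the remaining variables.\<close>
lemma stick_mean_case_nat:
  assumes "\<And>n. V n \<in> {0<..<1}" "\<And>x. \<bar>g x\<bar> \<le> 1" "v \<in> {0<..<1}"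
  shows "stick_mean g (case_nat v V) (case_nat x \<xi>) = v * g x + (1 - v) * stick_mean g V \<xi>"
proof -
  have "case_nat v V n \<in> {0<..<1}" for n using assms(1,3) by (cases n) auto
  note s = summable_rabs_cancel[OF stick_mean_summable(1)[of "case_nat v V" g "case_nat x \<xi>", OF this assms(2)]]
  have "stick_mean g (case_nat v V) (case_nat x \<xi>)
    = v * g x + (\<Sum>n. (1 - v) * (stick_breaking V n * g (\<xi> n)))"
    using suminf_split_head[OF s] unfolding stick_mean_def by (simp add: stick_breaking_case_nat mult_ac)
  also have "\<dots> = v * g x + (1 - v) * stick_mean g V \<xi>"
    unfolding stick_mean_def
    by (subst suminf_mult[OF summable_rabs_cancel[OF stick_mean_summable(1)[OF assms(1,2)]]]) simp
  finally show ?thesis .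
qed

abbreviation sticks :: "real \<Rightarrow> (nat \<Rightarrow> real) measure" where
  "sticks \<theta> \<equiv> Pi\<^sub>M UNIV (\<lambda>_::nat. beta_law 1 \<theta>)"

lemma space_sticks: "V \<in> space (sticks \<theta>) \<Longrightarrow> V n \<in> {0<..<1}"
  by (auto simp: space_PiM space_beta_law PiE_iff)

lemma prob_space_sticks: "0 < \<theta> \<Longrightarrow> prob_space (sticks \<theta>)"
  by (intro prob_space_PiM prob_space_beta_law)

lemma measurable_stick_breaking: "(\<lambda>V. stick_breaking V n) \<in> borel_measurable (sticks \<theta>)"
proof -
  have "(\<lambda>V. V i) \<in> borel_measurable (sticks \<theta>)" for i
  proof -
    have "(\<lambda>V. V i) \<in> measurable (sticks \<theta>) (beta_law 1 \<theta>)" by (rule measurable_component_singleton) simp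
    from measurable_compose[OF this measurable_beta_law[OF measurable_ident]] show ?thesis by simp
  qed
  then show ?thesis
    unfolding stick_breaking_def by (intro borel_measurable_times borel_measurable_prod borel_measurable_diff borel_measurable_const)
qed

lemma measurable_stick_mean:
  assumes g: "g \<in> borel_measurable borel" and s: "sets \<pi> = sets (borel :: 'a::metric_space measure)"
  shows "(\<lambda>p. stick_mean g (fst p) (snd p)) \<in> borel_measurable (sticks \<theta> \<Otimes>\<^sub>M Pi\<^sub>M UNIV (\<lambda>_::nat. \<pi>))"
  unfolding stick_mean_def
proof (intro borel_measurable_suminf borel_measurable_times)
  show "(\<lambda>p. stick_breaking (fst p) n) \<in> borel_measurable (sticks \<theta> \<Otimes>\<^sub>M Pi\<^sub>M UNIV (\<lambda>_::nat. \<pi>))" for n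
    by (rule measurable_compose[OF measurable_fst measurable_stick_breaking])
  have g': "g \<in> borel_measurable \<pi>" using g by (simp add: measurable_cong_sets[OF s refl])
  show "(\<lambda>p. g (snd p n)) \<in> borel_measurable (sticks \<theta> \<Otimes>\<^sub>M Pi\<^sub>M UNIV (\<lambda>_::nat. \<pi>))" for n
  proof -
    have c: "(\<lambda>\<xi>. \<xi> n) \<in> measurable (Pi\<^sub>M UNIV (\<lambda>_::nat. \<pi>)) \<pi>" by (rule measurable_component_singleton) simp
    show ?thesis by (rule measurable_compose[OF measurable_snd measurable_compose[OF c g']])
  qed
qed

text \<open>The part of the stick that is left after \<open>n\<close> breaks has mean \<open>(\<theta> / (1 + \<theta>))\<^sup>n\<close>. These means are summable,
  so that it tends to zero almost surely.\<close>
lemma AE_sticks_total: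
  assumes \<theta>: "0 < \<theta>"
  shows "AE V in sticks \<theta>. (\<Sum>n. stick_breaking V n) = 1"
proof -
  interpret B: prob_space "beta_law 1 \<theta>" by (rule prob_space_beta_law[OF \<theta>])
  interpret S: prob_space "sticks \<theta>" by (rule prob_space_sticks[OF \<theta>])
  define R where "R n V = (\<Prod>j<n. 1 - V j)" for n and V :: "nat \<Rightarrow> real"
  have R: "0 \<le> R n V" "R n V \<le> 1" if "V \<in> space (sticks \<theta>)" for n V
    unfolding R_def using stick_remainder[OF space_sticks[OF that]] by auto
  have Rm: "R n \<in> borel_measurable (sticks \<theta>)" for n
  proof -
    have "R n = (\<lambda>V. 1 - (\<Sum>i<n. stick_breaking V i))" unfolding sum_stick_breaking R_def by simp
    then show ?thesis using measurable_stick_breaking by auto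
  qed
  let ?r = "\<theta> / (1 + \<theta>)"
  have r1: "(\<integral>v. 1 - v \<partial>beta_law 1 \<theta>) = ?r"
    using beta_law_moment(2)[OF \<theta>, of 0 1] beta_moment_0[OF \<theta>, of 1] by simp
  have ER: "(\<integral>V. R n V \<partial>sticks \<theta>) = ?r ^ n" for n
  proof (induction n)
    case 0
    then show ?case by (simp add: R_def S.prob_space)
  next
    case (Suc n)
    have "(\<integral>V. R (Suc n) V \<partial>sticks \<theta>) = (\<integral>v. \<integral>V. R (Suc n) (case_nat v V) \<partial>sticks \<theta> \<partial>beta_law 1 \<theta>)"
      using R by (intro seq_measure_split[OF B.prob_space_axioms Rm, of _ 1]) auto
    also have "\<dots> = (\<integral>v. \<integral>V. (1 - v) * R n V \<partial>sticks \<theta> \<partial>beta_law 1 \<theta>)"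
      unfolding R_def by (simp add: prod.lessThan_Suc_shift del: prod.lessThan_Suc)
    also have "\<dots> = ?r ^ Suc n" by (simp add: Suc r1)
    finally show ?case .
  qed
  have "(\<integral>\<^sup>+V. (\<Sum>n. ennreal (R n V)) \<partial>sticks \<theta>) = (\<Sum>n. \<integral>\<^sup>+V. ennreal (R n V) \<partial>sticks \<theta>)"
    using Rm by (intro nn_integral_suminf) auto
  also have "\<dots> = (\<Sum>n. ennreal (?r ^ n))"
  proof (intro suminf_cong)
    fix n
    have "integrable (sticks \<theta>) (R n)"
      using R by (intro S.integrable_const_bound[of _ 1] Rm) auto
    then show "(\<integral>\<^sup>+V. ennreal (R n V) \<partial>sticks \<theta>) = ennreal (?r ^ n)"
      using R by (subst nn_integral_eq_integral) (auto simp: ER)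
  qed
  also have "\<dots> < \<infinity>"
  proof -
    have "summable (\<lambda>n. ?r ^ n)" using \<theta> by (intro summable_geometric) simp
    then show ?thesis using \<theta> by (simp add: suminf_ennreal2 less_top[symmetric])
  qed
  finally have fin: "(\<integral>\<^sup>+V. (\<Sum>n. ennreal (R n V)) \<partial>sticks \<theta>) \<noteq> \<infinity>" by simp
  have "AE V in sticks \<theta>. (\<Sum>n. ennreal (R n V)) \<noteq> \<infinity>"
    using Rm by (intro nn_integral_noteq_infinite[OF _ fin]) auto
  then show ?thesis
    using AE_space
  proof eventually_elim
    case (elim V)
    have "summable (\<lambda>n. R n V)" using elim R by (intro summable_suminf_not_top) auto
    then have "(\<lambda>n. 1 - R n V) \<longlonglongrightarrow> 1 - 0" by (intro tendsto_intros summable_LIMSEQ_zero)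
    then have "stick_breaking V sums 1" unfolding sums_def sum_stick_breaking R_def by simp
    then show ?case by (simp add: sums_unique[symmetric])
  qed
qed

section \<open>Moments of the stick-breaking measure\<close>

definition stick_moment :: "real \<Rightarrow> 'a::metric_space measure \<Rightarrow> nat set \<Rightarrow> (nat \<Rightarrow> 'a \<Rightarrow> real) \<Rightarrow> real" where
  "stick_moment \<theta> \<pi> I g =
     (\<integral>p. (\<Prod>i\<in>I. stick_mean (g i) (fst p) (snd p)) \<partial>(sticks \<theta> \<Otimes>\<^sub>M Pi\<^sub>M UNIV (\<lambda>_::nat. \<pi>)))"

lemma prod_abs_le_1:
  fixes f :: "'i \<Rightarrow> real"
  assumes "\<And>i. i \<in> I \<Longrightarrow> \<bar>f i\<bar> \<le> 1"
  shows "\<bar>\<Prod>i\<in>I. f i\<bar> \<le> 1"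
  using assms by (auto simp: abs_prod intro!: prod_le_1)

text \<open>After the first atom is split off, the product over \<open>I\<close> is expanded over the sets \<open>S\<close> of factors that pick
  this atom; the break \<open>V\<close>, the atom and the remaining measure are independent.\<close>
lemma stick_moment_fixed_point:
  fixes \<pi> :: "'a::metric_space measure"
  assumes \<theta>: "0 < \<theta>" and \<pi>: "\<pi> \<in> space (prob_algebra borel)" and I: "finite I"
    and g: "\<And>i. i \<in> I \<Longrightarrow> g i \<in> borel_measurable borel" "\<And>i x. i \<in> I \<Longrightarrow> \<bar>g i x\<bar> \<le> 1"
  shows "stick_moment \<theta> \<pi> I g = (\<Sum>S\<in>Pow I. beta_moment \<theta> (card I) (card S)
     * (\<integral>x. (\<Prod>i\<in>S. g i x) \<partial>\<pi>) * stick_moment \<theta> \<pi> (I - S) g)"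
proof -
  let ?X = "Pi\<^sub>M UNIV (\<lambda>_::nat. \<pi>)"
  interpret P: prob_space \<pi> using \<pi> by (rule M1_prob)
  interpret B: prob_space "beta_law 1 \<theta>" by (rule prob_space_beta_law[OF \<theta>])
  interpret S: prob_space "sticks \<theta>" by (rule prob_space_sticks[OF \<theta>])
  interpret X: prob_space ?X by (intro prob_space_PiM P.prob_space_axioms)
  interpret SX: pair_prob_space "sticks \<theta>" ?X by unfold_locales
  have s: "sets \<pi> = sets borel" using fin_measuresD(2)[OF M1_fin[OF \<pi>]] .
  define H where "H J V \<xi> = (\<Prod>i\<in>J. stick_mean (g i) V \<xi>)" for J V \<xi>
  have Hm: "(\<lambda>p. H J (fst p) (snd p)) \<in> borel_measurable (sticks \<theta> \<Otimes>\<^sub>M ?X)" if "J \<subseteq> I" for J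
    unfolding H_def using that g(1) s by (intro borel_measurable_prod measurable_stick_mean) auto
  have Hb: "\<bar>H J V \<xi>\<bar> \<le> 1" if "J \<subseteq> I" "V \<in> space (sticks \<theta>)" for J V \<xi>
    unfolding H_def using that g(2) space_sticks[OF that(2)] by (intro prod_abs_le_1 stick_mean_summable(2)) auto
  have Hi: "integrable (sticks \<theta> \<Otimes>\<^sub>M ?X) (\<lambda>p. H J (fst p) (snd p))" if "J \<subseteq> I" for J
    using Hb[OF that] by (intro SX.P.integrable_const_bound[of _ 1] Hm[OF that]) (auto simp: space_pair_measure)
  have Hx: "integrable ?X (H J V)" if "J \<subseteq> I" "V \<in> space (sticks \<theta>)" for J V
    using Hb[OF that] measurable_Pair2[OF Hm[OF that(1)] that(2)]
    by (intro X.integrable_const_bound[of _ 1]) auto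
  define K where "K J V = (\<integral>\<xi>. H J V \<xi> \<partial>?X)" for J V
  have Hi': "integrable (sticks \<theta> \<Otimes>\<^sub>M ?X) (\<lambda>(V, \<xi>). H J V \<xi>)" if "J \<subseteq> I" for J
    using Hi[OF that] by (simp add: case_prod_beta')
  have Ki: "integrable (sticks \<theta>) (K J)" if "J \<subseteq> I" for J
    unfolding K_def using SX.integrable_fst[OF Hi'[OF that]] .
  have mom: "stick_moment \<theta> \<pi> J g = (\<integral>V. K J V \<partial>sticks \<theta>)" if "J \<subseteq> I" for J
    unfolding stick_moment_def H_def[symmetric] K_def using SX.integral_fst[OF Hi'[OF that]]
    by (simp add: case_prod_beta')
  have Kb: "\<bar>K J V\<bar> \<le> 1" if "J \<subseteq> I" "V \<in> space (sticks \<theta>)" for J V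
    unfolding K_def using bounded_integral_le[OF X.finite_measure_axioms Hb[OF that]] by (simp add: X.prob_space)
  define p where "p S = (\<integral>x. (\<Prod>i\<in>S. g i x) \<partial>\<pi>)" for S
  have gi: "integrable \<pi> (\<lambda>x. \<Prod>i\<in>S. g i x)" if "S \<subseteq> I" for S
    using g that by (intro integrable_bounded[of _ _ 1] P.finite_measure_axioms s borel_measurable_prod prod_abs_le_1) auto
  have step: "K I (case_nat v V) = (\<Sum>S\<in>Pow I. v ^ card S * (1 - v) ^ card (I - S) * p S * K (I - S) V)"
    if v: "v \<in> {0<..<1}" and V: "V \<in> space (sticks \<theta>)" for v V
  proof -
    have vV: "case_nat v V \<in> space (sticks \<theta>)"
      using v V by (auto simp: space_PiM space_beta_law PiE_iff split: nat.split)
    have "K I (case_nat v V) = (\<integral>x. \<integral>\<xi>. H I (case_nat v V) (case_nat x \<xi>) \<partial>?X \<partial>\<pi>)"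
      unfolding K_def using borel_measurable_integrable[OF Hx[OF subset_refl vV]] Hb[OF subset_refl vV]
      by (intro seq_measure_split[OF P.prob_space_axioms]) auto
    also have "\<dots> = (\<integral>x. (\<Sum>S\<in>Pow I. v ^ card S * (1 - v) ^ card (I - S) * (\<Prod>i\<in>S. g i x) * K (I - S) V) \<partial>\<pi>)"
    proof (intro Bochner_Integration.integral_cong refl)
      fix x
      have eq: "H I (case_nat v V) (case_nat x \<xi>) =
          (\<Sum>S\<in>Pow I. v ^ card S * (1 - v) ^ card (I - S) * (\<Prod>i\<in>S. g i x) * H (I - S) V \<xi>)" for \<xi>
      proof -
        have "H I (case_nat v V) (case_nat x \<xi>) = (\<Prod>i\<in>I. v * g i x + (1 - v) * stick_mean (g i) V \<xi>)"
          unfolding H_def using space_sticks[OF V] g(2) v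
          by (intro prod.cong refl stick_mean_case_nat) auto
        also have "\<dots> = (\<Sum>S\<in>Pow I. (\<Prod>i\<in>S. v * g i x) * (\<Prod>i\<in>I - S. (1 - v) * stick_mean (g i) V \<xi>))"
          by (rule prod_add[OF I])
        also have "\<dots> = (\<Sum>S\<in>Pow I. v ^ card S * (1 - v) ^ card (I - S) * (\<Prod>i\<in>S. g i x) * H (I - S) V \<xi>)"
          unfolding H_def prod.distrib by (simp add: mult_ac)
        finally show ?thesis .
      qed
      show "(\<integral>\<xi>. H I (case_nat v V) (case_nat x \<xi>) \<partial>?X) =
          (\<Sum>S\<in>Pow I. v ^ card S * (1 - v) ^ card (I - S) * (\<Prod>i\<in>S. g i x) * K (I - S) V)"
        unfolding K_def eq using Hx[OF _ V] by (subst Bochner_Integration.integral_sum) auto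
    qed
    also have "\<dots> = (\<Sum>S\<in>Pow I. v ^ card S * (1 - v) ^ card (I - S) * p S * K (I - S) V)"
      unfolding p_def using gi by (subst Bochner_Integration.integral_sum) auto
    finally show ?thesis .
  qed
  have "stick_moment \<theta> \<pi> I g = (\<integral>v. \<integral>V. K I (case_nat v V) \<partial>sticks \<theta> \<partial>beta_law 1 \<theta>)"
    unfolding mom[OF subset_refl]
    using Kb[OF subset_refl] borel_measurable_integrable[OF Ki[OF subset_refl]]
    by (intro seq_measure_split[OF B.prob_space_axioms]) auto
  also have "\<dots> = (\<integral>v. (\<Sum>S\<in>Pow I. v ^ card S * (1 - v) ^ card (I - S) * (p S * stick_moment \<theta> \<pi> (I - S) g)) \<partial>beta_law 1 \<theta>)"
  proof (intro Bochner_Integration.integral_cong refl)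
    fix v assume "v \<in> space (beta_law 1 \<theta>)"
    then have v: "v \<in> {0<..<1}" by (simp add: space_beta_law)
    have "(\<integral>V. K I (case_nat v V) \<partial>sticks \<theta>)
       = (\<integral>V. (\<Sum>S\<in>Pow I. v ^ card S * (1 - v) ^ card (I - S) * p S * K (I - S) V) \<partial>sticks \<theta>)"
      by (intro Bochner_Integration.integral_cong refl step v)
    also have "\<dots> = (\<Sum>S\<in>Pow I. v ^ card S * (1 - v) ^ card (I - S) * (p S * stick_moment \<theta> \<pi> (I - S) g))"
      using Ki mom by (subst Bochner_Integration.integral_sum) (auto simp: mult.assoc)
    finally show "(\<integral>V. K I (case_nat v V) \<partial>sticks \<theta>)
       = (\<Sum>S\<in>Pow I. v ^ card S * (1 - v) ^ card (I - S) * (p S * stick_moment \<theta> \<pi> (I - S) g))" .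
  qed
  also have "\<dots> = (\<Sum>S\<in>Pow I. beta_moment \<theta> (card S + card (I - S)) (card S) * (p S * stick_moment \<theta> \<pi> (I - S) g))"
    using beta_law_moment[OF \<theta>] by (subst Bochner_Integration.integral_sum) auto
  also have "\<dots> = (\<Sum>S\<in>Pow I. beta_moment \<theta> (card I) (card S) * p S * stick_moment \<theta> \<pi> (I - S) g)"
  proof (intro sum.cong refl)
    fix S assume "S \<in> Pow I"
    then have "card S + card (I - S) = card I"
      using I by (metis Pow_iff card_Diff_subset card_mono finite_subset le_add_diff_inverse)
    then show "beta_moment \<theta> (card S + card (I - S)) (card S) * (p S * stick_moment \<theta> \<pi> (I - S) g)
       = beta_moment \<theta> (card I) (card S) * p S * stick_moment \<theta> \<pi> (I - S) g" by simp
  qed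
  finally show ?thesis unfolding p_def .
qed

lemma stick_moment_recursion:
  fixes \<pi> :: "'a::metric_space measure"
  assumes \<theta>: "0 < \<theta>" and \<pi>: "\<pi> \<in> space (prob_algebra borel)" and I: "finite I"
    and g: "\<And>i. i \<in> I \<Longrightarrow> g i \<in> borel_measurable borel \<and> (\<forall>x. \<bar>g i x\<bar> \<le> 1)"
  shows "exit_rate \<theta> (card I) * stick_moment \<theta> \<pi> I g =
      1 / 2 * (\<Sum>j\<in>I. \<Sum>i\<in>I - {j}. stick_moment \<theta> \<pi> (I - {j}) (g(i := \<lambda>x. g i x * g j x)))
      + \<theta> / 2 * (\<Sum>i\<in>I. (\<integral>x. g i x \<partial>\<pi>) * stick_moment \<theta> \<pi> (I - {i}) g)"
proof (rule moment_recursion[where G = "\<lambda>u. u \<in> borel_measurable borel \<and> (\<forall>x. \<bar>u x\<bar> \<le> 1)" and p = "\<lambda>u. \<integral>x. u x \<partial>\<pi>", OF \<theta> _ _ _ _ I g])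
  show "(\<integral>x. 1 \<partial>\<pi>) = (1::real)" using prob_space.prob_space[OF M1_prob[OF \<pi>]] by simp
  show "stick_moment \<theta> \<pi> I g = stick_moment \<theta> \<pi> I g'" if "\<And>i. i \<in> I \<Longrightarrow> g i = g' i" for I g g'
    unfolding stick_moment_def using that by (simp cong: prod.cong)
  show "stick_moment \<theta> \<pi> I g = (\<Sum>S\<in>Pow I. beta_moment \<theta> (card I) (card S)
     * (\<integral>x. (\<Prod>i\<in>S. g i x) \<partial>\<pi>) * stick_moment \<theta> \<pi> (I - S) g)"
    if "finite I" "\<And>i. i \<in> I \<Longrightarrow> g i \<in> borel_measurable borel \<and> (\<forall>x. \<bar>g i x\<bar> \<le> 1)" for I g
    using that by (intro stick_moment_fixed_point[OF \<theta> \<pi>]) auto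
  show "(\<lambda>x. u x * v x) \<in> borel_measurable borel \<and> (\<forall>x. \<bar>u x * v x\<bar> \<le> 1)"
    if "u \<in> borel_measurable borel \<and> (\<forall>x. \<bar>u x\<bar> \<le> 1)" "v \<in> borel_measurable borel \<and> (\<forall>x. \<bar>v x\<bar> \<le> 1)" for u v :: "'a \<Rightarrow> real"
    using that by (auto simp: abs_mult intro: mult_le_one)
qed

section \<open>Decreasing rearrangements\<close>

text \<open>Order the indices by decreasing value, with ties broken by the index. As the sequence is null and positive,
  every index has finitely many predecessors, and their number is its place in the rearrangement.\<close>
lemma decreasing_rearrangement:
  fixes p :: "nat \<Rightarrow> real"
  assumes pos: "\<And>n. 0 < p n" and null: "p \<longlonglongrightarrow> 0"
  obtains \<sigma> where "bij \<sigma>" "decseq (p \<circ> \<sigma>)"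
proof -
  define before where "before i j \<longleftrightarrow> p j < p i \<or> (p i = p j \<and> i < j)" for i j
  define D where "D i = {j. before j i}" for i
  define rank where "rank i = card (D i)" for i
  have fin: "finite (D i)" for i
  proof -
    have "eventually (\<lambda>j. p j < p i) sequentially" using order_tendstoD(2)[OF null pos] .
    then obtain N where N: "\<And>j. N \<le> j \<Longrightarrow> p j < p i" by (auto simp: eventually_sequentially)
    have "D i \<subseteq> {..<N}"
    proof
      fix j assume "j \<in> D i"
      then show "j \<in> {..<N}" using N[of j] by (cases "N \<le> j") (auto simp: D_def before_def)
    qed
    then show ?thesis by (rule finite_subset) simp
  qed
  have mono: "rank i < rank j" if "before i j" for i j
  proof -
    have "D i \<subset> D j" using that by (auto simp: D_def before_def)
    then show ?thesis unfolding rank_def by (rule psubset_card_mono[OF fin])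
  qed
  have total: "before i j \<or> before j i" if "i \<noteq> j" for i j
    using that by (auto simp: before_def)
  have inj: "inj rank"
    by (rule injI) (metis total mono less_irrefl)
  have surj: "surj rank"
    unfolding surj_def
  proof
    fix n
    have "infinite (range rank)" using inj finite_imageD infinite_UNIV_nat by blast
    then obtain i where i: "n < rank i"
      by (metis finite_nat_set_iff_bounded_le not_le rangeE)
    have "rank ` D i \<subseteq> {..<rank i}" using mono by (auto simp: D_def)
    moreover have "card (rank ` D i) = card {..<rank i}"
      using card_image[OF inj_on_subset[OF inj subset_UNIV], of "D i"] by (simp add: rank_def)
    ultimately have "rank ` D i = {..<rank i}" by (intro card_subset_eq) auto
    with i show "\<exists>i. n = rank i" by (metis imageE lessThan_iff)
  qed
  have bij: "bij rank" using inj surj by (simp add: bij_def)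
  show thesis
  proof (rule that)
    show "bij (inv rank)" by (rule bij_imp_bij_inv[OF bij])
    show "decseq (p \<circ> inv rank)"
    proof (rule decseq_SucI, rule ccontr)
      fix n assume "\<not> (p \<circ> inv rank) (Suc n) \<le> (p \<circ> inv rank) n"
      then have "before (inv rank (Suc n)) (inv rank n)" by (simp add: before_def)
      from mono[OF this] show False by (simp add: surj_f_inv_f[OF surj])
    qed
  qed
qed

section \<open>Atomic measures and the Dirichlet process\<close>

lemma sets_atomic_measure [simp]: "sets (atomic_measure P \<xi>) = sets borel"
  by (simp add: atomic_measure_def)

lemma space_atomic_measure [simp]: "space (atomic_measure P \<xi>) = UNIV"
  by (simp add: atomic_measure_def)

lemma emeasure_atomic_measure:
  assumes "A \<in> sets borel"
  shows "emeasure (atomic_measure P \<xi>) A = (\<Sum>n. ennreal (P n) * indicator A (\<xi> n))"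
proof -
  have "emeasure (atomic_measure P \<xi>) A = emeasure (density (count_space UNIV) (\<lambda>i. ennreal (P i))) (\<xi> -` A)"
    using assms by (simp add: atomic_measure_def emeasure_distr)
  also have "\<dots> = (\<integral>\<^sup>+n. ennreal (P n) * indicator A (\<xi> n) \<partial>count_space UNIV)"
    by (subst emeasure_density) (auto intro!: nn_integral_cong simp: indicator_def)
  finally show ?thesis by (simp add: nn_integral_count_space_nat)
qed

lemma prob_space_atomic_iff: "prob_space (atomic_measure P \<xi>) \<longleftrightarrow> (\<Sum>n. ennreal (P n)) = 1"
  using emeasure_atomic_measure[of UNIV P \<xi>] prob_space.emeasure_space_1[of "atomic_measure P \<xi>"]
  by (auto intro!: prob_spaceI)

lemma integral_atomic_measure:
  assumes P: "\<And>n. 0 \<le> P n" "summable P" and g: "g \<in> borel_measurable borel" "\<And>x. \<bar>g x\<bar> \<le> (1::real)"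
  shows "(\<integral>x. g x \<partial>atomic_measure P \<xi>) = (\<integral>n. P n * g (\<xi> n) \<partial>count_space UNIV)"
    "integrable (count_space UNIV) (\<lambda>n. P n * g (\<xi> n))"
proof -
  show int: "integrable (count_space UNIV) (\<lambda>n. P n * g (\<xi> n))"
    unfolding integrable_count_space_nat_iff
    by (rule summable_comparison_test'[OF P(2), of 0]) (use P(1) g(2) in \<open>auto simp: abs_mult mult_left_le\<close>)
  have "(\<integral>x. g x \<partial>atomic_measure P \<xi>) = (\<integral>n. g (\<xi> n) \<partial>density (count_space UNIV) (\<lambda>i. ennreal (P i)))"
    unfolding atomic_measure_def using g(1) by (subst integral_distr) auto
  also have "\<dots> = (\<integral>n. P n * g (\<xi> n) \<partial>count_space UNIV)"
    using P(1) by (subst integral_density) auto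
  finally show "(\<integral>x. g x \<partial>atomic_measure P \<xi>) = (\<integral>n. P n * g (\<xi> n) \<partial>count_space UNIV)" .
qed

text \<open>The map whose law under \<open>PD(\<theta>) \<times> \<pi>\<^bsup>\<nat>\<^esup>\<close> is the Dirichlet process.\<close>
definition atom_map :: "(nat \<Rightarrow> real) \<times> (nat \<Rightarrow> 'a::metric_space) \<Rightarrow> 'a measure" where
  "atom_map = (\<lambda>(P, \<xi>). if prob_space (atomic_measure P \<xi>) then atomic_measure P \<xi> else return borel (\<xi> 0))"

lemma measurable_atom_map:
  assumes M: "sets M = sets (Pi\<^sub>M UNIV (\<lambda>_::nat. borel :: real measure))"
    and s: "sets \<pi> = sets (borel :: 'a::metric_space measure)"
  shows "atom_map \<in> M \<Otimes>\<^sub>M Pi\<^sub>M UNIV (\<lambda>_::nat. \<pi>) \<rightarrow>\<^sub>M prob_algebra borel"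
proof -
  let ?X = "Pi\<^sub>M UNIV (\<lambda>_::nat. \<pi>)"
  have P: "(\<lambda>p. fst p n) \<in> borel_measurable (M \<Otimes>\<^sub>M ?X)" for n
  proof -
    have "(\<lambda>P. P n) \<in> borel_measurable M"
      unfolding measurable_cong_sets[OF M refl] by (rule measurable_component_singleton) simp
    then show ?thesis by (rule measurable_compose[OF measurable_fst])
  qed
  have X: "(\<lambda>p. snd p n) \<in> M \<Otimes>\<^sub>M ?X \<rightarrow>\<^sub>M borel" for n
  proof -
    have "(\<lambda>\<xi>. \<xi> n) \<in> measurable ?X \<pi>" by (rule measurable_component_singleton) simp
    then have "(\<lambda>\<xi>. \<xi> n) \<in> measurable ?X borel" unfolding measurable_cong_sets[OF refl s] .
    then show ?thesis by (rule measurable_compose[OF measurable_snd])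
  qed
  have ind: "(\<lambda>p. indicator A (snd p n) :: ennreal) \<in> borel_measurable (M \<Otimes>\<^sub>M ?X)" if "A \<in> sets borel" for A n
    by (rule measurable_compose[OF X borel_measurable_indicator[OF that]])
  have tot: "(\<lambda>p. \<Sum>n. ennreal (fst p n)) \<in> borel_measurable (M \<Otimes>\<^sub>M ?X)"
    using P by (intro borel_measurable_suminf_order measurable_compose[OF _ measurable_ennreal]) auto
  have em: "emeasure (atom_map p) A = (if (\<Sum>n. ennreal (fst p n)) = 1
      then (\<Sum>n. ennreal (fst p n) * indicator A (snd p n)) else indicator A (snd p 0))" if "A \<in> sets borel" for A p
    using that by (auto simp: atom_map_def case_prod_beta' prob_space_atomic_iff emeasure_atomic_measure)
  have prob: "prob_space (atom_map p)" for p :: "(nat \<Rightarrow> real) \<times> (nat \<Rightarrow> 'a)"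
    by (auto simp: atom_map_def case_prod_beta' prob_space_return)
  have "atom_map \<in> M \<Otimes>\<^sub>M ?X \<rightarrow>\<^sub>M subprob_algebra borel"
  proof (rule measurable_subprob_algebra)
    show "subprob_space (atom_map p)" for p :: "(nat \<Rightarrow> real) \<times> (nat \<Rightarrow> 'a)"
      using prob by (rule prob_space_imp_subprob_space)
    show "sets (atom_map p) = sets borel" for p :: "(nat \<Rightarrow> real) \<times> (nat \<Rightarrow> 'a)"
      by (auto simp: atom_map_def case_prod_beta')
    fix A :: "'a set" assume A: "A \<in> sets borel"
    show "(\<lambda>p. emeasure (atom_map p) A) \<in> borel_measurable (M \<Otimes>\<^sub>M ?X)"
      unfolding em[OF A]
    proof (intro measurable_If ind[OF A])
      show "(\<lambda>p. \<Sum>n. ennreal (fst p n) * indicator A (snd p n)) \<in> borel_measurable (M \<Otimes>\<^sub>M ?X)"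
        using P ind[OF A] by (intro borel_measurable_suminf_order borel_measurable_times measurable_compose[OF _ measurable_ennreal]) auto
      show "{p \<in> space (M \<Otimes>\<^sub>M ?X). (\<Sum>n. ennreal (fst p n)) = 1} \<in> sets (M \<Otimes>\<^sub>M ?X)"
        using tot by measurable
    qed
  qed
  then show ?thesis
    unfolding prob_algebra_def by (intro measurable_restrict_space2) (auto simp: prob)
qed

lemma measurable_ranked_sticks:
  "(\<lambda>V. ranked (stick_breaking V)) \<in> sticks \<theta> \<rightarrow>\<^sub>M Pi\<^sub>M UNIV (\<lambda>_::nat. borel)"
proof -
  have "(\<lambda>V. ranked (stick_breaking V) n) \<in> borel_measurable (sticks \<theta>)" for n
    unfolding ranked_def
  proof (rule borel_measurable_cSUP)
    show "countable {A::nat set. finite A \<and> card A = Suc n}"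
      by (rule countable_subset[OF _ countable_Collect_finite]) auto
    show "(\<lambda>V. Min (stick_breaking V ` A)) \<in> borel_measurable (sticks \<theta>)" if "A \<in> {A. finite A \<and> card A = Suc n}" for A
      using that measurable_stick_breaking by (intro borel_measurable_Min) auto
    fix V assume V: "V \<in> space (sticks \<theta>)"
    note b = space_sticks[OF V]
    have le: "stick_breaking V i \<le> 1" for i
      using sum_le_suminf[OF summable_stick_breaking(1)[of V], of "{i}"] summable_stick_breaking(2)[of V] b
        stick_breaking_pos[of V] by (simp add: less_imp_le) 
    show "bdd_above ((\<lambda>A. Min (stick_breaking V ` A)) ` {A. finite A \<and> card A = Suc n})"
    proof (rule bdd_aboveI2)
      fix A assume A: "A \<in> {A::nat set. finite A \<and> card A = Suc n}"
      then obtain a where "a \<in> A" by fastforce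
      then have "Min (stick_breaking V ` A) \<le> stick_breaking V a" using A by (intro Min_le) auto
      also have "\<dots> \<le> 1" by (rule le)
      finally show "Min (stick_breaking V ` A) \<le> 1" .
    qed
  qed
  then show ?thesis by (intro measurable_PiM_single') (auto simp: space_PiM)
qed

lemma suminf_permute:
  assumes "bij \<tau>" "integrable (count_space UNIV) (f :: nat \<Rightarrow> real)"
  shows "(\<Sum>n. f (\<tau> n)) = (\<Sum>n. f n)"
proof -
  have "integrable (count_space UNIV) (\<lambda>n. f (\<tau> n))"
    using integrable_bij_count_space[OF assms(1)] assms(2) by blast
  then show ?thesis
    using integral_bij_count_space[OF assms(1), of f] assms(2) by (simp add: integral_count_space_nat)
qed

text \<open>Ranking permutes the weights by a permutation that depends on \<open>V\<close> only, and for fixed \<open>V\<close> the inverse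
  permutation of the atoms preserves their law.\<close>
lemma ranked_moment:
  fixes \<pi> :: "'a::metric_space measure"
  assumes \<pi>: "\<pi> \<in> space (prob_algebra borel)" and V: "V \<in> space (sticks \<theta>)" and tot: "(\<Sum>n. stick_breaking V n) = 1"
    and g: "\<And>i. i \<in> I \<Longrightarrow> g i \<in> borel_measurable borel" "\<And>i x. i \<in> I \<Longrightarrow> \<bar>g i x\<bar> \<le> 1"
  shows "(\<integral>\<xi>. (\<Prod>i\<in>I. \<integral>x. g i x \<partial>atom_map (ranked (stick_breaking V), \<xi>)) \<partial>Pi\<^sub>M UNIV (\<lambda>_::nat. \<pi>))
    = (\<integral>\<xi>. (\<Prod>i\<in>I. stick_mean (g i) V \<xi>) \<partial>Pi\<^sub>M UNIV (\<lambda>_::nat. \<pi>))"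
proof -
  let ?X = "Pi\<^sub>M UNIV (\<lambda>_::nat. \<pi>)" and ?p = "stick_breaking V"
  note b = space_sticks[OF V]
  have s: "sets \<pi> = sets borel" using fin_measuresD(2)[OF M1_fin[OF \<pi>]] .
  have pos: "0 < ?p n" for n using stick_breaking_pos b by blast
  have sum: "summable ?p" using summable_stick_breaking(1) b by blast
  obtain \<sigma> where \<sigma>: "bij \<sigma>" "decseq (?p \<circ> \<sigma>)"
    using decreasing_rearrangement[OF pos summable_LIMSEQ_zero[OF sum]] by blast
  have r: "ranked ?p = ?p \<circ> \<sigma>" by (rule ranked_eqI[OF \<sigma>])
  have intp: "integrable (count_space UNIV) ?p"
    using sum pos by (simp add: integrable_count_space_nat_iff abs_of_pos)
  then have intq: "integrable (count_space UNIV) (\<lambda>n. ?p (\<sigma> n))"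
    using integrable_bij_count_space[OF \<sigma>(1)] by blast
  then have sumq: "summable (?p \<circ> \<sigma>)"
    using pos by (simp add: integrable_count_space_nat_iff abs_of_pos comp_def)
  have "(\<Sum>n. ?p (\<sigma> n)) = 1" using suminf_permute[OF \<sigma>(1) intp] tot by simp
  then have totq: "(\<Sum>n. ennreal ((?p \<circ> \<sigma>) n)) = 1"
    using sumq pos by (subst suminf_ennreal2) (auto simp: less_imp_le comp_def)
  have T: "atom_map (ranked ?p, \<xi>) = atomic_measure (?p \<circ> \<sigma>) \<xi>" for \<xi> :: "nat \<Rightarrow> 'a"
    unfolding atom_map_def r using totq by (simp add: prob_space_atomic_iff)
  define \<tau> where "\<tau> = inv \<sigma>"
  have \<tau>: "bij \<tau>" "\<tau> (\<sigma> n) = n" for n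
    using \<sigma>(1) by (auto simp: \<tau>_def bij_imp_bij_inv bij_is_inj)
  have eq: "(\<integral>x. g i x \<partial>atom_map (ranked ?p, \<xi>)) = stick_mean (g i) V (\<lambda>n. \<xi> (\<tau> n))" if i: "i \<in> I" for i \<xi>
  proof -
    have q: "\<And>n. 0 \<le> (?p \<circ> \<sigma>) n" using pos by (simp add: less_imp_le)
    have int: "integrable (count_space UNIV) (\<lambda>n. ?p n * g i (\<xi> (\<tau> n)))"
      using integral_atomic_measure(2)[OF _ sum g(1)[OF i] g(2)[OF i], of "\<lambda>n. \<xi> (\<tau> n)"] pos by (simp add: less_imp_le)
    have "(\<integral>x. g i x \<partial>atom_map (ranked ?p, \<xi>)) = (\<integral>n. ?p (\<sigma> n) * g i (\<xi> n) \<partial>count_space UNIV)"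
      unfolding T using integral_atomic_measure(1)[OF q sumq g(1)[OF i] g(2)[OF i]] by (simp add: comp_def)
    also have "\<dots> = (\<integral>n. ?p n * g i (\<xi> (\<tau> n)) \<partial>count_space UNIV)"
      using integral_bij_count_space[OF \<sigma>(1), of "\<lambda>n. ?p n * g i (\<xi> (\<tau> n))"] by (simp add: \<tau>(2))
    also have "\<dots> = stick_mean (g i) V (\<lambda>n. \<xi> (\<tau> n))"
      unfolding stick_mean_def by (rule integral_count_space_nat[OF int])
    finally show ?thesis .
  qed
  let ?\<Psi> = "\<lambda>\<xi>. \<Prod>i\<in>I. stick_mean (g i) V \<xi>"
  have D: "distr ?X ?X (\<lambda>\<xi> n. \<xi> (\<tau> n)) = ?X"
    using distr_PiM_reindex[of UNIV "\<lambda>_. \<pi>" \<tau> UNIV] M1_prob[OF \<pi>] \<tau>(1) by (simp add: bij_is_inj restrict_UNIV)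
  have \<Psi>: "?\<Psi> \<in> borel_measurable ?X"
    using measurable_Pair2[OF measurable_stick_mean[OF g(1) s] V] by (intro borel_measurable_prod) simp
  have m: "(\<lambda>\<xi> n. \<xi> (\<tau> n)) \<in> ?X \<rightarrow>\<^sub>M ?X"
    by (intro measurable_PiM_single' measurable_component_singleton) (auto simp: space_PiM)
  have "(\<integral>\<xi>. ?\<Psi> \<xi> \<partial>?X) = (\<integral>\<xi>. ?\<Psi> \<xi> \<partial>distr ?X ?X (\<lambda>\<xi> n. \<xi> (\<tau> n)))" unfolding D ..
  also have "\<dots> = (\<integral>\<xi>. ?\<Psi> (\<lambda>n. \<xi> (\<tau> n)) \<partial>?X)" by (rule integral_distr[OF m \<Psi>])
  finally show ?thesis using eq by (simp cong: prod.cong)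
qed

lemma prob_space_dirichlet:
  assumes \<theta>: "0 < \<theta>" and \<pi>: "\<pi> \<in> space (prob_algebra borel)"
  shows "prob_space (poisson_dirichlet \<theta>)" "prob_space (dirichlet_process \<theta> \<pi>)"
    "atom_map \<in> poisson_dirichlet \<theta> \<Otimes>\<^sub>M Pi\<^sub>M UNIV (\<lambda>_::nat. \<pi>) \<rightarrow>\<^sub>M prob_algebra borel"
    "dirichlet_process \<theta> \<pi> = distr (poisson_dirichlet \<theta> \<Otimes>\<^sub>M Pi\<^sub>M UNIV (\<lambda>_::nat. \<pi>)) (prob_algebra borel) atom_map"
proof -
  show PD: "prob_space (poisson_dirichlet \<theta>)"
    unfolding poisson_dirichlet_def
    by (rule prob_space.prob_space_distr[OF prob_space_sticks[OF \<theta>] measurable_ranked_sticks])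
  show T: "atom_map \<in> poisson_dirichlet \<theta> \<Otimes>\<^sub>M Pi\<^sub>M UNIV (\<lambda>_::nat. \<pi>) \<rightarrow>\<^sub>M prob_algebra borel"
    by (rule measurable_atom_map) (simp_all add: poisson_dirichlet_def fin_measuresD(2)[OF M1_fin[OF \<pi>]])
  show DP: "dirichlet_process \<theta> \<pi> = distr (poisson_dirichlet \<theta> \<Otimes>\<^sub>M Pi\<^sub>M UNIV (\<lambda>_::nat. \<pi>)) (prob_algebra borel) atom_map"
    by (simp add: dirichlet_process_def atom_map_def)
  have "prob_space (Pi\<^sub>M UNIV (\<lambda>_::nat. \<pi>))" by (intro prob_space_PiM M1_prob[OF \<pi>])
  then interpret pair_prob_space "poisson_dirichlet \<theta>" "Pi\<^sub>M UNIV (\<lambda>_::nat. \<pi>)"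
    using PD by (simp add: pair_prob_space_def pair_sigma_finite_def prob_space_imp_sigma_finite)
  show "prob_space (dirichlet_process \<theta> \<pi>)"
    unfolding DP by (rule P.prob_space_distr[OF T])
qed

lemma dirichlet_moment:
  fixes \<pi> :: "'a::metric_space measure"
  assumes \<theta>: "0 < \<theta>" and \<pi>: "\<pi> \<in> space (prob_algebra borel)"
    and g: "\<And>i. i \<in> I \<Longrightarrow> g i \<in> borel_measurable borel" "\<And>i x. i \<in> I \<Longrightarrow> \<bar>g i x\<bar> \<le> 1"
  shows "(\<integral>\<mu>. (\<Prod>i\<in>I. \<integral>x. g i x \<partial>\<mu>) \<partial>dirichlet_process \<theta> \<pi>) = stick_moment \<theta> \<pi> I g"
    "integrable (dirichlet_process \<theta> \<pi>) (\<lambda>\<mu>. \<Prod>i\<in>I. \<integral>x. g i x \<partial>\<mu>)"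
proof -
  let ?X = "Pi\<^sub>M UNIV (\<lambda>_::nat. \<pi>)" and ?PD = "poisson_dirichlet \<theta>"
  note D = prob_space_dirichlet[OF \<theta> \<pi>]
  interpret S: prob_space "sticks \<theta>" by (rule prob_space_sticks[OF \<theta>])
  interpret PD: prob_space ?PD by (rule D(1))
  interpret X: prob_space ?X by (intro prob_space_PiM M1_prob[OF \<pi>])
  interpret PX: pair_prob_space ?PD ?X by unfold_locales
  interpret SX: pair_prob_space "sticks \<theta>" ?X by unfold_locales
  have s: "sets \<pi> = sets borel" using fin_measuresD(2)[OF M1_fin[OF \<pi>]] .
  define H where "H \<mu> = (\<Prod>i\<in>I. \<integral>x. g i x \<partial>\<mu>)" for \<mu>
  have Hm: "H \<in> borel_measurable (prob_algebra borel)"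
    unfolding H_def using g(1) by (intro borel_measurable_prod measurable_integral_prob_algebra)
  have Hb: "\<bar>H \<mu>\<bar> \<le> 1" if "\<mu> \<in> space (prob_algebra borel)" for \<mu>
  proof -
    have "\<bar>\<integral>x. g i x \<partial>\<mu>\<bar> \<le> 1" if "i \<in> I" for i
      using bounded_integral_le[OF fin_measuresD(1)[OF M1_fin[OF \<open>\<mu> \<in> _\<close>]], of "g i" 1] g(2)[OF that] M1_prob[OF \<open>\<mu> \<in> _\<close>]
      by (simp add: prob_space.prob_space)
    then show ?thesis unfolding H_def by (rule prod_abs_le_1)
  qed
  interpret DP: prob_space "dirichlet_process \<theta> \<pi>" by (rule D(2))
  have "H \<in> borel_measurable (dirichlet_process \<theta> \<pi>)" unfolding D(4) using Hm by simp
  then show "integrable (dirichlet_process \<theta> \<pi>) (\<lambda>\<mu>. \<Prod>i\<in>I. \<integral>x. g i x \<partial>\<mu>)"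
    unfolding H_def[symmetric]
    using Hb by (intro DP.integrable_const_bound[of _ 1]) (auto simp: D(4))
  have HT: "(\<lambda>p. H (atom_map p)) \<in> borel_measurable (?PD \<Otimes>\<^sub>M ?X)" by (rule measurable_compose[OF D(3) Hm])
  then have int: "integrable (?PD \<Otimes>\<^sub>M ?X) (\<lambda>(P, \<xi>). H (atom_map (P, \<xi>)))"
    using Hb measurable_space[OF D(3)] by (intro PX.P.integrable_const_bound[of _ 1] AE_I2) auto
  define J where "J P = (\<integral>\<xi>. H (atom_map (P, \<xi>)) \<partial>?X)" for P
  have Jm: "J \<in> borel_measurable ?PD"
    unfolding J_def using borel_measurable_integrable[OF PX.integrable_fst[OF int]] .
  have Jm': "J \<in> borel_measurable (Pi\<^sub>M UNIV (\<lambda>_::nat. borel))"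
    using Jm unfolding poisson_dirichlet_def by simp
  have "(\<integral>\<mu>. H \<mu> \<partial>dirichlet_process \<theta> \<pi>) = (\<integral>p. H (atom_map p) \<partial>(?PD \<Otimes>\<^sub>M ?X))"
    unfolding D(4) by (rule integral_distr[OF D(3) Hm])
  also have "\<dots> = (\<integral>P. J P \<partial>?PD)"
    using PX.integral_fst[OF int] by (simp add: J_def case_prod_beta')
  also have "\<dots> = (\<integral>V. J (ranked (stick_breaking V)) \<partial>sticks \<theta>)"
    unfolding poisson_dirichlet_def by (rule integral_distr[OF measurable_ranked_sticks Jm'])
  also have "\<dots> = (\<integral>V. (\<integral>\<xi>. (\<Prod>i\<in>I. stick_mean (g i) V \<xi>) \<partial>?X) \<partial>sticks \<theta>)"
  proof (rule integral_cong_AE)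
    show "(\<lambda>V. J (ranked (stick_breaking V))) \<in> borel_measurable (sticks \<theta>)"
      by (rule measurable_compose[OF measurable_ranked_sticks Jm'])
    have "(\<lambda>p. \<Prod>i\<in>I. stick_mean (g i) (fst p) (snd p)) \<in> borel_measurable (sticks \<theta> \<Otimes>\<^sub>M ?X)"
      using g(1) s by (intro borel_measurable_prod measurable_stick_mean)
    then show "(\<lambda>V. \<integral>\<xi>. (\<Prod>i\<in>I. stick_mean (g i) V \<xi>) \<partial>?X) \<in> borel_measurable (sticks \<theta>)"
      by (intro X.borel_measurable_lebesgue_integral) (simp add: case_prod_beta')
    show "AE V in sticks \<theta>. J (ranked (stick_breaking V)) = (\<integral>\<xi>. (\<Prod>i\<in>I. stick_mean (g i) V \<xi>) \<partial>?X)"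
      using AE_sticks_total[OF \<theta>] AE_space
    proof eventually_elim
      case (elim V)
      show ?case unfolding J_def H_def by (rule ranked_moment[OF \<pi> elim(2,1) g])
    qed
  qed
  also have "\<dots> = stick_moment \<theta> \<pi> I g"
  proof -
    have "(\<lambda>p. \<Prod>i\<in>I. stick_mean (g i) (fst p) (snd p)) \<in> borel_measurable (sticks \<theta> \<Otimes>\<^sub>M ?X)"
      using g(1) s by (intro borel_measurable_prod measurable_stick_mean)
    then have "integrable (sticks \<theta> \<Otimes>\<^sub>M ?X) (\<lambda>(V, \<xi>). \<Prod>i\<in>I. stick_mean (g i) V \<xi>)"
      using g(2) space_sticks
      by (intro SX.P.integrable_const_bound[of _ 1] AE_I2)
         (auto simp: case_prod_beta' space_pair_measure intro!: prod_abs_le_1 stick_mean_summable(2))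
    from SX.integral_fst[OF this] show ?thesis by (simp add: stick_moment_def case_prod_beta')
  qed
  finally show "(\<integral>\<mu>. (\<Prod>i\<in>I. \<integral>x. g i x \<partial>\<mu>) \<partial>dirichlet_process \<theta> \<pi>) = stick_moment \<theta> \<pi> I g"
    unfolding H_def .
qed

section \<open>Moments of the Dirichlet process\<close>

lemma prod_insert_coord:
  fixes G :: "nat \<Rightarrow> 'a \<Rightarrow> real"
  assumes j: "j < m"
  defines "h \<equiv> \<lambda>l. if l < j then l else Suc l"
  shows "(\<Prod>l<m. G l (insert_coord m j a x l)) = G j a * (\<Prod>l<m - 1. G (h l) (x l))"
    "(\<Prod>l<m - 1. F (h l)) = (\<Prod>l\<in>{..<m} - {j}. (F l :: real))"
proof -
  have bij: "bij_betw h {..<m-1} ({..<m} - {j})"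
    unfolding h_def using j
    by (intro bij_betwI[of _ _ _ "\<lambda>l. if l < j then l else l - 1"]) (auto split: if_splits)
  show re: "(\<Prod>l<m - 1. F (h l)) = (\<Prod>l\<in>{..<m} - {j}. (F l :: real))" for F
    by (rule prod.reindex_bij_betw[OF bij])
  have "(\<Prod>l<m. G l (insert_coord m j a x l))
     = G j (insert_coord m j a x j) * (\<Prod>l\<in>{..<m} - {j}. G l (insert_coord m j a x l))"
    using j by (subst prod.remove[of _ j]) auto
  also have "(\<Prod>l\<in>{..<m} - {j}. G l (insert_coord m j a x l)) = (\<Prod>l<m - 1. G (h l) (insert_coord m j a x (h l)))"
    by (rule re[symmetric])
  also have "\<dots> = (\<Prod>l<m - 1. G (h l) (x l))"
    by (intro prod.cong refl) (auto simp: h_def insert_coord_def)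
  finally show "(\<Prod>l<m. G l (insert_coord m j a x l)) = G j a * (\<Prod>l<m - 1. G (h l) (x l))"
    using j by (simp add: insert_coord_def)
qed

lemma pairing_move_product:
  fixes G :: "nat \<Rightarrow> 'a::metric_space \<Rightarrow> real"
  assumes \<mu>: "\<mu> \<in> fin_measures" and G: "\<And>i. i < m \<Longrightarrow> G i \<in> borel_measurable borel" "\<And>i x. i < m \<Longrightarrow> \<bar>G i x\<bar> \<le> 1"
  shows "i < j \<Longrightarrow> j < m \<Longrightarrow> pairing (m - 1) (snd (apply_move \<pi> (m, \<lambda>x. \<Prod>l<m. G l (x l)) (Coalesce i j))) \<mu>
      = (\<Prod>l\<in>{..<m} - {j}. \<integral>x. (G(i := \<lambda>x. G i x * G j x)) l x \<partial>\<mu>)"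
    "i < m \<Longrightarrow> pairing (m - 1) (snd (apply_move \<pi> (m, \<lambda>x. \<Prod>l<m. G l (x l)) (Integrate i))) \<mu>
      = (\<integral>x. G i x \<partial>\<pi>) * (\<Prod>l\<in>{..<m} - {i}. \<integral>x. G l x \<partial>\<mu>)"
proof -
  assume ij: "i < j" "j < m"
  let ?h = "\<lambda>l. if l < j then l else Suc l" and ?G = "G(i := \<lambda>x. G i x * G j x)"
  have "(\<Prod>l<m. G l (insert_coord m j (x i) x l)) = (\<Prod>l<m - 1. ?G (?h l) (x l))" for x
  proof -
    have "(\<Prod>l<m. G l (insert_coord m j (x i) x l)) = G j (x i) * (\<Prod>l<m - 1. G (?h l) (x l))"
      by (rule prod_insert_coord(1)[OF ij(2)])
    also have "(\<Prod>l<m - 1. G (?h l) (x l)) = G i (x i) * (\<Prod>l\<in>{..<m - 1} - {i}. G (?h l) (x l))"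
      using ij by (subst prod.remove[of _ i]) auto
    also have "(\<Prod>l\<in>{..<m - 1} - {i}. G (?h l) (x l)) = (\<Prod>l\<in>{..<m - 1} - {i}. ?G (?h l) (x l))"
      using ij by (intro prod.cong refl) auto
    also have "G j (x i) * (G i (x i) * \<dots>) = (\<Prod>l<m - 1. ?G (?h l) (x l))"
      using ij by (subst (2) prod.remove[of _ i]) (auto simp: mult_ac)
    finally show ?thesis .
  qed
  then have "pairing (m - 1) (snd (apply_move \<pi> (m, \<lambda>x. \<Prod>l<m. G l (x l)) (Coalesce i j))) \<mu>
      = pairing (m - 1) (\<lambda>x. \<Prod>l<m - 1. ?G (?h l) (x l)) \<mu>" by simp
  also have "\<dots> = (\<Prod>l<m - 1. \<integral>x. ?G (?h l) x \<partial>\<mu>)"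
    using G ij by (intro pairing_product[OF \<mu>]) (auto simp: abs_mult intro: mult_le_one borel_measurable_times)
  also have "\<dots> = (\<Prod>l\<in>{..<m} - {j}. \<integral>x. ?G l x \<partial>\<mu>)"
    by (rule prod_insert_coord(2)[OF ij(2)])
  finally show "pairing (m - 1) (snd (apply_move \<pi> (m, \<lambda>x. \<Prod>l<m. G l (x l)) (Coalesce i j))) \<mu>
      = (\<Prod>l\<in>{..<m} - {j}. \<integral>x. ?G l x \<partial>\<mu>)" .
next
  assume i: "i < m"
  let ?h = "\<lambda>l. if l < i then l else Suc l"
  have "(\<integral>a. (\<Prod>l<m. G l (insert_coord m i a x l)) \<partial>\<pi>) = (\<integral>a. G i a \<partial>\<pi>) * (\<Prod>l<m - 1. G (?h l) (x l))" for x
    unfolding prod_insert_coord(1)[OF i] by simp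
  then have "pairing (m - 1) (snd (apply_move \<pi> (m, \<lambda>x. \<Prod>l<m. G l (x l)) (Integrate i))) \<mu>
      = (\<integral>a. G i a \<partial>\<pi>) * pairing (m - 1) (\<lambda>x. \<Prod>l<m - 1. G (?h l) (x l)) \<mu>"
    by (simp add: pairing_def)
  also have "pairing (m - 1) (\<lambda>x. \<Prod>l<m - 1. G (?h l) (x l)) \<mu> = (\<Prod>l<m - 1. \<integral>x. G (?h l) x \<partial>\<mu>)"
    using G by (intro pairing_product[OF \<mu>]) auto
  also have "\<dots> = (\<Prod>l\<in>{..<m} - {i}. \<integral>x. G l x \<partial>\<mu>)"
    by (rule prod_insert_coord(2)[OF i])
  finally show "pairing (m - 1) (snd (apply_move \<pi> (m, \<lambda>x. \<Prod>l<m. G l (x l)) (Integrate i))) \<mu>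
      = (\<integral>x. G i x \<partial>\<pi>) * (\<Prod>l\<in>{..<m} - {i}. \<integral>x. G l x \<partial>\<mu>)" .
qed

lemma sum_symmetric_pairs:
  fixes K :: "nat \<Rightarrow> nat \<Rightarrow> real"
  assumes "\<And>i j. i < m \<Longrightarrow> j < m \<Longrightarrow> i \<noteq> j \<Longrightarrow> K i j = K j i"
  shows "(\<Sum>j<m. \<Sum>i\<in>{..<m} - {j}. K i j) = 2 * (\<Sum>j<m. \<Sum>i<j. K i j)"
  using assms
proof (induction m)
  case (Suc m)
  have "(\<Sum>i\<in>{..<Suc m} - {j}. K i j) = (\<Sum>i\<in>{..<m} - {j}. K i j) + K m j" if "j < m" for j
  proof -
    have "{..<Suc m} - {j} = insert m ({..<m} - {j})" using that by auto
    then show ?thesis by simp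
  qed
  then have "(\<Sum>j<m. \<Sum>i\<in>{..<Suc m} - {j}. K i j) = (\<Sum>j<m. \<Sum>i\<in>{..<m} - {j}. K i j) + (\<Sum>j<m. K m j)"
    by (simp add: sum.distrib)
  moreover have "(\<Sum>i\<in>{..<Suc m} - {m}. K i m) = (\<Sum>j<m. K j m)" by (intro sum.cong) auto
  moreover have "(\<Sum>j<m. K m j) = (\<Sum>j<m. K j m)" using Suc.prems by (intro sum.cong) auto
  ultimately show ?case using Suc by simp
qed simp

lemma stick_moment_coalesce_sym:
  assumes "finite I" "i \<in> I" "j \<in> I" "i \<noteq> j"
  shows "stick_moment \<theta> \<pi> (I - {j}) (g(i := \<lambda>x. g i x * g j x))
    = stick_moment \<theta> \<pi> (I - {i}) (g(j := \<lambda>x. g j x * g i x))"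
proof -
  have "(\<Prod>l\<in>I - {j}. stick_mean ((g(i := \<lambda>x. g i x * g j x)) l) V \<xi>)
    = (\<Prod>l\<in>I - {i}. stick_mean ((g(j := \<lambda>x. g j x * g i x)) l) V \<xi>)" for V \<xi>
  proof -
    let ?R = "\<Prod>l\<in>I - {i, j}. stick_mean (g l) V \<xi>"
    have "I - {j} - {i} = I - {i, j}" "I - {i} - {j} = I - {i, j}" by auto
    then have "(\<Prod>l\<in>I - {j}. stick_mean ((g(i := \<lambda>x. g i x * g j x)) l) V \<xi>) = stick_mean (\<lambda>x. g i x * g j x) V \<xi> * ?R"
      "(\<Prod>l\<in>I - {i}. stick_mean ((g(j := \<lambda>x. g j x * g i x)) l) V \<xi>) = stick_mean (\<lambda>x. g j x * g i x) V \<xi> * ?R"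
      using assms by (simp_all add: prod.remove[of "I - {j}" i] prod.remove[of "I - {i}" j])
    then show ?thesis by (simp add: mult.commute)
  qed
  then show ?thesis unfolding stick_moment_def by simp
qed

text \<open>For products of functions of one variable both sides are stick-breaking moments, and the claim becomes
  \<open>stick_moment_recursion\<close>.\<close>
lemma dirichlet_step_product:
  fixes G :: "nat \<Rightarrow> 'a::metric_space \<Rightarrow> real"
  assumes \<theta>: "0 < \<theta>" and \<pi>: "\<pi> \<in> space (prob_algebra borel)" and m: "1 \<le> m"
    and G: "\<And>i. i < m \<Longrightarrow> G i \<in> borel_measurable borel" "\<And>i x. i < m \<Longrightarrow> \<bar>G i x\<bar> \<le> 1"
  defines "\<psi> \<equiv> \<lambda>x. \<Prod>l<m. G l (x l)"
  shows "(\<integral>\<mu>. pairing (m - 1) (mean_step \<theta> \<pi> m \<psi>) \<mu> \<partial>dirichlet_process \<theta> \<pi>)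
     = (\<integral>\<mu>. pairing m \<psi> \<mu> \<partial>dirichlet_process \<theta> \<pi>)"
proof -
  let ?D = "dirichlet_process \<theta> \<pi>" and ?I = "{..<m}"
  have D: "\<mu> \<in> space (prob_algebra borel)" if "\<mu> \<in> space ?D" for \<mu>
    using that by (simp add: prob_space_dirichlet(4)[OF \<theta> \<pi>])
  let ?g = "\<lambda>i j. G(i := \<lambda>x. G i x * G j x)"
  let ?K = "\<lambda>i j. stick_moment \<theta> \<pi> (?I - {j}) (?g i j)"
  let ?L = "\<lambda>i. stick_moment \<theta> \<pi> (?I - {i}) G"
  have \<psi>: "bdd_meas m 1 \<psi>" unfolding \<psi>_def by (rule bdd_meas_product[OF G])
  have gij: "(?g i j) l \<in> borel_measurable borel" "\<bar>(?g i j) l x\<bar> \<le> 1" if "l < m" "i < m" "j < m" for i j l x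
    using G that by (auto simp: abs_mult intro: mult_le_one borel_measurable_times)
  have pair: "(\<integral>\<mu>. pairing m \<psi> \<mu> \<partial>?D) = stick_moment \<theta> \<pi> ?I G"
  proof -
    have "(\<integral>\<mu>. pairing m \<psi> \<mu> \<partial>?D) = (\<integral>\<mu>. (\<Prod>i<m. \<integral>x. G i x \<partial>\<mu>) \<partial>?D)"
      unfolding \<psi>_def using D G by (intro Bochner_Integration.integral_cong refl pairing_product M1_fin)
    also have "\<dots> = stick_moment \<theta> \<pi> ?I G" using G by (intro dirichlet_moment(1)[OF \<theta> \<pi>]) auto
    finally show ?thesis .
  qed
  have coal: "(\<integral>\<mu>. pairing (m - 1) (snd (apply_move \<pi> (m, \<psi>) (Coalesce i j))) \<mu> \<partial>?D) = ?K i j"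
    "integrable ?D (pairing (m - 1) (snd (apply_move \<pi> (m, \<psi>) (Coalesce i j))))" if ij: "i < j" "j < m" for i j
  proof -
    have eq: "pairing (m - 1) (snd (apply_move \<pi> (m, \<psi>) (Coalesce i j))) \<mu> = (\<Prod>l\<in>?I - {j}. \<integral>x. (?g i j) l x \<partial>\<mu>)"
      if "\<mu> \<in> space ?D" for \<mu>
      unfolding \<psi>_def by (rule pairing_move_product(1)[OF M1_fin[OF D[OF that]] G ij])
    note M = dirichlet_moment[OF \<theta> \<pi>, of "?I - {j}" "?g i j"]
    have "(\<integral>\<mu>. pairing (m - 1) (snd (apply_move \<pi> (m, \<psi>) (Coalesce i j))) \<mu> \<partial>?D)
       = (\<integral>\<mu>. (\<Prod>l\<in>?I - {j}. \<integral>x. (?g i j) l x \<partial>\<mu>) \<partial>?D)"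
      by (intro Bochner_Integration.integral_cong refl eq)
    also have "\<dots> = ?K i j" using gij ij by (intro M(1)) auto
    finally show "(\<integral>\<mu>. pairing (m - 1) (snd (apply_move \<pi> (m, \<psi>) (Coalesce i j))) \<mu> \<partial>?D) = ?K i j" .
    have "integrable ?D (\<lambda>\<mu>. \<Prod>l\<in>?I - {j}. \<integral>x. (?g i j) l x \<partial>\<mu>)" using gij ij by (intro M(2)) auto
    then show "integrable ?D (pairing (m - 1) (snd (apply_move \<pi> (m, \<psi>) (Coalesce i j))))"
      by (rule Bochner_Integration.integrable_cong[THEN iffD2, OF refl eq, rotated])
  qed
  have integ: "(\<integral>\<mu>. pairing (m - 1) (snd (apply_move \<pi> (m, \<psi>) (Integrate i))) \<mu> \<partial>?D) = (\<integral>x. G i x \<partial>\<pi>) * ?L i"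
    "integrable ?D (pairing (m - 1) (snd (apply_move \<pi> (m, \<psi>) (Integrate i))))" if i: "i < m" for i
  proof -
    have eq: "pairing (m - 1) (snd (apply_move \<pi> (m, \<psi>) (Integrate i))) \<mu> = (\<integral>x. G i x \<partial>\<pi>) * (\<Prod>l\<in>?I - {i}. \<integral>x. G l x \<partial>\<mu>)"
      if "\<mu> \<in> space ?D" for \<mu>
      unfolding \<psi>_def by (rule pairing_move_product(2)[OF M1_fin[OF D[OF that]] G i])
    note M = dirichlet_moment[OF \<theta> \<pi>, of "?I - {i}" G]
    have "(\<integral>\<mu>. pairing (m - 1) (snd (apply_move \<pi> (m, \<psi>) (Integrate i))) \<mu> \<partial>?D)
       = (\<integral>\<mu>. (\<integral>x. G i x \<partial>\<pi>) * (\<Prod>l\<in>?I - {i}. \<integral>x. G l x \<partial>\<mu>) \<partial>?D)"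
      by (intro Bochner_Integration.integral_cong refl eq)
    also have "\<dots> = (\<integral>x. G i x \<partial>\<pi>) * ?L i" using M(1) G by simp
    finally show "(\<integral>\<mu>. pairing (m - 1) (snd (apply_move \<pi> (m, \<psi>) (Integrate i))) \<mu> \<partial>?D) = (\<integral>x. G i x \<partial>\<pi>) * ?L i" .
    have "integrable ?D (\<lambda>\<mu>. (\<integral>x. G i x \<partial>\<pi>) * (\<Prod>l\<in>?I - {i}. \<integral>x. G l x \<partial>\<mu>))"
      using G by (intro integrable_mult_right M(2)) auto
    then show "integrable ?D (pairing (m - 1) (snd (apply_move \<pi> (m, \<psi>) (Integrate i))))"
      by (rule Bochner_Integration.integrable_cong[THEN iffD2, OF refl eq, rotated])
  qed
  have int: "integrable ?D (pairing (m - 1) (snd (apply_move \<pi> (m, \<psi>) v)))" if "v \<in> moves m" for v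
    using that by (cases rule: move_cases) (simp_all add: coal(2) integ(2) del: apply_move.simps One_nat_def)
  let ?w = "\<lambda>v. move_rate \<theta> v / exit_rate \<theta> m"
  have "(\<integral>\<mu>. pairing (m - 1) (mean_step \<theta> \<pi> m \<psi>) \<mu> \<partial>?D)
     = (\<integral>\<mu>. (\<Sum>v\<in>moves m. ?w v * pairing (m - 1) (snd (apply_move \<pi> (m, \<psi>) v)) \<mu>) \<partial>?D)"
    unfolding mean_step_def
    using D bdd_meas_move[OF \<psi> _ \<pi>] by (intro Bochner_Integration.integral_cong refl pairing_sum M1_fin) auto
  also have "\<dots> = (\<Sum>v\<in>moves m. ?w v * (\<integral>\<mu>. pairing (m - 1) (snd (apply_move \<pi> (m, \<psi>) v)) \<mu> \<partial>?D))"
    using int by (subst Bochner_Integration.integral_sum) auto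
  also have "\<dots> = ((\<Sum>j<m. \<Sum>i<j. ?K i j) + \<theta> / 2 * (\<Sum>i<m. (\<integral>x. G i x \<partial>\<pi>) * ?L i)) / exit_rate \<theta> m"
  proof -
    have "(\<Sum>v\<in>moves m. ?w v * (\<integral>\<mu>. pairing (m - 1) (snd (apply_move \<pi> (m, \<psi>) v)) \<mu> \<partial>?D))
       = (\<Sum>j<m. \<Sum>i<j. 1 / exit_rate \<theta> m * ?K i j) + (\<Sum>i<m. \<theta> / 2 / exit_rate \<theta> m * ((\<integral>x. G i x \<partial>\<pi>) * ?L i))"
      unfolding sum_moves by (intro arg_cong2[where f = "(+)"] sum.cong refl) (simp_all only: coal(1) integ(1) lessThan_iff move_rate.simps)
    then show ?thesis by (simp only: sum_distrib_left[symmetric] add_divide_distrib) simp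
  qed
  also have "(\<Sum>j<m. \<Sum>i<j. ?K i j) + \<theta> / 2 * (\<Sum>i<m. (\<integral>x. G i x \<partial>\<pi>) * ?L i) = exit_rate \<theta> m * stick_moment \<theta> \<pi> ?I G"
  proof -
    have "(\<Sum>j<m. \<Sum>i\<in>?I - {j}. ?K i j) = 2 * (\<Sum>j<m. \<Sum>i<j. ?K i j)"
      by (intro sum_symmetric_pairs stick_moment_coalesce_sym) auto
    moreover have "exit_rate \<theta> (card ?I) * stick_moment \<theta> \<pi> ?I G =
      1 / 2 * (\<Sum>j\<in>?I. \<Sum>i\<in>?I - {j}. ?K i j) + \<theta> / 2 * (\<Sum>i\<in>?I. (\<integral>x. G i x \<partial>\<pi>) * ?L i)"
      using G by (intro stick_moment_recursion[OF \<theta> \<pi>]) auto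
    ultimately show ?thesis by simp
  qed
  also have "exit_rate \<theta> m * stick_moment \<theta> \<pi> ?I G / exit_rate \<theta> m = (\<integral>\<mu>. pairing m \<psi> \<mu> \<partial>?D)"
    using exit_rate_pos[OF \<theta> m] by (simp add: pair)
  finally show ?thesis .
qed

lemma integrable_dirichlet_pairing:
  assumes E: "compact (UNIV :: 'a::metric_space set)" and \<theta>: "0 < \<theta>" and \<pi>: "\<pi> \<in> space (prob_algebra borel)"
    and \<psi>: "cont_fun m (\<psi> :: (nat \<Rightarrow> 'a) \<Rightarrow> real)"
  shows "integrable (dirichlet_process \<theta> \<pi>) (pairing m \<psi>)"
proof -
  interpret prob_space "dirichlet_process \<theta> \<pi>" by (rule prob_space_dirichlet(2)[OF \<theta> \<pi>])
  obtain C where C: "\<And>x. x \<in> {..<m} \<rightarrow>\<^sub>E UNIV \<Longrightarrow> \<bar>\<psi> x\<bar> \<le> C" using cont_fun_ucont(2)[OF E \<psi>] by blast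
  have "pairing m \<psi> \<in> borel_measurable (dirichlet_process \<theta> \<pi>)"
    unfolding prob_space_dirichlet(4)[OF \<theta> \<pi>] using measurable_pairing[OF E \<psi>] by simp
  moreover have "\<bar>pairing m \<psi> \<mu>\<bar> \<le> C" if "\<mu> \<in> space (dirichlet_process \<theta> \<pi>)" for \<mu>
  proof -
    have "\<mu> \<in> space (prob_algebra borel)" using that by (simp add: prob_space_dirichlet(4)[OF \<theta> \<pi>])
    then show ?thesis using pairing_bound[OF M1_fin C] M1_measure by fastforce
  qed
  ultimately show ?thesis by (intro integrable_const_bound[of _ C] AE_I2) auto
qed

text \<open>Both sides are continuous in \<open>\<psi>\<close> for the supremum norm, and sums of products are dense.\<close>
lemma dirichlet_step:
  assumes E: "compact (UNIV :: 'a::metric_space set)" and \<theta>: "0 < \<theta>" and \<pi>: "\<pi> \<in> space (prob_algebra borel)"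
    and \<psi>: "cont_fun m (\<psi> :: (nat \<Rightarrow> 'a) \<Rightarrow> real)" and m: "1 \<le> m"
  shows "(\<integral>\<mu>. pairing (m - 1) (mean_step \<theta> \<pi> m \<psi>) \<mu> \<partial>dirichlet_process \<theta> \<pi>)
     = (\<integral>\<mu>. pairing m \<psi> \<mu> \<partial>dirichlet_process \<theta> \<pi>)" (is "?l = ?r")
proof -
  let ?D = "dirichlet_process \<theta> \<pi>"
  interpret prob_space ?D by (rule prob_space_dirichlet(2)[OF \<theta> \<pi>])
  have D: "\<mu> \<in> space (prob_algebra borel)" if "\<mu> \<in> space ?D" for \<mu>
    using that by (simp add: prob_space_dirichlet(4)[OF \<theta> \<pi>])
  obtain C where C: "bdd_meas m C \<psi>" using cont_fun_ucont(2)[OF E \<psi>] bdd_meas_cont_fun[OF E \<psi>] by blast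
  have close: "\<bar>?l - ?r\<bar> \<le> 2 * e" if e: "0 < e" for e
  proof -
    obtain J :: "(nat \<Rightarrow> 'a) set" and c and G :: "(nat \<Rightarrow> 'a) \<Rightarrow> nat \<Rightarrow> 'a \<Rightarrow> real" where *:
      "finite J" "\<And>j i. continuous_on UNIV (G j i)" "\<And>j i x. \<bar>G j i x\<bar> \<le> 1"
      "\<And>x. x \<in> {..<m} \<rightarrow>\<^sub>E UNIV \<Longrightarrow> \<bar>\<psi> x - (\<Sum>j\<in>J. c j * (\<Prod>i<m. G j i (x i)))\<bar> \<le> e"
      by (rule approx_by_products[OF E \<psi> e]) (rule that)
    define f where "f j x = (\<Prod>i<m. G j i (x i))" for j and x :: "nat \<Rightarrow> 'a"
    have Gm: "G j i \<in> borel_measurable borel" for j i by (intro borel_measurable_continuous_onI *(2))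
    have f: "bdd_meas m 1 (f j)" for j unfolding f_def by (intro bdd_meas_product Gm *(3))
    have fcont: "cont_fun m (f j)" for j
      unfolding f_def cont_fun_def
      by (intro continuous_map_prod continuous_map_compose[OF continuous_map_product_projection, unfolded comp_def]) (use *(2) in auto)
    define \<eta> where "\<eta> x = (\<Sum>j\<in>J. c j * f j x)" for x
    have \<eta>: "bdd_meas m (\<Sum>j\<in>J. \<bar>c j\<bar> * 1) \<eta>" unfolding \<eta>_def by (intro bdd_meas_sum bdd_meas_cmult f *(1))
    define d where "d x = \<psi> x - \<eta> x" for x
    have d: "bdd_meas m e d"
      using bdd_meas_measurable[OF C] bdd_meas_measurable[OF \<eta>] *(4) unfolding bdd_meas_def d_def \<eta>_def f_def by auto
    have step_f: "(\<integral>\<mu>. pairing (m - 1) (mean_step \<theta> \<pi> m (f j)) \<mu> \<partial>?D) = (\<integral>\<mu>. pairing m (f j) \<mu> \<partial>?D)" for j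
      unfolding f_def by (rule dirichlet_step_product[OF \<theta> \<pi> m Gm *(3)])
    note int_f = integrable_dirichlet_pairing[OF E \<theta> \<pi> fcont]
      integrable_dirichlet_pairing[OF E \<theta> \<pi> cont_fun_mean_step[OF E fcont \<pi>]]
    \<comment> \<open>The approximation error \<open>d\<close> joins the products as one more summand, with index \<open>None\<close>, so that
      linearity of the mean step applies to all of \<open>\<psi>\<close>.\<close>
    have \<psi>_eq: "\<psi> = (\<lambda>x. \<Sum>w\<in>insert None (Some ` J). (case w of None \<Rightarrow> 1 | Some j \<Rightarrow> c j) * (case w of None \<Rightarrow> d | Some j \<Rightarrow> f j) x)"
      using *(1) by (subst sum.insert) (auto simp: fun_eq_iff sum.reindex d_def \<eta>_def)
    have bmw: "bdd_meas m (case w of None \<Rightarrow> e | Some j \<Rightarrow> 1) (case w of None \<Rightarrow> d | Some j \<Rightarrow> f j)" for w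
      using d f by (cases w) auto
    have ms: "mean_step \<theta> \<pi> m \<psi> = (\<lambda>x. \<Sum>w\<in>insert None (Some ` J). (case w of None \<Rightarrow> 1 | Some j \<Rightarrow> c j) *
        mean_step \<theta> \<pi> m (case w of None \<Rightarrow> d | Some j \<Rightarrow> f j) x)"
      by (subst \<psi>_eq, rule mean_step_sum[OF \<pi> _ bmw]) (use *(1) in simp)
    have split: "pairing m \<psi> \<mu> = pairing m d \<mu> + (\<Sum>j\<in>J. c j * pairing m (f j) \<mu>)"
      "pairing (m - 1) (mean_step \<theta> \<pi> m \<psi>) \<mu> = pairing (m - 1) (mean_step \<theta> \<pi> m d) \<mu> +
         (\<Sum>j\<in>J. c j * pairing (m - 1) (mean_step \<theta> \<pi> m (f j)) \<mu>)" if "\<mu> \<in> fin_measures" for \<mu>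
    proof -
      show "pairing m \<psi> \<mu> = pairing m d \<mu> + (\<Sum>j\<in>J. c j * pairing m (f j) \<mu>)"
        by (subst \<psi>_eq, subst pairing_sum[OF that bmw]) (use *(1) in \<open>auto simp: sum.reindex\<close>)
      show "pairing (m - 1) (mean_step \<theta> \<pi> m \<psi>) \<mu> = pairing (m - 1) (mean_step \<theta> \<pi> m d) \<mu> +
         (\<Sum>j\<in>J. c j * pairing (m - 1) (mean_step \<theta> \<pi> m (f j)) \<mu>)"
        by (subst ms, subst pairing_sum[OF that bdd_meas_mean_step[OF bmw \<pi> \<theta> m]]) (use *(1) in \<open>auto simp: sum.reindex\<close>)
    qed
    let ?S = "\<Sum>j\<in>J. c j * (\<integral>\<mu>. pairing m (f j) \<mu> \<partial>?D)"
    have close: "\<bar>(\<integral>\<mu>. F \<mu> \<partial>?D) - (\<Sum>j\<in>J. c j * (\<integral>\<mu>. H j \<mu> \<partial>?D))\<bar> \<le> e"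
      if "integrable ?D F" "\<And>j. integrable ?D (H j)" "\<And>\<mu>. \<mu> \<in> space ?D \<Longrightarrow> \<bar>F \<mu> - (\<Sum>j\<in>J. c j * H j \<mu>)\<bar> \<le> e" for F H
    proof -
      have "(\<integral>\<mu>. F \<mu> \<partial>?D) - (\<Sum>j\<in>J. c j * (\<integral>\<mu>. H j \<mu> \<partial>?D)) = (\<integral>\<mu>. F \<mu> - (\<Sum>j\<in>J. c j * H j \<mu>) \<partial>?D)"
        using that(1,2) by (simp add: Bochner_Integration.integral_sum)
      also have "\<bar>\<dots>\<bar> \<le> e * measure ?D (space ?D)"
        by (rule bounded_integral_le[OF finite_measure_axioms that(3)])
      finally show ?thesis by (simp add: prob_space)
    qed
    have "\<bar>?r - ?S\<bar> \<le> e"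
    proof (rule close[OF integrable_dirichlet_pairing[OF E \<theta> \<pi> \<psi>] int_f(1)])
      fix \<mu> assume \<mu>: "\<mu> \<in> space ?D"
      show "\<bar>pairing m \<psi> \<mu> - (\<Sum>j\<in>J. c j * pairing m (f j) \<mu>)\<bar> \<le> e"
        using pairing_bound[OF M1_fin[OF D[OF \<mu>]] bdd_meas_le[OF d]] M1_measure[OF D[OF \<mu>]]
        by (simp add: split(1)[OF M1_fin[OF D[OF \<mu>]]])
    qed
    moreover have "\<bar>?l - ?S\<bar> \<le> e"
      unfolding step_f[symmetric]
    proof (rule close[OF integrable_dirichlet_pairing[OF E \<theta> \<pi> cont_fun_mean_step[OF E \<psi> \<pi>]] int_f(2)])
      fix \<mu> assume \<mu>: "\<mu> \<in> space ?D"
      show "\<bar>pairing (m - 1) (mean_step \<theta> \<pi> m \<psi>) \<mu> - (\<Sum>j\<in>J. c j * pairing (m - 1) (mean_step \<theta> \<pi> m (f j)) \<mu>)\<bar> \<le> e"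
        using pairing_bound[OF M1_fin[OF D[OF \<mu>]], of "m - 1" "mean_step \<theta> \<pi> m d" e]
          bdd_meas_le[OF bdd_meas_mean_step[OF d \<pi> \<theta> m]] M1_measure[OF D[OF \<mu>]]
        by (simp add: split(2)[OF M1_fin[OF D[OF \<mu>]]] del: One_nat_def)
    qed
    ultimately show ?thesis by linarith
  qed
  have "\<bar>?l - ?r\<bar> \<le> 0"
  proof (rule field_le_epsilon)
    fix e :: real assume "0 < e"
    then show "\<bar>?l - ?r\<bar> \<le> 0 + e" using close[of "e / 2"] by simp
  qed
  then show ?thesis by simp
qed

lemma dirichlet_mean:
  assumes E: "compact (UNIV :: 'a::metric_space set)" and \<theta>: "0 < \<theta>" and \<pi>: "\<pi> \<in> space (prob_algebra borel)"
    and \<phi>: "cont_fun k (\<phi> :: (nat \<Rightarrow> 'a) \<Rightarrow> real)"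
  shows "(\<integral>\<mu>. pairing k \<phi> \<mu> \<partial>dirichlet_process \<theta> \<pi>) = mean_state \<theta> \<pi> k k \<phi> (\<lambda>_. undefined)"
proof -
  interpret prob_space "dirichlet_process \<theta> \<pi>" by (rule prob_space_dirichlet(2)[OF \<theta> \<pi>])
  have "(\<integral>\<mu>. pairing (k - n) (mean_state \<theta> \<pi> n k \<phi>) \<mu> \<partial>dirichlet_process \<theta> \<pi>) = (\<integral>\<mu>. pairing k \<phi> \<mu> \<partial>dirichlet_process \<theta> \<pi>)"
    if "n \<le> k" for n
    using that
  proof (induction n)
    case (Suc n)
    then show ?case
      using dirichlet_step[OF E \<theta> \<pi> cont_fun_mean_state[OF E \<pi> \<phi>, of n \<theta>]]
      unfolding mean_state_Suc by simp
  qed simp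
  from this[of k] show ?thesis by (simp add: pairing_0 prob_space)
qed

section \<open>The solution of the Stein equation and its derivatives\<close>

text \<open>Compactness makes the norm finite, so that it can be used as a real bound.\<close>
lemma sup_norm_cont_fun:
  assumes E: "compact (UNIV :: 'a::metric_space set)" and \<phi>: "cont_fun k (\<phi> :: (nat \<Rightarrow> 'a) \<Rightarrow> real)"
  obtains C where "sup_norm ({..<k} \<rightarrow>\<^sub>E UNIV) \<phi> = ereal C" "bdd_meas k C \<phi>"
proof -
  let ?S = "{..<k} \<rightarrow>\<^sub>E (UNIV :: 'a set)"
  obtain B where B: "\<And>x. x \<in> ?S \<Longrightarrow> \<bar>\<phi> x\<bar> \<le> B" using cont_fun_ucont(2)[OF E \<phi>] by blast
  have x0: "(\<lambda>l\<in>{..<k}. undefined) \<in> ?S" by simp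
  have up: "sup_norm ?S \<phi> \<le> ereal B" unfolding sup_norm_def by (intro SUP_least) (simp add: B)
  have le: "ereal \<bar>\<phi> x\<bar> \<le> sup_norm ?S \<phi>" if "x \<in> ?S" for x
    unfolding sup_norm_def using that by (rule SUP_upper)
  have "\<bar>sup_norm ?S \<phi>\<bar> \<noteq> \<infinity>"
    using up le[OF x0] by (cases "sup_norm ?S \<phi>") auto
  then obtain C where C: "sup_norm ?S \<phi> = ereal C" by (cases "sup_norm ?S \<phi>") auto
  have "bdd_meas k C \<phi>" using le unfolding C by (intro bdd_meas_cont_fun[OF E \<phi>]) simp
  with C show ?thesis by (rule that)
qed

text \<open>In terms of \<open>m = k - n\<close> the exit rate is \<open>m (m - 1 + \<theta>) / 2\<close>, so that the summands are at most
  \<open>2 / \<theta>\<close>, \<open>2 (m - 1) / (\<theta> + 1)\<close> and \<open>2 (m - 1) (m - 2) / (\<theta> + 2)\<close>; in the last two cases because the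
  numerator vanishes unless \<open>m \<ge> 2\<close>, respectively \<open>m \<ge> 3\<close>.\<close>
lemma sum_falling_factorial_exit_rate:
  assumes \<theta>: "0 < \<theta>"
  shows "(\<Sum>n<k. real (k - n) / exit_rate \<theta> (k - n)) \<le> 2 * real k / \<theta>"
    and "(\<Sum>n<k. real (k - n) * real (k - n - 1) / exit_rate \<theta> (k - n)) \<le> real k * (real k - 1) / (\<theta> + 1)"
    and "(\<Sum>n<k. real (k - n) * real (k - n - 1) * real (k - n - 1 - 1) / exit_rate \<theta> (k - n))
      \<le> 2 * real k * (real k - 1) * (real k - 2) / (3 * (\<theta> + 2))"
proof -
  have re: "(\<Sum>n<k. g (k - n)) = (\<Sum>i<k. g (Suc i))" for g :: "nat \<Rightarrow> real"
    using sum.nat_diff_reindex[of "\<lambda>i. g (Suc i)" k] by (simp add: Suc_diff_Suc cong: sum.cong_simp)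
  have quot: "a * p / (a * q / 2) = 2 * p / q" if "a \<noteq> 0" for a p q :: real
    using that by simp
  have "(\<Sum>n<k. real (k - n) / exit_rate \<theta> (k - n)) = (\<Sum>i<k. real (Suc i) / exit_rate \<theta> (Suc i))"
    by (rule re)
  also have "\<dots> \<le> (\<Sum>i<k. 2 / \<theta>)"
  proof (intro sum_mono)
    fix i
    have "real (Suc i) / exit_rate \<theta> (Suc i) = 2 / (real i + \<theta>)"
      using quot[of "real (Suc i)" 1 "real i + \<theta>"] by (simp add: exit_rate_eq)
    then show "real (Suc i) / exit_rate \<theta> (Suc i) \<le> 2 / \<theta>"
      using \<theta> by (simp add: frac_le)
  qed
  finally show "(\<Sum>n<k. real (k - n) / exit_rate \<theta> (k - n)) \<le> 2 * real k / \<theta>"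
    by (simp only: sum_constant card_lessThan times_divide_eq_right mult.commute)
  have "(\<Sum>n<k. real (k - n) * real (k - n - 1) / exit_rate \<theta> (k - n))
      = (\<Sum>i<k. real (Suc i) * real (Suc i - 1) / exit_rate \<theta> (Suc i))"
    by (rule re)
  also have "\<dots> \<le> (\<Sum>i<k. 2 * real i / (\<theta> + 1))"
  proof (intro sum_mono)
    fix i
    have "real (Suc i) * real (Suc i - 1) / exit_rate \<theta> (Suc i) = 2 * real i / (real i + \<theta>)"
      using quot[of "real (Suc i)" "real i" "real i + \<theta>"] by (simp add: exit_rate_eq)
    also have "\<dots> \<le> 2 * real i / (\<theta> + 1)"
      using \<theta> by (cases "i = 0") (auto intro!: divide_left_mono mult_pos_pos)
    finally show "real (Suc i) * real (Suc i - 1) / exit_rate \<theta> (Suc i) \<le> 2 * real i / (\<theta> + 1)" .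
  qed
  also have "\<dots> = real k * (real k - 1) / (\<theta> + 1)"
  proof -
    have "(\<Sum>i<k. 2 * real i) = real k * (real k - 1)"
      by (induction k) (simp_all add: algebra_simps)
    then show ?thesis by (simp add: sum_divide_distrib[symmetric])
  qed
  finally show "(\<Sum>n<k. real (k - n) * real (k - n - 1) / exit_rate \<theta> (k - n)) \<le> real k * (real k - 1) / (\<theta> + 1)" .
  have "(\<Sum>n<k. real (k - n) * real (k - n - 1) * real (k - n - 1 - 1) / exit_rate \<theta> (k - n))
      = (\<Sum>i<k. real (Suc i) * real (Suc i - 1) * real (Suc i - 1 - 1) / exit_rate \<theta> (Suc i))"
    by (rule re)
  also have "\<dots> \<le> (\<Sum>i<k. 2 * (real i * (real i - 1)) / (\<theta> + 2))"
  proof (intro sum_mono)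
    fix i
    have i: "real i * real (i - 1) = real i * (real i - 1)" by (cases i) auto
    have "real (Suc i) * real (Suc i - 1) * real (Suc i - 1 - 1) / exit_rate \<theta> (Suc i)
        = real (Suc i) * (real i * (real i - 1)) / (real (Suc i) * (real i + \<theta>) / 2)"
      by (simp add: exit_rate_eq mult.assoc flip: i)
    also have "\<dots> = 2 * (real i * (real i - 1)) / (real i + \<theta>)" by (rule quot) simp
    also have "\<dots> \<le> 2 * (real i * (real i - 1)) / (\<theta> + 2)"
    proof (cases "i \<le> 1")
      case True
      then have "i = 0 \<or> i = 1" by auto
      then show ?thesis by auto
    next
      case False
      then show ?thesis using \<theta> by (intro divide_left_mono) auto
    qed
    finally show "real (Suc i) * real (Suc i - 1) * real (Suc i - 1 - 1) / exit_rate \<theta> (Suc i)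
        \<le> 2 * (real i * (real i - 1)) / (\<theta> + 2)" .
  qed
  also have "\<dots> = 2 * real k * (real k - 1) * (real k - 2) / (3 * (\<theta> + 2))"
  proof -
    have "(\<Sum>i<k. 2 * (real i * (real i - 1))) = 2 * real k * (real k - 1) * (real k - 2) / 3"
      by (induction k) (simp_all add: field_simps)
    then show ?thesis unfolding sum_divide_distrib[symmetric] by (simp only: divide_divide_eq_left)
  qed
  finally show "(\<Sum>n<k. real (k - n) * real (k - n - 1) * real (k - n - 1 - 1) / exit_rate \<theta> (k - n))
      \<le> 2 * real k * (real k - 1) * (real k - 2) / (3 * (\<theta> + 2))" .
qed

text \<open>With \<open>c\<^sub>n = - 1 / \<lambda>\<^bsub>k-n\<^esub>\<close> as coefficients, the rates in \<open>fv_gen_polynomial\<close> cancel. The \<open>n\<close>-th summand is then the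
  difference of the \<open>n\<close>-th and the following mean state, paired with powers of \<open>\<mu>\<close>, so that the sum
  telescopes.\<close>
lemma
  assumes \<theta>: "0 < \<theta>" and \<pi>: "\<pi> \<in> space (prob_algebra borel)" and \<phi>: "bdd_meas k C \<phi>"
  shows stein_solution_mdifferentiable:
      "\<mu> \<in> fin_measures \<Longrightarrow> mdifferentiable (stein_solution \<theta> \<pi> k \<phi> c) x \<mu>"
      "\<mu> \<in> fin_measures \<Longrightarrow> mdifferentiable (mderiv (stein_solution \<theta> \<pi> k \<phi> c) x) y \<mu>"
      "\<mu> \<in> fin_measures \<Longrightarrow> mdifferentiable (mderiv2 (stein_solution \<theta> \<pi> k \<phi> c) x y) z \<mu>"
    and stein_solution_derivative_bounds:
      "\<mu> \<in> space (prob_algebra borel) \<Longrightarrow> \<bar>mderiv (stein_solution \<theta> \<pi> k \<phi> c) x \<mu>\<bar> \<le> 2 * real k / \<theta> * C"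
      "\<mu> \<in> space (prob_algebra borel) \<Longrightarrow> \<bar>mderiv2 (stein_solution \<theta> \<pi> k \<phi> c) x y \<mu>\<bar>
        \<le> real k * (real k - 1) / (\<theta> + 1) * C"
      "\<mu> \<in> space (prob_algebra borel) \<Longrightarrow> \<bar>mderiv3 (stein_solution \<theta> \<pi> k \<phi> c) x y z \<mu>\<bar>
        \<le> 2 * real k * (real k - 1) * (real k - 2) / (3 * (\<theta> + 2)) * C"
    and stein_solution_equation:
      "\<mu> \<in> space (prob_algebra borel) \<Longrightarrow> fv_gen_defined \<pi> (stein_solution \<theta> \<pi> k \<phi> c) \<mu>"
      "\<mu> \<in> space (prob_algebra borel) \<Longrightarrow> fv_gen \<theta> \<pi> (stein_solution \<theta> \<pi> k \<phi> c) \<mu>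
        = pairing k \<phi> \<mu> - mean_state \<theta> \<pi> k k \<phi> (\<lambda>_. undefined)"
proof -
  let ?f = "stein_solution \<theta> \<pi> k \<phi> c"
  let ?\<psi> = "\<lambda>n. mean_state \<theta> \<pi> n k \<phi>" and ?d = "\<lambda>n. k - n"
  let ?w = "\<lambda>n. - 1 / exit_rate \<theta> (k - n)"
  let ?s = "\<Sum>n<k. c / exit_rate \<theta> (k - n)"
  have \<psi>: "bdd_meas (?d n) C (?\<psi> n)" if "n \<in> {..<k}" for n
    using that by (intro bdd_meas_mean_state[OF \<theta> \<pi>] \<phi>) simp
  have f: "?f \<mu> = ?s + (\<Sum>n\<in>{..<k}. ?w n * pairing (?d n) (?\<psi> n) \<mu>)" if "\<mu> \<in> fin_measures" for \<mu>
    unfolding stein_solution_polynomial(2)[OF \<theta> \<pi> that \<phi>]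
    by (simp add: diff_divide_distrib sum_subtractf sum_negf)
  note D = mderivs_polynomial[of "{..<k}" ?d "\<lambda>_. C" ?\<psi> ?f ?s ?w, OF finite_lessThan \<psi> f]
  note G = fv_gen_polynomial[of "{..<k}" ?d "\<lambda>_. C" ?\<psi> ?f ?s ?w, OF finite_lessThan \<psi> f _ \<pi> \<theta>]
  show "mdifferentiable ?f x \<mu>" "mdifferentiable (mderiv ?f x) y \<mu>" "mdifferentiable (mderiv2 ?f x y) z \<mu>"
    if "\<mu> \<in> fin_measures" using D(1-3) that by blast+
  have rate: "0 < exit_rate \<theta> (k - n)" if "n < k" for n
    using that by (intro exit_rate_pos \<theta>) simp
  have sum_bound: "\<bar>\<Sum>n<k. ?w n * S n\<bar> \<le> (\<Sum>n<k. b n / exit_rate \<theta> (k - n)) * C"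
    if "\<And>n. n < k \<Longrightarrow> \<bar>S n\<bar> \<le> b n * C" for S b
  proof -
    have "\<bar>\<Sum>n<k. ?w n * S n\<bar> \<le> (\<Sum>n<k. \<bar>?w n * S n\<bar>)" by (rule sum_abs)
    also have "\<dots> \<le> (\<Sum>n<k. b n / exit_rate \<theta> (k - n) * C)"
    proof (intro sum_mono)
      fix n assume "n \<in> {..<k}"
      then show "\<bar>?w n * S n\<bar> \<le> b n / exit_rate \<theta> (k - n) * C"
        using that[of n] rate[of n] by (simp add: abs_mult divide_right_mono)
    qed
    finally show ?thesis by (simp add: sum_distrib_right)
  qed
  show "\<bar>mderiv ?f x \<mu>\<bar> \<le> 2 * real k / \<theta> * C"
    "\<bar>mderiv2 ?f x y \<mu>\<bar> \<le> real k * (real k - 1) / (\<theta> + 1) * C"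
    "\<bar>mderiv3 ?f x y z \<mu>\<bar> \<le> 2 * real k * (real k - 1) * (real k - 2) / (3 * (\<theta> + 2)) * C"
    if \<mu>: "\<mu> \<in> space (prob_algebra borel)"
  proof -
    note \<mu>' = M1_fin[OF \<mu>]
    have pair: "\<bar>pairing m \<psi> \<mu>\<bar> \<le> C" if "bdd_meas m C \<psi>" for m \<psi>
      using pairing_bound[OF \<mu>' bdd_meas_le[OF that]] by (simp add: M1_measure[OF \<mu>])
    have sum_le: "\<bar>\<Sum>i<m. a i\<bar> \<le> real m * B" if "\<And>i. i < m \<Longrightarrow> \<bar>a i\<bar> \<le> B" for m :: nat and a B
      using order_trans[OF sum_abs sum_bounded_above[of "{..<m}" "\<lambda>i. \<bar>a i\<bar>" B]] that by simp
    have "\<bar>mderiv ?f x \<mu>\<bar> \<le> (\<Sum>n<k. real (k - n) / exit_rate \<theta> (k - n)) * C"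
    proof (subst D(4))
      show "\<bar>\<Sum>n<k. ?w n * (\<Sum>i<k - n. pairing (k - n - 1)
          (\<lambda>w. ?\<psi> n (insert_coord (k - n) i x w)) \<mu>)\<bar> \<le> (\<Sum>n<k. real (k - n) / exit_rate \<theta> (k - n)) * C"
        by (rule sum_bound) (intro sum_le pair bdd_meas_insert \<psi>, auto)
    qed (use \<mu>' in auto)
    also have "\<dots> \<le> 2 * real k / \<theta> * C"
      by (intro mult_right_mono sum_falling_factorial_exit_rate \<theta> bdd_meas_nonneg[OF \<phi>])
    finally show "\<bar>mderiv ?f x \<mu>\<bar> \<le> 2 * real k / \<theta> * C" .
    have "\<bar>mderiv2 ?f x y \<mu>\<bar> \<le> (\<Sum>n<k. real (k - n) * real (k - n - 1) / exit_rate \<theta> (k - n)) * C"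
    proof (subst D(5))
      show "\<bar>\<Sum>n<k. ?w n * (\<Sum>i<k - n. \<Sum>l<k - n - 1. pairing (k - n - 1 - 1)
          (\<lambda>w. ?\<psi> n (insert_coord (k - n) i x (insert_coord (k - n - 1) l y w))) \<mu>)\<bar>
        \<le> (\<Sum>n<k. real (k - n) * real (k - n - 1) / exit_rate \<theta> (k - n)) * C"
        by (rule sum_bound, unfold mult.assoc) (intro sum_le pair bdd_meas_insert \<psi>, auto)
    qed (use \<mu>' in auto)
    also have "\<dots> \<le> real k * (real k - 1) / (\<theta> + 1) * C"
      by (intro mult_right_mono sum_falling_factorial_exit_rate \<theta> bdd_meas_nonneg[OF \<phi>])
    finally show "\<bar>mderiv2 ?f x y \<mu>\<bar> \<le> real k * (real k - 1) / (\<theta> + 1) * C" .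
    have "\<bar>mderiv3 ?f x y z \<mu>\<bar> \<le>
        (\<Sum>n<k. real (k - n) * real (k - n - 1) * real (k - n - 1 - 1) / exit_rate \<theta> (k - n)) * C"
    proof (subst D(6))
      show "\<bar>\<Sum>n<k. ?w n * (\<Sum>i<k - n. \<Sum>l<k - n - 1. \<Sum>r<k - n - 1 - 1. pairing (k - n - 1 - 1 - 1)
          (\<lambda>w. ?\<psi> n (insert_coord (k - n) i x (insert_coord (k - n - 1) l y (insert_coord (k - n - 1 - 1) r z w)))) \<mu>)\<bar>
        \<le> (\<Sum>n<k. real (k - n) * real (k - n - 1) * real (k - n - 1 - 1) / exit_rate \<theta> (k - n)) * C"
        by (rule sum_bound, unfold mult.assoc) (intro sum_le pair bdd_meas_insert \<psi>, auto)
    qed (use \<mu>' in auto)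
    also have "\<dots> \<le> 2 * real k * (real k - 1) * (real k - 2) / (3 * (\<theta> + 2)) * C"
      by (intro mult_right_mono sum_falling_factorial_exit_rate \<theta> bdd_meas_nonneg[OF \<phi>])
    finally show "\<bar>mderiv3 ?f x y z \<mu>\<bar> \<le> 2 * real k * (real k - 1) * (real k - 2) / (3 * (\<theta> + 2)) * C" .
  qed
  show "fv_gen_defined \<pi> ?f \<mu>"
    "fv_gen \<theta> \<pi> ?f \<mu> = pairing k \<phi> \<mu> - mean_state \<theta> \<pi> k k \<phi> (\<lambda>_. undefined)"
    if \<mu>: "\<mu> \<in> space (prob_algebra borel)"
  proof -
    show "fv_gen_defined \<pi> ?f \<mu>" by (rule G(1)) (use \<mu> in auto)
    let ?p = "\<lambda>n. pairing (k - n) (?\<psi> n) \<mu>"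
    have "fv_gen \<theta> \<pi> ?f \<mu> = (\<Sum>n<k. ?p n - ?p (Suc n))"
    proof (subst G(2), simp, simp, rule \<mu>, intro sum.cong refl)
      fix n assume "n \<in> {..<k}"
      then show "?w n * (exit_rate \<theta> (k - n) * (pairing (k - n - 1) (mean_step \<theta> \<pi> (k - n) (?\<psi> n)) \<mu> - ?p n))
          = ?p n - ?p (Suc n)"
        using rate[of n] by (simp add: mean_state_Suc del: mean_state.simps)
    qed
    also have "\<dots> = pairing k \<phi> \<mu> - ?\<psi> k (\<lambda>_. undefined)"
      using sum_lessThan_telescope'[of ?p k] by (simp add: pairing_0)
    finally show "fv_gen \<theta> \<pi> ?f \<mu> = pairing k \<phi> \<mu> - ?\<psi> k (\<lambda>_. undefined)" .
  qed
qed

theorem theorem2p1: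
  fixes \<theta> :: real and \<pi> :: "'a::metric_space measure"
    and N :: "'w measure" and Z :: "'w \<Rightarrow> 'a measure"
    and k :: nat and \<phi> :: "(nat \<Rightarrow> 'a) \<Rightarrow> real"
    and N' :: "'v measure" and Zt :: "real \<Rightarrow> 'v \<Rightarrow> 'a measure"
  assumes "0 < \<theta>"
    and "compact (UNIV :: 'a set)"
    and "\<pi> \<in> space (prob_algebra borel)"
    and "prob_space N"
    and "Z \<in> N \<rightarrow>\<^sub>M prob_algebra borel"
    and "distr N (prob_algebra borel) Z = dirichlet_process \<theta> \<pi>"
    and "1 \<le> k"
    and "cont_fun k \<phi>"
  shows "let M1 = space (prob_algebra borel);
             h = pairing k \<phi>;
             Eh = (\<integral>\<omega>. h (Z \<omega>) \<partial>N);
             f = stein_solution \<theta> \<pi> k \<phi> Eh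
         in
           \<comment> \<open>well-definedness\<close>
           integrable N (\<lambda>\<omega>. h (Z \<omega>)) \<and>
           (\<forall>\<mu>\<in>fin_measures.
              (\<forall>t\<ge>0. integrable (dual_space \<theta> \<pi> k \<phi>) (stein_integrand \<theta> k Eh \<mu> t)) \<and>
              set_integrable lborel {0..}
                (\<lambda>t. \<integral>\<omega>. stein_integrand \<theta> k Eh \<mu> t \<omega> \<partial>dual_space \<theta> \<pi> k \<phi>)) \<and>
           (\<forall>\<mu>\<in>M1. fleming_viot_process \<theta> \<pi> \<mu> N' Zt \<longrightarrow>
              (\<forall>t\<ge>0. integrable N' (\<lambda>\<omega>. h (Zt t \<omega>))) \<and>
              set_integrable lborel {0..} (\<lambda>t. (\<integral>\<omega>. h (Zt t \<omega>) \<partial>N') - Eh) \<and>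
              f \<mu> = - (LBINT t:{0..}. (\<integral>\<omega>. h (Zt t \<omega>) \<partial>N') - Eh)) \<and>
           (\<forall>\<mu>\<in>fin_measures. \<forall>x y z.
              mdifferentiable f x \<mu> \<and> mdifferentiable (mderiv f x) y \<mu> \<and>
              mdifferentiable (mderiv2 f x y) z \<mu>) \<and>
           \<comment> \<open>Stein equation\<close>
           (\<forall>\<mu>\<in>M1. fv_gen_defined \<pi> f \<mu> \<and> fv_gen \<theta> \<pi> f \<mu> = h \<mu> - Eh) \<and>
           \<comment> \<open>bounds\<close>
           (SUP x. sup_norm M1 (mderiv f x))
             \<le> ereal (2 * real k / \<theta>) * sup_norm ({..<k} \<rightarrow>\<^sub>E UNIV) \<phi> \<and>
           (SUP (x, y). sup_norm M1 (mderiv2 f x y))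
             \<le> ereal (real k * (real k - 1) / (\<theta> + 1)) * sup_norm ({..<k} \<rightarrow>\<^sub>E UNIV) \<phi> \<and>
           (SUP (x, y, z). sup_norm M1 (mderiv3 f x y z))
             \<le> ereal (2 * real k * (real k - 1) * (real k - 2) / (3 * (\<theta> + 2)))
                * sup_norm ({..<k} \<rightarrow>\<^sub>E UNIV) \<phi>"
proof -
  note \<theta> = assms(1) and E = assms(2) and \<pi> = assms(3) and Z = assms(5) and dp = assms(6) and \<phi> = assms(8)
  obtain C where C: "sup_norm ({..<k} \<rightarrow>\<^sub>E UNIV) \<phi> = ereal C" and bdd_meas: "bdd_meas k C \<phi>"
    by (rule sup_norm_cont_fun[OF E \<phi>])
  define Eh where "Eh = (\<integral>\<omega>. pairing k \<phi> (Z \<omega>) \<partial>N)"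
  note meas = measurable_pairing[OF E \<phi>]
  have "Eh = (\<integral>\<mu>. pairing k \<phi> \<mu> \<partial>distr N (prob_algebra borel) Z)"
    unfolding Eh_def by (rule integral_distr[OF Z meas, symmetric])
  then have Eh: "Eh = mean_state \<theta> \<pi> k k \<phi> (\<lambda>_. undefined)"
    unfolding dp dirichlet_mean[OF E \<theta> \<pi> \<phi>] .
  have h_int: "integrable N (\<lambda>\<omega>. pairing k \<phi> (Z \<omega>))"
    using integrable_dirichlet_pairing[OF E \<theta> \<pi> \<phi>] unfolding dp[symmetric] integrable_distr_eq[OF Z meas] .
  have fv: "(\<forall>t\<ge>0. integrable N' (\<lambda>\<omega>. pairing k \<phi> (Zt t \<omega>))) \<and>
      set_integrable lborel {0..} (\<lambda>t. (\<integral>\<omega>. pairing k \<phi> (Zt t \<omega>) \<partial>N') - Eh) \<and>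
      stein_solution \<theta> \<pi> k \<phi> Eh \<mu> = - (LBINT t:{0..}. (\<integral>\<omega>. pairing k \<phi> (Zt t \<omega>) \<partial>N') - Eh)"
    if \<mu>: "\<mu> \<in> space (prob_algebra borel)" and FV: "fleming_viot_process \<theta> \<pi> \<mu> N' Zt" for \<mu>
    using fv_pairing(4)[OF E FV \<phi> bdd_meas] fv_occupation[OF E \<theta> \<pi> FV \<phi> Eh]
    unfolding stein_solution_polynomial(2)[OF \<theta> \<pi> M1_fin[OF \<mu>] bdd_meas] by simp
  have "(SUP x. sup_norm (space (prob_algebra borel)) (mderiv (stein_solution \<theta> \<pi> k \<phi> Eh) x))
      \<le> ereal (2 * real k / \<theta>) * ereal C"
    "(SUP (x, y). sup_norm (space (prob_algebra borel)) (mderiv2 (stein_solution \<theta> \<pi> k \<phi> Eh) x y))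
      \<le> ereal (real k * (real k - 1) / (\<theta> + 1)) * ereal C"
    "(SUP (x, y, z). sup_norm (space (prob_algebra borel)) (mderiv3 (stein_solution \<theta> \<pi> k \<phi> Eh) x y z))
      \<le> ereal (2 * real k * (real k - 1) * (real k - 2) / (3 * (\<theta> + 2))) * ereal C"
    unfolding sup_norm_def times_ereal.simps(1) split_def
    by (intro SUP_least iffD2[OF ereal_less_eq(3)] stein_solution_derivative_bounds[OF \<theta> \<pi> bdd_meas]; assumption)+
  then show ?thesis
    unfolding Let_def Eh_def[symmetric] C
    using h_int stein_integrand_integral(1)[OF \<theta> \<pi> _ bdd_meas] stein_solution_polynomial(1)[OF \<theta> \<pi> _ bdd_meas] fv
      stein_solution_mdifferentiable[OF \<theta> \<pi> bdd_meas] stein_solution_equation[OF \<theta> \<pi> bdd_meas, folded Eh]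
    by (intro conjI ballI allI impI) simp_all
qed

end
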